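(* Let $n \geq 1$ and let $(G_1,G_2,G_3)$ be a graph triple, where $G_1=(V_1,E_1)$ and $G_2=(V_2,E_2)$ are $n$-vertex graphs and $G_3=(V_1\cup V_2,E_3)$ is bipartite with partite sets $V_1$ and $V_2$. Suppose that $\Delta(G_1)\leq n-2$, $\Delta(G_2)\leq n-2$, $\Delta(G_3)\leq n-1$, $|E_1|+|E_2|+|E_3|\leq 2n-3$, and the unordered pair $\{G_1,G_2\}$ is (up to isomorphism) none of the following 7 pairs: (1) $\{2K_2,\; K_1\cup K_3\}$; (2) $\{\overline{K_2}\cup K_3,\; K_2\cup K_3\}$; (3) $\{3K_2,\; \overline{K_2}\cup K_4\}$; (4) $\{\overline{K_3}\cup K_3,\; 2K_3\}$; (5) $\{2K_2\cup K_3,\; \overline{K_3}\cup K_4\}$; (6) $\{\overline{K_4}\cup K_4,\; K_2\cup 2K_3\}$; (7) $\{\overline{K_5}\cup K_4,\; 3K_3\}$. Then the triple $(G_1,G_2,G_3)$ packs.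
   Context: All graphs are finite and simple. A graph triple $(G_1,G_2,G_3)$ of size $n$ consists of two $n$-vertex graphs $G_1=(V_1,E_1)$ and $G_2=(V_2,E_2)$ on disjoint vertex sets, together with a bipartite graph $G_3=(V_1\cup V_2,E_3)$ with partite sets $V_1$ and $V_2$ (so every edge of $E_3$ joins a vertex of $V_1$ to a vertex of $V_2$). The triple packs if there is a bijection $f:V_1\to V_2$ such that $uv\in E_1$ implies $f(u)f(v)\notin E_2$, and $uf(u)\notin E_3$ for every $u\in V_1$. $\Delta(H)$ denotes the maximum degree of a graph $H$; in particular $\Delta(G_3)$ is the maximum of the $G_3$-degrees over all vertices of $V_1\cup V_2$. In the list of pairs, $\cup$ denotes vertex-disjoint union, $mH$ denotes the disjoint union of $m$ copies of $H$, and $\overline{K_m}$ denotes the edgeless graph on $m$ vertices. *)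

theory Defs
  imports Main
begin

text \<open>A graph is a pair of a vertex set and a set of edges; an edge is a two-element set of vertices.\<close>

type_synonym 'a graph = "'a set \<times> 'a set set"

abbreviation verts :: "'a graph \<Rightarrow> 'a set" where
  "verts G \<equiv> fst G"

abbreviation edges :: "'a graph \<Rightarrow> 'a set set" where
  "edges G \<equiv> snd G"

definition simple_graph :: "'a graph \<Rightarrow> bool" where
  "simple_graph G \<longleftrightarrow> finite (verts G) \<and> (\<forall>e \<in> edges G. e \<subseteq> verts G \<and> card e = 2)"

definition degree :: "'a graph \<Rightarrow> 'a \<Rightarrow> nat" where
  "degree G v = card {e \<in> edges G. v \<in> e}"

text \<open>Meaningful only for finite graphs with at least one vertex.\<close>

definition max_degree :: "'a graph \<Rightarrow> nat" where
  "max_degree G = Max (degree G ` verts G)"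

definition graph_iso :: "'a graph \<Rightarrow> 'b graph \<Rightarrow> bool" (infix "\<cong>" 50) where
  "G \<cong> H \<longleftrightarrow> (\<exists>f. bij_betw f (verts G) (verts H) \<and>
     (\<forall>u \<in> verts G. \<forall>v \<in> verts G. {u, v} \<in> edges G \<longleftrightarrow> {f u, f v} \<in> edges H))"

definition complete_graph :: "nat \<Rightarrow> nat graph" ("K\<^bsub>_\<^esub>") where
  "K\<^bsub>m\<^esub> = ({..<m}, {e. e \<subseteq> {..<m} \<and> card e = 2})"

definition edgeless_graph :: "nat \<Rightarrow> nat graph" ("K\<^sup>c\<^bsub>_\<^esub>") where
  "K\<^sup>c\<^bsub>m\<^esub> = ({..<m}, {})"

definition graph_union :: "'a graph \<Rightarrow> 'b graph \<Rightarrow> ('a + 'b) graph" (infixr "\<uplus>" 65) where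
  "G \<uplus> H = (Inl ` verts G \<union> Inr ` verts H, image Inl ` edges G \<union> image Inr ` edges H)"

definition copies :: "nat \<Rightarrow> 'a graph \<Rightarrow> (nat \<times> 'a) graph" (infixr "\<odot>" 70) where
  "m \<odot> G = ({..<m} \<times> verts G, {Pair i ` e | i e. i < m \<and> e \<in> edges G})"

definition graph_triple :: "nat \<Rightarrow> 'a graph \<Rightarrow> 'a graph \<Rightarrow> 'a graph \<Rightarrow> bool" where
  "graph_triple n G1 G2 G3 \<longleftrightarrow>
     simple_graph G1 \<and> simple_graph G2 \<and> simple_graph G3 \<and>
     card (verts G1) = n \<and> card (verts G2) = n \<and> verts G1 \<inter> verts G2 = {} \<and>
     verts G3 = verts G1 \<union> verts G2 \<and>
     (\<forall>e \<in> edges G3. \<exists>u \<in> verts G1. \<exists>v \<in> verts G2. e = {u, v})"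

definition packs :: "'a graph \<Rightarrow> 'a graph \<Rightarrow> 'a graph \<Rightarrow> bool" where
  "packs G1 G2 G3 \<longleftrightarrow> (\<exists>f. bij_betw f (verts G1) (verts G2) \<and>
     (\<forall>u v. {u, v} \<in> edges G1 \<longrightarrow> {f u, f v} \<notin> edges G2) \<and>
     (\<forall>u \<in> verts G1. {u, f u} \<notin> edges G3))"

text \<open>The unordered pair of \<open>G1\<close> and \<open>G2\<close> is, up to isomorphism, the unordered pair of \<open>H1\<close> and \<open>H2\<close>.\<close>

definition iso_pair :: "'a graph \<Rightarrow> 'a graph \<Rightarrow> 'b graph \<Rightarrow> 'c graph \<Rightarrow> bool" where
  "iso_pair G1 G2 H1 H2 \<longleftrightarrow> (G1 \<cong> H1 \<and> G2 \<cong> H2) \<or> (G1 \<cong> H2 \<and> G2 \<cong> H1)"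

definition exceptional_pair :: "'a graph \<Rightarrow> 'a graph \<Rightarrow> bool" where
  "exceptional_pair G1 G2 \<longleftrightarrow>
     iso_pair G1 G2 (2 \<odot> K\<^bsub>2\<^esub>) (K\<^bsub>1\<^esub> \<uplus> K\<^bsub>3\<^esub>) \<or>
     iso_pair G1 G2 (K\<^sup>c\<^bsub>2\<^esub> \<uplus> K\<^bsub>3\<^esub>) (K\<^bsub>2\<^esub> \<uplus> K\<^bsub>3\<^esub>) \<or>
     iso_pair G1 G2 (3 \<odot> K\<^bsub>2\<^esub>) (K\<^sup>c\<^bsub>2\<^esub> \<uplus> K\<^bsub>4\<^esub>) \<or>
     iso_pair G1 G2 (K\<^sup>c\<^bsub>3\<^esub> \<uplus> K\<^bsub>3\<^esub>) (2 \<odot> K\<^bsub>3\<^esub>) \<or>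
     iso_pair G1 G2 (2 \<odot> K\<^bsub>2\<^esub> \<uplus> K\<^bsub>3\<^esub>) (K\<^sup>c\<^bsub>3\<^esub> \<uplus> K\<^bsub>4\<^esub>) \<or>
     iso_pair G1 G2 (K\<^sup>c\<^bsub>4\<^esub> \<uplus> K\<^bsub>4\<^esub>) (K\<^bsub>2\<^esub> \<uplus> 2 \<odot> K\<^bsub>3\<^esub>) \<or>
     iso_pair G1 G2 (K\<^sup>c\<^bsub>5\<^esub> \<uplus> K\<^bsub>4\<^esub>) (3 \<odot> K\<^bsub>3\<^esub>)"

end

theory Submission
  imports Defs "HOL-Library.Disjoint_Sets"
begin

text \<open>Take a counterexample with the fewest vertices. Mapping a vertex \<open>c\<close> of \<open>G1\<close> to a vertex \<open>y\<close> of
  \<open>G2\<close>, and some leaves at \<open>c\<close> to vertices not adjacent to \<open>y\<close>, leaves a smaller triple: the remaining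
  neighbours of \<open>c\<close> must avoid the neighbours of \<open>y\<close>, and this is recorded as new edges of \<open>G3\<close>. If
  \<open>k\<close> vertices are mapped and at least \<open>2 k\<close> edges are lost, the smaller triple satisfies the edge bound
  again, so it violates a degree bound or is exceptional; in the latter case it has exactly \<open>2 n' - 3\<close> edges
  and none in \<open>G3\<close>. Triples with at most \<open>n\<close> edges are packed by a direct induction, which
  disposes of vertices of degree \<open>n - 1\<close> in \<open>G3\<close> and of degree \<open>n - 2\<close> in \<open>G1\<close> or \<open>G2\<close>. An isolated vertex
  of \<open>G1\<close> is mapped so that two edges are lost, and this fails only for the exceptional pairs. Without
  isolated vertices the sparser graph has leaves: if \<open>G3\<close> has edges, a single leaf is mapped; otherwise
  either a leaf and its neighbour, or a vertex all but at most one of whose neighbours are leaves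
  together with these leaves.\<close>

section \<open>Finite simple graphs as relations\<close>

text \<open>Sending \<open>x\<close> to \<open>y\<close> deletes the edges at both vertices but
  creates deg x times deg y new forbidden pairs, so a net loss of two edges per mapped vertex is
  cheap only near isolated vertices and leaves. A leaf sent to \<open>y\<close> trades the edges at
  \<open>y\<close> for equally many new pairs and nets just its own edge: the second has to come
  from \<open>G3\<close>. Hence a single leaf suffices when \<open>G3\<close> has edges, and several
  vertices go at once when it has none. A centre with at most one non-leaf neighbour keeps the
  number of new pairs down to deg y. The degree bounds drop by one with every mapped vertex while a
  degree may stay put, so vertices of extremal degree have to be excluded before the general
  reductions. Equality in the edge bound for exceptional pairs is the main lever: a reduction that
  loses an edge too many, or that leaves a forbidden pair, is contradictory at once. Otherwise the
  exceptional remainder clashes with a second reduction or reassembles to an exceptional pair of the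
  original size.\<close>

definition simple_on :: "'a set \<Rightarrow> 'a rel \<Rightarrow> bool" where
  "simple_on V R \<longleftrightarrow> finite V \<and> R \<subseteq> V \<times> V \<and> sym R \<and> irrefl R"

text \<open>Doubletons make a symmetric relation count each edge once. The third graph is instead
  kept oriented from \<open>A\<close> to \<open>B\<close>, so plain \<open>card\<close> counts its
  edges, and its degrees on the \<open>B\<close> side are those of the converse.\<close>

definition ecard :: "'a rel \<Rightarrow> nat" where
  "ecard R = card ((\<lambda>(u, v). {u, v}) ` R)"

abbreviation dg :: "('a \<times> 'b) set \<Rightarrow> 'a \<Rightarrow> nat" where
  "dg R v \<equiv> card (R `` {v})"

definition del :: "'a set \<Rightarrow> 'a rel \<Rightarrow> 'a rel" where
  "del S R = R \<inter> (- S) \<times> (- S)"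

lemma in_del [simp]: "(u, v) \<in> del S R \<longleftrightarrow> (u, v) \<in> R \<and> u \<notin> S \<and> v \<notin> S"
  by (auto simp: del_def)

lemma del_del: "del S (del T R) = del (S \<union> T) R"
  by (auto simp: del_def)

lemma simple_onD:
  assumes "simple_on V R"
  shows "finite V" "finite R" "finite (R `` {v})" "R `` {v} \<subseteq> V" "(v, v) \<notin> R"
    "(u, v) \<in> R \<Longrightarrow> (v, u) \<in> R" "(u, v) \<in> R \<Longrightarrow> u \<in> V" "(u, v) \<in> R \<Longrightarrow> v \<in> V"
    "(u, v) \<in> R \<Longrightarrow> u \<noteq> v"
proof -
  have *: "finite V" "R \<subseteq> V \<times> V" "sym R" "irrefl R"
    using assms by (auto simp: simple_on_def)
  show "finite V" by fact
  show "finite R" using * by (meson finite_SigmaI finite_subset)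
  then show "finite (R `` {v})" by (simp add: finite_Image)
  show "R `` {v} \<subseteq> V" using * by auto
  show "(v, v) \<notin> R" using * by (simp add: irrefl_def)
  show "(u, v) \<in> R \<Longrightarrow> (v, u) \<in> R" using * by (meson symD)
  show "(u, v) \<in> R \<Longrightarrow> u \<in> V" "(u, v) \<in> R \<Longrightarrow> v \<in> V" using * by auto
  show "(u, v) \<in> R \<Longrightarrow> u \<noteq> v" using * by (auto simp: irrefl_def)
qed

lemma simple_on_del: "simple_on V R \<Longrightarrow> simple_on (V - S) (del S R)"
  unfolding simple_on_def by (auto simp: del_def sym_def irrefl_def)

lemma ecard_empty [simp]: "ecard {} = 0"
  by (simp add: ecard_def)

lemma ecard_mono: "finite R \<Longrightarrow> Q \<subseteq> R \<Longrightarrow> ecard Q \<le> ecard R"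
  unfolding ecard_def by (intro card_mono) auto

lemma ecard_del_mono: "finite R \<Longrightarrow> S \<subseteq> T \<Longrightarrow> ecard (del T R) \<le> ecard (del S R)"
  by (rule ecard_mono) (auto simp: del_def)

lemma ecard_eq_0: "finite R \<Longrightarrow> ecard R = 0 \<longleftrightarrow> R = {}"
  by (simp add: ecard_def)

lemma ecard_del1:
  assumes "simple_on V R"
  shows "ecard (del {x} R) + dg R x = ecard R"
proof -
  let ?f = "\<lambda>(u, v). {u, v}"
  have eq: "?f ` R = ?f ` del {x} R \<union> (\<lambda>v. {x, v}) ` (R `` {x})"
  proof (intro equalityI subsetI)
    fix e assume "e \<in> ?f ` R"
    then obtain u v where e: "(u, v) \<in> R" "e = {u, v}" by force
    consider "u = x" | "v = x" | "u \<noteq> x" "v \<noteq> x" by blast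
    then show "e \<in> ?f ` del {x} R \<union> (\<lambda>v. {x, v}) ` (R `` {x})"
    proof cases
      case 1
      then have "v \<in> R `` {x}" "e = {x, v}" using e by simp_all
      then show ?thesis by (intro UnI2 image_eqI)
    next
      case 2
      then have "(x, u) \<in> R" using e(1) simple_onD(6)[OF assms] by simp
      then have "u \<in> R `` {x}" "e = {x, u}" using e 2 by (simp_all add: insert_commute)
      then show ?thesis by (intro UnI2 image_eqI)
    next
      case 3
      then show ?thesis using e by (intro UnI1 image_eqI[of _ _ "(u, v)"]) simp_all
    qed
  next
    fix e assume "e \<in> ?f ` del {x} R \<union> (\<lambda>v. {x, v}) ` (R `` {x})"
    then show "e \<in> ?f ` R"
    proof
      assume "e \<in> ?f ` del {x} R"
      then show ?thesis using image_mono[of "del {x} R" R ?f] by (auto simp: del_def)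
    next
      assume "e \<in> (\<lambda>v. {x, v}) ` (R `` {x})"
      then obtain v where "(x, v) \<in> R" "e = {x, v}" by auto
      then show ?thesis by (intro image_eqI[of _ _ "(x, v)"]) simp_all
    qed
  qed
  have "x \<notin> e" if "e \<in> ?f ` del {x} R" for e
    using that by (auto simp: del_def)
  moreover have "x \<in> e" if "e \<in> (\<lambda>v. {x, v}) ` (R `` {x})" for e
    using that by auto
  ultimately have disj: "?f ` del {x} R \<inter> (\<lambda>v. {x, v}) ` (R `` {x}) = {}"
    by (meson disjoint_iff)
  have "card ((\<lambda>v. {x, v}) ` (R `` {x})) = dg R x"
    by (rule card_image) (auto simp: inj_on_def doubleton_eq_iff)
  moreover have "finite R" by (rule simple_onD(2)[OF assms])
  then have "finite (?f ` del {x} R)" "finite ((\<lambda>v. {x, v}) ` (R `` {x}))"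
    by (simp_all add: del_def finite_Image)
  ultimately show ?thesis
    unfolding ecard_def eq using disj by (simp add: card_Un_disjoint)
qed

lemma dg_del: "dg (del S R) v = (if v \<in> S then 0 else card (R `` {v} - S))"
proof -
  have "del S R `` {v} = (if v \<in> S then {} else R `` {v} - S)" by (auto simp: del_def)
  then show ?thesis by simp
qed

lemma dg_del_le: "finite R \<Longrightarrow> dg (del S R) v \<le> dg R v"
  by (intro card_mono finite_Image) (auto simp: del_def)

lemma dg_del_less:
  assumes "finite R" "(v, s) \<in> R" "s \<in> S"
  shows "dg (del S R) v < dg R v"
  by (rule psubset_card_mono) (use assms in \<open>auto simp: del_def finite_Image\<close>)

lemma dg_0: "finite R \<Longrightarrow> dg R v = 0 \<longleftrightarrow> R `` {v} = {}"
  by (simp add: finite_Image)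

lemma dg_ge_1: "finite R \<Longrightarrow> (v, w) \<in> R \<Longrightarrow> 1 \<le> dg R v"
  using dg_0[of R v] by (cases "dg R v") auto

lemma dg_ge_1': "finite R \<Longrightarrow> (w, v) \<in> R \<Longrightarrow> 1 \<le> dg (R\<inverse>) v"
  using dg_ge_1[of "R\<inverse>" v w] by simp

lemma dg_ge_1E:
  assumes "1 \<le> dg R v"
  obtains w where "(v, w) \<in> R"
proof -
  have "R `` {v} \<noteq> {}" using assms by auto
  then show ?thesis using that by blast
qed

lemma card_rel: "finite V \<Longrightarrow> finite R \<Longrightarrow> R \<subseteq> V \<times> W \<Longrightarrow> card R = (\<Sum>v\<in>V. dg R v)"
proof -
  assume a: "finite V" "finite R" "R \<subseteq> V \<times> W"
  have "R = Sigma V (\<lambda>v. R `` {v})" using a by auto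
  then have "card R = card (Sigma V (\<lambda>v. R `` {v}))" by simp
  also have "\<dots> = (\<Sum>v\<in>V. dg R v)"
    by (rule card_SigmaI) (use a in \<open>auto simp: finite_Image\<close>)
  finally show ?thesis .
qed

lemma card_ecard:
  assumes "simple_on V R"
  shows "card R = 2 * ecard R"
proof -
  have "finite V" using assms by (simp add: simple_onD)
  then show ?thesis using assms
  proof (induction V arbitrary: R rule: finite_induct)
    case empty
    then have "R = {}" by (auto simp: simple_on_def)
    then show ?case by simp
  next
    case (insert x V)
    note s = simple_onD[OF insert.prems]
    have "simple_on V (del {x} R)"
      using simple_on_del[OF insert.prems, of "{x}"] insert.hyps by simp
    then have IH: "card (del {x} R) = 2 * ecard (del {x} R)" by (rule insert.IH)
    have eq: "R = del {x} R \<union> (Pair x ` (R `` {x}) \<union> (\<lambda>v. (v, x)) ` (R `` {x}))"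
      using s(6) by (auto simp: image_iff)
    have "card R = card (del {x} R) + card (Pair x ` (R `` {x}) \<union> (\<lambda>v. (v, x)) ` (R `` {x}))"
      by (subst eq, rule card_Un_disjoint) (use s(2) in \<open>auto simp: del_def finite_Image\<close>)
    also have "card (Pair x ` (R `` {x}) \<union> (\<lambda>v. (v, x)) ` (R `` {x}))
        = card (Pair x ` (R `` {x})) + card ((\<lambda>v. (v, x)) ` (R `` {x}))"
      by (rule card_Un_disjoint) (use s(2,5) in \<open>auto simp: finite_Image\<close>)
    also have "\<dots> = 2 * dg R x" by (simp add: card_image inj_on_def)
    finally show ?case using IH ecard_del1[OF insert.prems, of x] by simp
  qed
qed

section \<open>The handshake lemma and bounds from degree sums\<close>

lemma handshake:
  assumes "simple_on V R"
  shows "(\<Sum>v\<in>V. dg R v) = 2 * ecard R"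
proof -
  have "card R = (\<Sum>v\<in>V. dg R v)"
    by (rule card_rel[of _ _ V]) (use assms simple_onD(1,2)[OF assms] in \<open>auto simp: simple_on_def\<close>)
  then show ?thesis using card_ecard[OF assms] by simp
qed

text \<open>The handshake sum with exact degrees on \<open>S\<close> and a uniform lower bound
  elsewhere. With \<delta> = 1 or 2 it turns the absence of isolated vertices or of leaves into
  lower bounds on the number of edges.\<close>

lemma degree_sum_ge:
  assumes "simple_on V R" "S \<subseteq> V" "\<And>v. v \<in> V - S \<Longrightarrow> \<delta> \<le> dg R v"
  shows "(\<Sum>v\<in>S. dg R v) + \<delta> * (card V - card S) \<le> 2 * ecard R"
proof -
  have f: "finite V" using assms(1) by (rule simple_onD)
  then have f: "finite V" "finite S" using assms(2) finite_subset by blast+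
  have "2 * ecard R = (\<Sum>v\<in>S. dg R v) + (\<Sum>v\<in>V - S. dg R v)"
    using handshake[OF assms(1)] sum.subset_diff[OF assms(2) f(1), of "dg R"] by simp
  moreover have "\<delta> * card (V - S) \<le> (\<Sum>v\<in>V - S. dg R v)"
    using sum_bounded_below[of "V - S" \<delta> "dg R"] assms(3) by (simp add: mult.commute)
  ultimately show ?thesis using card_Diff_subset[OF f(2) assms(2)] by simp
qed

lemma degree_sum_ge1:
  assumes "simple_on V R" "x \<in> V" "\<And>v. v \<in> V \<Longrightarrow> v \<noteq> x \<Longrightarrow> \<delta> \<le> dg R v"
  shows "dg R x + \<delta> * (card V - 1) \<le> 2 * ecard R"
  using degree_sum_ge[OF assms(1), of "{x}" \<delta>] assms by simp

lemma degree_sum_ge0: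
  assumes "simple_on V R" "\<And>v. v \<in> V \<Longrightarrow> \<delta> \<le> dg R v"
  shows "\<delta> * card V \<le> 2 * ecard R"
  using degree_sum_ge[OF assms(1), of "{}" \<delta>] assms by simp

lemma degree_sum_ge2:
  assumes "simple_on V R" "x \<in> V" "y \<in> V" "x \<noteq> y"
    "\<And>v. v \<in> V \<Longrightarrow> v \<noteq> x \<Longrightarrow> v \<noteq> y \<Longrightarrow> \<delta> \<le> dg R v"
  shows "dg R x + dg R y + \<delta> * (card V - 2) \<le> 2 * ecard R"
  using degree_sum_ge[OF assms(1), of "{x, y}" \<delta>] assms by (simp add: numeral_2_eq_2)

lemma dg_le_ecard: "simple_on V R \<Longrightarrow> dg R x \<le> ecard R"
  using ecard_del1[of V R x] by linarith

text \<open>Only the edge \<open>xy\<close> can be counted at both endpoints; this is the 1 that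
  disappears for non-adjacent vertices.\<close>

lemma dg2_le_ecard:
  assumes "simple_on V R" "x \<noteq> y"
  shows "dg R x + dg R y \<le> ecard R + 1"
    and "(x, y) \<notin> R \<Longrightarrow> dg R x + dg R y \<le> ecard R"
proof -
  note s = simple_onD[OF assms(1)]
  have *: "ecard (del {x} R) + dg R x = ecard R" by (rule ecard_del1[OF assms(1)])
  have **: "dg (del {x} R) y \<le> ecard (del {x} R)"
    by (rule dg_le_ecard[OF simple_on_del[OF assms(1)]])
  have d: "dg (del {x} R) y = card (R `` {y} - {x})" using assms(2) by (simp add: dg_del)
  have "card (R `` {y}) - 1 \<le> card (R `` {y} - {x})" using s(3) by (simp add: card_Diff_singleton_if)
  then show "dg R x + dg R y \<le> ecard R + 1" using * ** d by linarith
  show "dg R x + dg R y \<le> ecard R" if "(x, y) \<notin> R"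
  proof -
    have "R `` {y} - {x} = R `` {y}" using that s(6) by auto
    then show ?thesis using * ** d by simp
  qed
qed

lemma ecard_del2:
  assumes "simple_on V R" "x \<noteq> y" "(x, y) \<notin> R"
  shows "ecard (del {x, y} R) + dg R x + dg R y = ecard R"
proof -
  have "del {x, y} R = del {y} (del {x} R)" by (simp add: del_del insert_commute)
  moreover have "dg (del {x} R) y = dg R y"
  proof -
    have "R `` {y} - {x} = R `` {y}" using assms simple_onD(6) by fastforce
    then show ?thesis using assms(2) by (simp add: dg_del)
  qed
  ultimately show ?thesis
    using ecard_del1[OF simple_on_del[OF assms(1)], of y "{x}"] ecard_del1[OF assms(1), of x] by simp
qed

lemma ecard_del_insert:
  assumes "simple_on V R" "y \<notin> Y" "Y \<inter> R `` {y} = {}"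
  shows "ecard (del (insert y Y) R) + dg R y = ecard (del Y R)"
proof -
  have "del (insert y Y) R = del {y} (del Y R)" by (simp add: del_del)
  moreover have "dg (del Y R) y = dg R y"
  proof -
    have "R `` {y} - Y = R `` {y}" using assms by auto
    then show ?thesis using assms(2) by (simp add: dg_del)
  qed
  ultimately show ?thesis
    using ecard_del1[OF simple_on_del[OF assms(1)], of y Y] by simp
qed

section \<open>Existence of vertices of prescribed degree\<close>

lemma exists_low_degree:
  assumes "simple_on V R" "ecard R < card V"
  obtains v where "v \<in> V" "dg R v \<le> 1"
proof -
  have "\<exists>v\<in>V. dg R v \<le> 1"
  proof (rule ccontr)
    assume "\<not> ?thesis"
    then have "\<And>v. v \<in> V \<Longrightarrow> 2 \<le> dg R v" by force
    from degree_sum_ge0[OF assms(1) this] assms(2) show False by simp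
  qed
  then show ?thesis using that by blast
qed

lemma dg_1:
  assumes "dg R v = 1" "(v, w) \<in> R"
  shows "R `` {v} = {w}"
proof -
  obtain x where "R `` {v} = {x}" using assms(1) by (rule card_1_singletonE)
  moreover have "w \<in> R `` {v}" using assms(2) by simp
  ultimately show ?thesis by simp
qed

lemma max_dg:
  assumes "finite V" "V \<noteq> {}"
  obtains v where "v \<in> V" "\<And>w. w \<in> V \<Longrightarrow> dg R w \<le> dg R v"
proof -
  have "\<exists>v\<in>V. \<forall>w\<in>V. dg R w \<le> dg R v"
    using assms obtains_MAX[of V "dg R"] by (metis Max_ge finite_imageI imageI)
  then show ?thesis using that by blast
qed

lemma exists_not_in:
  assumes "finite S" "card S < card B"
  obtains y where "y \<in> B" "y \<notin> S"
proof -
  have "\<not> B \<subseteq> S" using assms card_mono[of S B] by force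
  then show ?thesis using that by blast
qed

lemma exists_nonneighbour:
  assumes "simple_on V R" "v \<in> V" "dg R v + 2 \<le> card V"
  obtains w where "w \<in> V" "w \<noteq> v" "(v, w) \<notin> R"
proof -
  note s = simple_onD[OF assms(1)]
  have "card (insert v (R `` {v})) \<le> dg R v + 1" using s(3) s(5) by (simp add: card_insert_if)
  then obtain w where "w \<in> V" "w \<notin> insert v (R `` {v})"
    using exists_not_in[of "insert v (R `` {v})" V] assms(3) s(3) by auto
  then show ?thesis using that by auto
qed

text \<open>With minimum degree 1 and p leaves the handshake sum is at least p + 2 (n - p). So there
  are at least 2 n - 2 e leaves, too many to fit into \<open>F\<close>.\<close>

lemma exists_leaf_outside:
  assumes sg: "simple_on V R" and d1: "\<And>v. v \<in> V \<Longrightarrow> 1 \<le> dg R v"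
    and F: "finite F" "card F + 2 * ecard R < 2 * card V"
  obtains l where "l \<in> V" "dg R l = 1" "l \<notin> F"
proof -
  let ?L = "{v \<in> V. dg R v = 1}"
  note s = simple_onD[OF sg]
  have "2 \<le> dg R v" if "v \<in> V - ?L" for v using that d1[of v] by force
  moreover have L: "?L \<subseteq> V" by auto
  ultimately have "(\<Sum>v\<in>?L. dg R v) + 2 * (card V - card ?L) \<le> 2 * ecard R"
    by (intro degree_sum_ge[OF sg])
  moreover have "(\<Sum>v\<in>?L. dg R v) = card ?L" by simp
  moreover have "card ?L \<le> card V" by (rule card_mono) (use s(1) in auto)
  ultimately have "card F < card ?L" using F(2) by linarith
  then obtain l where "l \<in> ?L" "l \<notin> F" by (rule exists_not_in[OF F(1)])
  then show ?thesis using that by blast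
qed

lemma converse_dg_le: "finite R \<Longrightarrow> dg R v \<le> card R" "finite R \<Longrightarrow> dg (R\<inverse>) w \<le> card R"
proof -
  assume f: "finite R"
  have "card (Pair v ` (R `` {v})) \<le> card R" by (rule card_mono) (use f in auto)
  then show "dg R v \<le> card R" by (simp add: card_image inj_on_def)
  have "card ((\<lambda>u. (u, w)) ` (R\<inverse> `` {w})) \<le> card R" by (rule card_mono) (use f in auto)
  then show "dg (R\<inverse>) w \<le> card R" by (simp add: card_image inj_on_def)
qed

section \<open>Packing relations and removing stars\<close>

definition triple :: "'a set \<Rightarrow> 'a set \<Rightarrow> 'a rel \<Rightarrow> 'a rel \<Rightarrow> 'a rel \<Rightarrow> bool" where
  "triple A B R1 R2 R3 \<longleftrightarrow> simple_on A R1 \<and> simple_on B R2 \<and> R3 \<subseteq> A \<times> B \<and> card A = card B"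

definition packs_on :: "'a set \<Rightarrow> 'a set \<Rightarrow> 'a rel \<Rightarrow> 'a rel \<Rightarrow> 'a rel \<Rightarrow> bool" where
  "packs_on A B R1 R2 R3 \<longleftrightarrow> (\<exists>f. bij_betw f A B \<and> (\<forall>u v. (u, v) \<in> R1 \<longrightarrow> (f u, f v) \<notin> R2)
     \<and> (\<forall>u\<in>A. (u, f u) \<notin> R3))"

lemma tripleD:
  assumes "triple A B R1 R2 R3"
  shows "simple_on A R1" "simple_on B R2" "R3 \<subseteq> A \<times> B" "card A = card B" "finite A" "finite B"
    "finite R1" "finite R2" "finite R3"
proof -
  show *: "simple_on A R1" "simple_on B R2" "R3 \<subseteq> A \<times> B" "card A = card B"
    using assms by (auto simp: triple_def)
  show "finite A" "finite B" "finite R1" "finite R2" using *(1,2) by (simp_all add: simple_onD(1,2))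
  then show "finite R3" using *(3) finite_subset by blast
qed

lemma triple_swap: "triple A B R1 R2 R3 \<Longrightarrow> triple B A R2 R1 (R3\<inverse>)"
  by (auto simp: triple_def)

text \<open>The inverse bijection packs the exchanged triple. This symmetry lets every result about
  \<open>R1\<close> be reused for \<open>R2\<close>.\<close>

lemma packs_on_swap:
  assumes "triple A B R1 R2 R3" "packs_on A B R1 R2 R3"
  shows "packs_on B A R2 R1 (R3\<inverse>)"
proof -
  obtain f where f: "bij_betw f A B" "\<And>u v. (u, v) \<in> R1 \<Longrightarrow> (f u, f v) \<notin> R2"
    "\<And>u. u \<in> A \<Longrightarrow> (u, f u) \<notin> R3"
    using assms(2) by (auto simp: packs_on_def)
  let ?g = "inv_into A f"
  have g: "bij_betw ?g B A" using f(1) by (rule bij_betw_inv_into)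
  have fg: "f (?g b) = b" if "b \<in> B" for b using f(1) that by (rule bij_betw_inv_into_right)
  have gA: "?g b \<in> A" if "b \<in> B" for b using g that by (rule bij_betw_apply)
  have "(?g u, ?g v) \<notin> R1" if "(u, v) \<in> R2" for u v
    using f(2)[of "?g u" "?g v"] fg that simple_onD(7,8)[OF tripleD(2)[OF assms(1)] that] by auto
  moreover have "(u, ?g u) \<notin> R3\<inverse>" if "u \<in> B" for u
    using f(3)[of "?g u"] fg gA that by auto
  ultimately show ?thesis unfolding packs_on_def using g by blast
qed

lemma packs_on_swap_iff: "triple A B R1 R2 R3 \<Longrightarrow> packs_on B A R2 R1 (R3\<inverse>) \<longleftrightarrow> packs_on A B R1 R2 R3"
  using packs_on_swap[of A B R1 R2 R3] packs_on_swap[of B A R2 R1 "R3\<inverse>"] triple_swap[of A B R1 R2 R3] by auto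

lemma packs_on_edgeless: "packs_on A B {} {} R3 \<Longrightarrow> packs_on A B R1 {} R3"
  unfolding packs_on_def by blast

text \<open>The way back from a smaller triple: \<open>c\<close> goes to \<open>y\<close> and
  \<open>L\<close> goes to \<open>Y\<close> by an arbitrary bijection, which is harmless as a leaf
  sees only \<open>c\<close>. \<open>Q\<close> is only required to contain the surviving and the new
  forbidden pairs, so it can be chosen to suit the count. With \<open>L\<close> and \<open>Y\<close>
  empty a single vertex is mapped.\<close>

lemma star_removal:
  assumes tr: "triple A B R1 R2 R3"
    and c: "c \<in> A" "y \<in> B" "(c, y) \<notin> R3"
    and L: "L \<subseteq> A" "\<And>l. l \<in> L \<Longrightarrow> R1 `` {l} = {c}"
    and Y: "Y \<subseteq> B" "card Y = card L" "y \<notin> Y" "Y \<inter> R2 `` {y} = {}" "R3 \<inter> L \<times> Y = {}"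
    and P: "packs_on (A - insert c L) (B - insert y Y) (del (insert c L) R1) (del (insert y Y) R2) Q"
    and Q: "R3 \<inter> (- insert c L) \<times> (- insert y Y) \<subseteq> Q" "(R1 `` {c} - L) \<times> (R2 `` {y} - Y) \<subseteq> Q"
  shows "packs_on A B R1 R2 R3"
proof -
  note t = tripleD[OF tr]
  note s1 = simple_onD[OF t(1)] and s2 = simple_onD[OF t(2)]
  have cL: "c \<notin> L" using L(2)[of c] s1(5)[of c] by auto
  have "finite L" "finite Y" using L(1) Y(1) t(5,6) finite_subset by blast+
  then obtain h where h: "bij_betw h L Y" using Y(2) finite_same_card_bij by metis
  obtain f where f: "bij_betw f (A - insert c L) (B - insert y Y)"
    "\<And>u v. (u, v) \<in> del (insert c L) R1 \<Longrightarrow> (f u, f v) \<notin> del (insert y Y) R2"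
    "\<And>u. u \<in> A - insert c L \<Longrightarrow> (u, f u) \<notin> Q"
    using P by (auto simp: packs_on_def)
  have fB: "f u \<in> B - insert y Y" if "u \<in> A" "u \<notin> insert c L" for u
    using bij_betwE[OF f(1)] that by blast
  have hY: "h l \<in> Y" if "l \<in> L" for l using bij_betwE[OF h] that by blast
  define g where "g u = (if u = c then y else if u \<in> L then h u else f u)" for u
  have g: "g c = y" "\<And>l. l \<in> L \<Longrightarrow> g l = h l" "\<And>u. u \<notin> insert c L \<Longrightarrow> g u = f u"
    using cL by (auto simp: g_def)
  have "bij_betw g {c} {y}" using g(1) by (simp add: bij_betw_def)
  moreover have "bij_betw g L Y" using h g(2) bij_betw_cong[of L g h] by blast
  ultimately have "bij_betw g ({c} \<union> L) ({y} \<union> Y)"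
    by (rule bij_betw_combine) (use Y(3) in auto)
  moreover have "bij_betw g (A - insert c L) (B - insert y Y)"
    using f(1) g(3) bij_betw_cong[of "A - insert c L" g f] by blast
  ultimately have "bij_betw g (({c} \<union> L) \<union> (A - insert c L)) (({y} \<union> Y) \<union> (B - insert y Y))"
    by (rule bij_betw_combine) auto
  moreover have "({c} \<union> L) \<union> (A - insert c L) = A" "({y} \<union> Y) \<union> (B - insert y Y) = B"
    using c L(1) Y(1) by auto
  ultimately have bij: "bij_betw g A B" by simp
  \<comment> \<open>The image of a leaf lies in \<open>Y\<close>, off the neighbourhood of
    \<open>y\<close>; every other neighbour of \<open>c\<close> is kept off it by
    \<open>Q\<close>.\<close>
  have key: "(g c, g v) \<notin> R2" if e: "(c, v) \<in> R1" for v
  proof (cases "v \<in> L")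
    case True
    then show ?thesis using Y(4) hY[of v] by (auto simp: g)
  next
    case False
    have v: "v \<in> A" "v \<noteq> c" using s1(8,9)[OF e] by blast+
    then have "(v, f v) \<notin> Q" "f v \<in> B - insert y Y" using f(3)[of v] fB[of v] False by blast+
    moreover have "v \<in> R1 `` {c} - L" using e False by simp
    ultimately have "f v \<notin> R2 `` {y}" using Q(2) by blast
    then show ?thesis using v False g by simp
  qed
  have "(g u, g v) \<notin> R2" if e: "(u, v) \<in> R1" for u v
  proof -
    have e': "(v, u) \<in> R1" using s1(6)[OF e] .
    consider "u = c" | "v = c" | "u \<noteq> c" "v \<noteq> c" by blast
    then show ?thesis
    proof cases
      case 1
      then show ?thesis using key e by blast
    next
      case 2
      then show ?thesis using key[of u] e' s2(6) by blast
    next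
      case 3
      then have "u \<notin> L" "v \<notin> L" using L(2)[of u] L(2)[of v] e e' by blast+
      then have uv: "u \<notin> insert c L" "v \<notin> insert c L" using 3 by auto
      have "u \<in> A" "v \<in> A" using s1(7,8)[OF e] .
      then have "f u \<in> B - insert y Y" "f v \<in> B - insert y Y" using fB uv by blast+
      moreover have "(f u, f v) \<notin> del (insert y Y) R2" using f(2)[of u v] e uv by simp
      ultimately show ?thesis using g(3) uv by auto
    qed
  qed
  moreover have "(u, g u) \<notin> R3" if "u \<in> A" for u
  proof -
    consider "u = c" | "u \<in> L" | "u \<notin> insert c L" by blast
    then show ?thesis
    proof cases
      case 1
      then show ?thesis using c g by simp
    next
      case 2
      then show ?thesis using Y(5) hY[of u] g(2) by auto
    next
      case 3
      then have "(u, f u) \<notin> Q" "f u \<in> B - insert y Y" using f(3)[of u] fB[of u] that by blast+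
      then show ?thesis using Q(1) 3 g(3) by auto
    qed
  qed
  ultimately show ?thesis unfolding packs_on_def using bij by blast
qed

lemma triple_del:
  assumes "triple A B R1 R2 R3" "X \<subseteq> A" "Y \<subseteq> B" "card X = card Y" "Q \<subseteq> (A - X) \<times> (B - Y)"
  shows "triple (A - X) (B - Y) (del X R1) (del Y R2) Q"
proof -
  note t = tripleD[OF assms(1)]
  have "finite X" "finite Y" using assms(2,3) t finite_subset by blast+
  then have "card (A - X) = card (B - Y)" using assms t(4) by (simp add: card_Diff_subset)
  then show ?thesis using assms t by (simp add: triple_def simple_on_del)
qed

lemma triple_edgeless: "triple A B R1 R2 R3 \<Longrightarrow> triple A B {} {} R3"
  by (simp add: triple_def simple_on_def sym_def irrefl_def)

lemma card_bip_del:
  assumes "finite R" "(x, y) \<notin> R"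
  shows "card (R \<inter> (- {x}) \<times> (- {y})) + dg R x + dg (R\<inverse>) y = card R"
proof -
  have eq: "R = (R \<inter> (- {x}) \<times> (- {y})) \<union> (Pair x ` (R `` {x}) \<union> (\<lambda>a. (a, y)) ` (R\<inverse> `` {y}))"
    by auto
  have "card R = card (R \<inter> (- {x}) \<times> (- {y}))
      + card (Pair x ` (R `` {x}) \<union> (\<lambda>a. (a, y)) ` (R\<inverse> `` {y}))"
    by (subst eq, rule card_Un_disjoint) (use assms in \<open>auto simp: finite_Image\<close>)
  also have "card (Pair x ` (R `` {x}) \<union> (\<lambda>a. (a, y)) ` (R\<inverse> `` {y}))
      = card (Pair x ` (R `` {x})) + card ((\<lambda>a. (a, y)) ` (R\<inverse> `` {y}))"
    by (rule card_Un_disjoint) (use assms in \<open>auto simp: finite_Image\<close>)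
  also have "\<dots> = dg R x + dg (R\<inverse>) y" by (simp add: card_image inj_on_def)
  finally show ?thesis by simp
qed

lemma sum_dg_bip:
  assumes "finite A" "finite B" "R \<subseteq> A \<times> B"
  shows "(\<Sum>v\<in>A. dg R v) = card R" "(\<Sum>v\<in>B. dg (R\<inverse>) v) = card R"
proof -
  have "finite R" using assms by (meson finite_SigmaI finite_subset)
  then show "(\<Sum>v\<in>A. dg R v) = card R" using card_rel[of A R B] assms by simp
  have "card (R\<inverse>) = (\<Sum>v\<in>B. dg (R\<inverse>) v)"
    by (rule card_rel[of _ _ A]) (use assms \<open>finite R\<close> in auto)
  then show "(\<Sum>v\<in>B. dg (R\<inverse>) v) = card R" by (simp add: card_inverse)
qed

section \<open>Triples with few edges\<close>

text \<open>The forbidden box is charged by its two sides instead of its area. This is what pays for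
  a pair \<open>x\<close>, \<open>y\<close> whose degrees are both large: the box of their
  neighbourhoods then costs only the edges deleted with them. The induction maps vertices of degree
  at most 1, so that the weight drops by at least one each time.\<close>

lemma packs_light_forbidden_box:
  assumes "triple A B R1 R2 R3" "S \<subseteq> A" "T \<subseteq> B"
    "card S + card T + ecard R1 + ecard R2 + card R3 < card A"
  shows "packs_on A B R1 R2 (R3 \<union> S \<times> T)"
  using assms
proof (induction "card A" arbitrary: A B R1 R2 R3 S T rule: less_induct)
  case less
  note tr = less.prems(1)
  note t = tripleD[OF tr]
  note s1 = simple_onD[OF t(1)] and s2 = simple_onD[OF t(2)]
  have fS: "finite S" "finite T" using less.prems(2,3) t finite_subset by blast+
  \<comment> \<open>If \<open>x\<close> is a leaf, the new pairs are as many as the edges lost at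
    \<open>y\<close>, and the edge of \<open>x\<close> is the gain. If \<open>x\<close> is isolated
    there are no new pairs, so the gain must come from the other quantities in
    \<open>loss\<close>.\<close>
  have step: ?case if x: "x \<in> A" "dg R1 x \<le> 1" and y: "y \<in> B" "(x, y) \<notin> R3" "\<not> (x \<in> S \<and> y \<in> T)"
    and loss: "x \<in> S \<or> y \<in> T \<or> 1 \<le> dg R1 x + dg R3 x + dg (R3\<inverse>) y \<or> 1 \<le> dg R2 y" for x y
  proof -
    let ?Q = "R3 \<inter> (- {x}) \<times> (- {y}) \<union> R1 `` {x} \<times> R2 `` {y}"
    have tr': "triple (A - {x}) (B - {y}) (del {x} R1) (del {y} R2) ?Q"
    proof (rule triple_del[OF tr])
      have "R1 `` {x} \<subseteq> A - {x}" "R2 `` {y} \<subseteq> B - {y}" using s1(4,5) s2(4,5) by blast+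
      then show "?Q \<subseteq> (A - {x}) \<times> (B - {y})" using t(3) by blast
    qed (use x y in auto)
    have cA: "card (A - {x}) = card A - 1" "card A > 0" using x(1) t(5) by (auto simp: card_gt_0_iff)
    have "card ?Q \<le> card (R3 \<inter> (- {x}) \<times> (- {y})) + dg R1 x * dg R2 y"
      by (rule order_trans[OF card_Un_le]) (simp add: card_cartesian_product)
    moreover have "dg R1 x = 0 \<or> dg R1 x = 1" using x(2) by linarith
    moreover have "card (R3 \<inter> (- {x}) \<times> (- {y})) + dg R3 x + dg (R3\<inverse>) y = card R3"
      by (rule card_bip_del[OF t(9) y(2)])
    moreover have "ecard (del {x} R1) + dg R1 x = ecard R1" "ecard (del {y} R2) + dg R2 y = ecard R2"
      using ecard_del1[OF t(1), of x] ecard_del1[OF t(2), of y] by simp_all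
    moreover have "card (S - {x}) = card S - (if x \<in> S then 1 else 0)"
      "card (T - {y}) = card T - (if y \<in> T then 1 else 0)"
      "x \<in> S \<Longrightarrow> card S > 0" "y \<in> T \<Longrightarrow> card T > 0"
      using fS by (auto simp: card_gt_0_iff)
    ultimately have w: "card (S - {x}) + card (T - {y}) + ecard (del {x} R1) + ecard (del {y} R2)
        + card ?Q < card (A - {x})"
      using loss less.prems(4) cA by (auto split: if_splits)
    have "packs_on (A - {x}) (B - {y}) (del {x} R1) (del {y} R2) (?Q \<union> (S - {x}) \<times> (T - {y}))"
      by (rule less.hyps[OF _ tr' _ _ w]) (use cA less.prems(2,3) in auto)
    moreover have "triple A B R1 R2 (R3 \<union> S \<times> T)"
      using tr less.prems(2,3) by (auto simp: triple_def)
    ultimately show ?case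
      by - (rule star_removal[of _ _ _ _ _ x y "{}" "{}"], use x y in auto)
  qed
  show ?case
  proof (cases "\<exists>x\<in>A. dg R1 x \<le> 1 \<and> (x \<in> S \<or> 1 \<le> dg R1 x + dg R3 x)")
    case True
    \<comment> \<open>Here \<open>x\<close> itself supplies the loss, so \<open>y\<close> only has
      to avoid \<open>R3\<close> and \<open>T\<close>.\<close>
    then obtain x where x: "x \<in> A" "dg R1 x \<le> 1" "x \<in> S \<or> 1 \<le> dg R1 x + dg R3 x" by blast
    have "card (R3 `` {x} \<union> T) \<le> dg R3 x + card T" by (rule card_Un_le)
    also have "\<dots> \<le> card R3 + card T" using converse_dg_le(1)[OF t(9)] by simp
    also have "\<dots> < card B" using less.prems(4) t(4) by simp
    finally obtain y where "y \<in> B" "y \<notin> R3 `` {x} \<union> T"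
      using exists_not_in[of "R3 `` {x} \<union> T" B] t(9) fS by (auto simp: finite_Image)
    then show ?thesis using step[of x y] x by auto
  next
    case False
    \<comment> \<open>The average degree of \<open>R1\<close> is below 2. This \<open>x\<close>
      touches nothing at all, so any \<open>y\<close> that touches something will do.\<close>
    obtain x where x: "x \<in> A" "dg R1 x \<le> 1"
      using exists_low_degree[OF t(1)] less.prems(4) by auto
    then have x0: "x \<notin> S" "dg R1 x = 0" "dg R3 x = 0" using False by force+
    then have nx: "(x, y) \<notin> R3" for y using dg_0[OF t(9), of x] by auto
    show ?thesis
    proof (cases "\<exists>y\<in>B. y \<in> T \<or> 1 \<le> dg (R3\<inverse>) y \<or> 1 \<le> dg R2 y")
      case True
      then obtain y where "y \<in> B" "y \<in> T \<or> 1 \<le> dg (R3\<inverse>) y \<or> 1 \<le> dg R2 y" by blast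
      then show ?thesis using step[of x y] x x0 nx by auto
    next
      case F: False
      \<comment> \<open>No vertex of \<open>B\<close> touches anything: there are no constraints
        left and every bijection packs.\<close>
      have "T = {}" using F less.prems(3) by blast
      moreover have "R3 = {}"
      proof (rule ccontr)
        assume "R3 \<noteq> {}"
        then obtain a y where a: "(a, y) \<in> R3" by auto
        then have "y \<in> B" using t(3) by auto
        then have "dg (R3\<inverse>) y = 0" using F by force
        then show False using a dg_0[of "R3\<inverse>" y] t(9) by auto
      qed
      moreover have "R2 = {}"
      proof (rule ccontr)
        assume "R2 \<noteq> {}"
        then obtain y z where a: "(y, z) \<in> R2" by auto
        then have "y \<in> B" using s2(7) by blast
        then have "dg R2 y = 0" using F by force
        then show False using a dg_0[OF t(8), of y] by auto
      qed
      moreover obtain f where "bij_betw f A B" using t(4-6) finite_same_card_bij by blast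
      ultimately show ?thesis unfolding packs_on_def by auto
    qed
  qed
qed

lemma packs_light:
  assumes "triple A B R1 R2 R3" "ecard R1 + ecard R2 + card R3 < card A"
  shows "packs_on A B R1 R2 R3"
  using packs_light_forbidden_box[OF assms(1), of "{}" "{}"] assms(2) by simp

text \<open>\<open>packs_light\<close> needs fewer edges than the remaining
  \<open>card A - 1\<close> vertices, hence a net loss of two when starting from
  \<open>card A\<close>.\<close>

lemma packs_single_loss2:
  assumes tr: "triple A B R1 R2 R3" and w: "ecard R1 + ecard R2 + card R3 \<le> card A"
    and x: "x \<in> A" "y \<in> B" "(x, y) \<notin> R3"
    and loss: "dg R1 x * dg R2 y + 2 \<le> dg R1 x + dg R2 y + dg R3 x + dg (R3\<inverse>) y"
  shows "packs_on A B R1 R2 R3"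
proof -
  note t = tripleD[OF tr]
  note s1 = simple_onD[OF t(1)] and s2 = simple_onD[OF t(2)]
  let ?Q = "R3 \<inter> (- {x}) \<times> (- {y}) \<union> R1 `` {x} \<times> R2 `` {y}"
  have tr': "triple (A - {x}) (B - {y}) (del {x} R1) (del {y} R2) ?Q"
  proof (rule triple_del[OF tr])
    have "R1 `` {x} \<subseteq> A - {x}" "R2 `` {y} \<subseteq> B - {y}" using s1(4,5) s2(4,5) by blast+
    then show "?Q \<subseteq> (A - {x}) \<times> (B - {y})" using t(3) by blast
  qed (use x in auto)
  have cA: "card (A - {x}) = card A - 1" "card A > 0" using x(1) t(5) by (auto simp: card_gt_0_iff)
  have "card ?Q \<le> card (R3 \<inter> (- {x}) \<times> (- {y})) + dg R1 x * dg R2 y"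
    by (rule order_trans[OF card_Un_le]) (simp add: card_cartesian_product)
  moreover have "card (R3 \<inter> (- {x}) \<times> (- {y})) + dg R3 x + dg (R3\<inverse>) y = card R3"
    by (rule card_bip_del[OF t(9) x(3)])
  moreover have "ecard (del {x} R1) + dg R1 x = ecard R1" "ecard (del {y} R2) + dg R2 y = ecard R2"
    using ecard_del1[OF t(1), of x] ecard_del1[OF t(2), of y] by simp_all
  ultimately have "ecard (del {x} R1) + ecard (del {y} R2) + card ?Q < card (A - {x})"
    using w loss cA by linarith
  then have "packs_on (A - {x}) (B - {y}) (del {x} R1) (del {y} R2) ?Q"
    by (rule packs_light[OF tr'])
  then show ?thesis
    by - (rule star_removal[OF tr, of x y "{}" "{}"], use x in auto)
qed

text \<open>Two vertices disappear together with one edge of \<open>R1\<close> and at least two of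
  \<open>R2\<close>; three lost edges bring the weight strictly below
  \<open>card A - 2\<close>.\<close>

lemma packs_K2_removal:
  assumes tr: "triple A B R1 R2 {}" and w: "ecard R1 + ecard R2 \<le> card A"
    and c: "(c, x) \<in> R1" "dg R1 c = 1" "dg R1 x = 1"
    and y: "y \<in> B" "y' \<in> B" "y \<noteq> y'" "(y, y') \<notin> R2" "2 \<le> dg R2 y + dg R2 y'"
  shows "packs_on A B R1 R2 {}"
proof -
  note t = tripleD[OF tr]
  note s1 = simple_onD[OF t(1)] and s2 = simple_onD[OF t(2)]
  have N: "R1 `` {c} = {x}" "R1 `` {x} = {c}" using dg_1[OF c(2,1)] dg_1[OF c(3) s1(6)[OF c(1)]] by simp_all
  have cA: "c \<in> A" "x \<in> A" "c \<noteq> x" using s1(7-9)[OF c(1)] .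
  have tr': "triple (A - {c, x}) (B - {y, y'}) (del {c, x} R1) (del {y, y'} R2) {}"
    by (rule triple_del[OF tr]) (use cA y in auto)
  have "ecard (del {c, x} R1) + 1 \<le> ecard R1"
    using ecard_del_mono[OF t(7), of "{c}" "{c, x}"] ecard_del1[OF t(1), of c] c(2) by auto
  moreover have "ecard (del {y, y'} R2) + dg R2 y + dg R2 y' = ecard R2"
    by (rule ecard_del2[OF t(2) y(3,4)])
  moreover have "card (A - {c, x}) = card A - 2" using cA t(5) by (simp add: card_Diff_subset)
  moreover have "card {c, x} \<le> card A" by (rule card_mono) (use t(5) cA in auto)
  ultimately have "ecard (del {c, x} R1) + ecard (del {y, y'} R2) + card {} < card (A - {c, x})"
    using w y(5) cA(3) by simp
  then have "packs_on (A - {c, x}) (B - {y, y'}) (del {c, x} R1) (del {y, y'} R2) {}"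
    by (rule packs_light[OF tr'])
  then show ?thesis
    by - (rule star_removal[OF tr, of c y "{x}" "{y'}"], use cA y N in auto)
qed

text \<open>Sending \<open>x\<close> to a vertex of degree 2 or more would lose two edges, so
  \<open>R2\<close> has maximum degree 1. With \<open>ecard R1 \<le> ecard R2\<close> both graphs
  then have exactly n/2 edges, and since \<open>x\<close> is isolated, some vertex \<open>u\<close>
  of \<open>R1\<close> has degree at least 2. An edge of \<open>R2\<close> is finally placed on
  \<open>u\<close> and \<open>x\<close>.\<close>

lemma packs_at_n_isolated:
  assumes tr: "triple A B R1 R2 {}" and w: "ecard R1 + ecard R2 \<le> card A"
    and x: "x \<in> A" "dg R1 x = 0" and le: "ecard R1 \<le> ecard R2"
  shows "packs_on A B R1 R2 {}"
proof (rule ccontr)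
  assume no: "\<not> ?thesis"
  note t = tripleD[OF tr]
  note s1 = simple_onD[OF t(1)] and s2 = simple_onD[OF t(2)]
  have d2: "dg R2 y \<le> 1" if "y \<in> B" for y
  proof (rule ccontr)
    assume "\<not> ?thesis"
    then have "packs_on A B R1 R2 {}" using packs_single_loss2[OF tr _ x(1) that] w x by simp
    then show False using no by simp
  qed
  have "ecard R1 + ecard R2 = card A" using packs_light[OF tr] w no by fastforce
  moreover have "2 * ecard R2 \<le> card B"
    using handshake[OF t(2)] sum_bounded_above[of B "dg R2" 1] d2 by simp
  ultimately have e: "2 * ecard R1 = card A" "2 * ecard R2 = card B" using le t(4) by linarith+
  have "\<exists>u\<in>A. 2 \<le> dg R1 u"
  proof (rule ccontr)
    assume "\<not> ?thesis"
    then have "dg R1 v \<le> 1" if "v \<in> A - {x}" for v using that by fastforce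
    then have "(\<Sum>v\<in>A - {x}. dg R1 v) \<le> card (A - {x})"
      using sum_bounded_above[of "A - {x}" "dg R1" 1] by simp
    moreover have "(\<Sum>v\<in>A. dg R1 v) = (\<Sum>v\<in>A - {x}. dg R1 v)"
      using sum.remove[OF t(5) x(1), of "dg R1"] x(2) by linarith
    moreover have "card (A - {x}) < card A" using x(1) t(5) by (rule card_Diff1_less[rotated])
    ultimately show False using handshake[OF t(1)] e(1) by linarith
  qed
  then obtain u where u: "u \<in> A" "2 \<le> dg R1 u" by blast
  then have "u \<noteq> x" using x by auto
  have nx: "(u, x) \<notin> R1" using x(2) s1(6)[of u x] dg_0[OF t(7), of x] by auto
  have "card A > 0" using u(1) t(5) by (auto simp: card_gt_0_iff)
  then have "R2 \<noteq> {}" using e t(4) by auto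
  then obtain y y' where yy: "(y, y') \<in> R2" by auto
  then have yB: "y \<in> B" "y' \<in> B" "(y', y) \<in> R2" using s2(6,7,8) by blast+
  have "dg R2 y \<noteq> 0" "dg R2 y' \<noteq> 0" using yy yB dg_0[OF t(8)] by auto
  then have "dg R2 y = 1" "dg R2 y' = 1" using d2[of y] d2[of y'] yB by auto
  moreover have tr': "triple B A R2 R1 {}" using triple_swap[OF tr] by simp
  ultimately have "packs_on B A R2 R1 {}"
    using packs_K2_removal[OF tr' _ yy _ _ u(1) x(1) \<open>u \<noteq> x\<close> nx] w t(4) u(2) by simp
  then show False using no packs_on_swap[OF tr'] by simp
qed

text \<open>A leaf nets its own edge wherever it goes; a single edge of \<open>R3\<close> at the
  leaf or at its image provides the second one.\<close>

lemma packs_at_n_leaf: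
  assumes tr: "triple A B R1 R2 R3" and w: "ecard R1 + ecard R2 + card R3 \<le> card A"
    and d3: "\<And>a. a \<in> A \<Longrightarrow> dg R3 a < card A"
    and ne: "R3 \<noteq> {}" and x: "x \<in> A" "dg R1 x = 1"
  shows "packs_on A B R1 R2 R3"
proof -
  note t = tripleD[OF tr]
  have "\<exists>y\<in>B. (x, y) \<notin> R3 \<and> 1 \<le> dg R3 x + dg (R3\<inverse>) y"
  proof (cases "dg R3 x = 0")
    case True
    obtain a y where a: "(a, y) \<in> R3" using ne by auto
    then have "dg (R3\<inverse>) y \<noteq> 0" using dg_0[of "R3\<inverse>" y] t(9) by auto
    moreover have "(x, y) \<notin> R3" using True dg_0[OF t(9), of x] by auto
    ultimately show ?thesis using a t(3) by force
  next
    case False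
    obtain y where "y \<in> B" "y \<notin> R3 `` {x}"
      using exists_not_in[of "R3 `` {x}" B] d3[OF x(1)] t(4,9) by (auto simp: finite_Image)
    then show ?thesis using False by force
  qed
  then obtain y where "y \<in> B" "(x, y) \<notin> R3" "1 \<le> dg R3 x + dg (R3\<inverse>) y" by blast
  then show ?thesis using packs_single_loss2[OF tr w x(1)] x(2) by simp
qed

text \<open>The excluded case is a single edge against a single edge on two vertices, which indeed
  does not pack.\<close>

lemma packs_at_n:
  assumes tr: "triple A B R1 R2 R3" and w: "ecard R1 + ecard R2 + card R3 \<le> card A"
    and d3: "\<And>a. a \<in> A \<Longrightarrow> dg R3 a < card A" "\<And>b. b \<in> B \<Longrightarrow> dg (R3\<inverse>) b < card A"
    and no: "\<not> (card A = 2 \<and> ecard R1 = 1 \<and> ecard R2 = 1)"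
  shows "packs_on A B R1 R2 R3"
proof (rule ccontr)
  assume np: "\<not> ?thesis"
  note t = tripleD[OF tr]
  note s1 = simple_onD[OF t(1)] and s2 = simple_onD[OF t(2)]
  have tr': "triple B A R2 R1 (R3\<inverse>)" using triple_swap[OF tr] .
  have np': "\<not> packs_on B A R2 R1 (R3\<inverse>)" using np packs_on_swap_iff[OF tr] by simp
  have w': "ecard R2 + ecard R1 + card (R3\<inverse>) \<le> card B" using w t(4) by (simp add: card_inverse)
  have weq: "ecard R1 + ecard R2 + card R3 = card A" using packs_light[OF tr] w np by fastforce
  have triv: "packs_on A B R1 {} {}" "packs_on A B {} R2 {}"
  proof -
    obtain f where "bij_betw f A B" using t(4-6) finite_same_card_bij by blast
    then show "packs_on A B R1 {} {}" "packs_on A B {} R2 {}" by (auto simp: packs_on_def)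
  qed
  show False
  proof (cases "R3 = {}")
    case True
    have tr0: "triple A B R1 R2 {}" and tr0': "triple B A R2 R1 {}" using tr tr' True by auto
    have np0: "\<not> packs_on A B R1 R2 {}" "\<not> packs_on B A R2 R1 {}" using np np' True by auto
    have w0: "ecard R1 + ecard R2 = card A" using weq True by simp
    have i1: "card A \<le> 2 * ecard R1" if "ecard R1 \<le> ecard R2"
    proof -
      have "1 \<le> dg R1 x" if "x \<in> A" for x
        using packs_at_n_isolated[OF tr0 _ that] w0 \<open>ecard R1 \<le> ecard R2\<close> np0 by fastforce
      then show ?thesis using degree_sum_ge0[OF t(1), of 1] by simp
    qed
    have i2: "card A \<le> 2 * ecard R2" if "ecard R2 \<le> ecard R1"
    proof -
      have "1 \<le> dg R2 x" if "x \<in> B" for x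
        using packs_at_n_isolated[OF tr0' _ that] w0 \<open>ecard R2 \<le> ecard R1\<close> np0 t(4) by fastforce
      then show ?thesis using degree_sum_ge0[OF t(2), of 1] t(4) by simp
    qed
    have e: "2 * ecard R1 = card A" "2 * ecard R2 = card A"
      using i1 i2 w0 by linarith+
    have n1: "1 \<le> dg R1 x" if "x \<in> A" for x
      using packs_at_n_isolated[OF tr0 _ that] w0 e np0 by fastforce
    have n2: "1 \<le> dg R2 x" if "x \<in> B" for x
      using packs_at_n_isolated[OF tr0' _ that] w0 e np0 t(4) by fastforce
    have m1: "dg R1 x = 1" if "x \<in> A" for x
    proof -
      have "card A > 0" using that t(5) by (auto simp: card_gt_0_iff)
      then show ?thesis using degree_sum_ge1[OF t(1) that n1] e(1) n1[OF that] by simp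
    qed
    have m2: "dg R2 x = 1" if "x \<in> B" for x
    proof -
      have "card B > 0" using that t(6) by (auto simp: card_gt_0_iff)
      then show ?thesis using degree_sum_ge1[OF t(2) that n2] e(2) t(4) n2[OF that] by simp
    qed
    have "R1 \<noteq> {}" using triv(2) np0 by auto
    then obtain c x where cx: "(c, x) \<in> R1" by auto
    then have cA: "c \<in> A" "x \<in> A" using s1(7,8) by blast+
    then have "card A > 0" using t(5) by (auto simp: card_gt_0_iff)
    \<comment> \<open>Both graphs are perfect matchings, so \<open>card A\<close> is even, and size
      2 is the excluded case.\<close>
    then have big: "card A > 2" using no e by presburger
    then obtain y where y: "y \<in> B" using t(4) by fastforce
    have "card (insert y (R2 `` {y})) \<le> 2"
      using m2[OF y] card_insert_le_m1[of 2 "R2 `` {y}" y] by simp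
    then obtain y' where y': "y' \<in> B" "y' \<notin> insert y (R2 `` {y})"
      using exists_not_in[of "insert y (R2 `` {y})" B] s2(3) big t(4) by auto
    have "packs_on A B R1 R2 {}"
      by (rule packs_K2_removal[OF tr0 _ cx m1[OF cA(1)] m1[OF cA(2)] y y'(1)])
        (use w0 y' m2[OF y] m2[OF y'(1)] in auto)
    then show False using np0 by simp
  next
    case False
    have nl1: "dg R1 x \<noteq> 1" if "x \<in> A" for x
      using packs_at_n_leaf[OF tr w d3(1) False that] np by blast
    have nl2: "dg R2 x \<noteq> 1" if "x \<in> B" for x
      using packs_at_n_leaf[OF tr' w' _ _ that] np' False d3(2) t(4) by auto
    note loss2 = packs_single_loss2[OF tr w]
    have "card R3 > 0" using False t(9) by (simp add: card_gt_0_iff)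
    then have "ecard R1 < card A" using w by simp
    then obtain x where x: "x \<in> A" "dg R1 x = 0"
      using exists_low_degree[OF t(1)] nl1 by (metis One_nat_def le_Suc_eq le_zero_eq)
    \<comment> \<open>Once \<open>R2\<close> is empty every bijection respects \<open>R1\<close>, so
      \<open>R3\<close> alone has to be packed.\<close>
    have light: "\<not> card R3 < card A" if "R2 = {}"
    proof
      assume "card R3 < card A"
      moreover have "triple A B {} {} R3" using tr by (auto simp: triple_def simple_on_def sym_def irrefl_def)
      ultimately have "packs_on A B {} {} R3" by (intro packs_light) auto
      then show False using packs_on_edgeless np that by blast
    qed
    \<comment> \<open>The isolated \<open>x\<close> creates no new pairs, so everything met at
      \<open>x\<close> and \<open>y\<close> is net loss and cannot reach two.\<close>
    have l: "dg R2 y + dg R3 x + dg (R3\<inverse>) y \<le> 1" if "y \<in> B" "(x, y) \<notin> R3" for y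
      using loss2[OF x(1) that] x(2) np by fastforce
    obtain y1 where y1: "y1 \<in> B" "y1 \<notin> R3 `` {x}"
      using exists_not_in[of "R3 `` {x}" B] d3(1)[OF x(1)] t(4,9) by (auto simp: finite_Image)
    then have "dg R3 x \<le> 1" using l[of y1] by auto
    then consider "dg R3 x = 0" | "dg R3 x = 1" by linarith
    then show False
    proof cases
      case 1
      then have nx: "(x, y) \<notin> R3" for y using dg_0[OF t(9), of x] by auto
      have l1: "dg R2 y = 0" "dg (R3\<inverse>) y \<le> 1" if "y \<in> B" for y
        using l[OF that nx] nl2[OF that] by linarith+
      have "R2 = {}"
      proof (rule ccontr)
        assume "R2 \<noteq> {}"
        then obtain p q where "(p, q) \<in> R2" by auto
        then show False using l1(1)[of p] s2(7) dg_0[OF t(8), of p] by auto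
      qed
      \<comment> \<open>All edges of the triple lie in \<open>R3\<close>. As degrees on the
        \<open>B\<close> side are at most 1, each is exactly 1, and any vertex \<open>u\<close> with
        an \<open>R3\<close> edge finds a non-neighbour where two edges are lost.\<close>
      then have c3: "card R3 = card A" using light weq by linarith
      obtain u z where uz: "(u, z) \<in> R3" using False by auto
      then have uA: "u \<in> A" using t(3) by auto
      obtain y where y: "y \<in> B" "y \<notin> R3 `` {u}"
        using exists_not_in[of "R3 `` {u}" B] d3(1)[OF uA] t(4,9) by (auto simp: finite_Image)
      have "dg (R3\<inverse>) y = 1"
      proof (rule ccontr)
        assume "dg (R3\<inverse>) y \<noteq> 1"
        then have "dg (R3\<inverse>) y = 0" using l1(2)[OF y(1)] by simp
        then have "card R3 = (\<Sum>v\<in>B - {y}. dg (R3\<inverse>) v)"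
          using sum.remove[OF t(6) y(1), of "dg (R3\<inverse>)"] sum_dg_bip(2)[OF t(5,6,3)] by linarith
        also have "\<dots> \<le> card (B - {y})"
          using sum_bounded_above[of "B - {y}" "dg (R3\<inverse>)" 1] l1(2) by simp
        also have "\<dots> < card B" using y(1) t(6) by (rule card_Diff1_less[rotated])
        finally show False using c3 t(4) by simp
      qed
      moreover have "dg R3 u \<noteq> 0" using uz dg_0[OF t(9), of u] by auto
      ultimately have "packs_on A B R1 R2 R3" using loss2[OF uA y(1)] y(2) l1(1)[OF y(1)] by simp
      then show False using np by simp
    next
      case 2
      then obtain y0 where y0: "R3 `` {x} = {y0}" using card_1_singletonE by blast
      have l1: "dg R2 y = 0" "dg (R3\<inverse>) y = 0" if "y \<in> B" "y \<noteq> y0" for y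
        using l[of y] that y0 2 by auto
      have "R2 = {}"
      proof (rule ccontr)
        assume "R2 \<noteq> {}"
        then obtain p q where pq: "(p, q) \<in> R2" by auto
        then have "(q, p) \<in> R2" "p \<noteq> q" "p \<in> B" "q \<in> B" using s2(6-9) by blast+
        then show False using pq l1(1)[of p] l1(1)[of q] dg_0[OF t(8), of p] dg_0[OF t(8), of q] by auto
      qed
      \<comment> \<open>All edges of \<open>R3\<close> end in \<open>y0\<close>, whose degree is
        below \<open>card A\<close>.\<close>
      moreover have "card R3 < card A"
      proof -
        have yB: "y0 \<in> B" using y0 t(3) by blast
        have "card R3 = dg (R3\<inverse>) y0 + (\<Sum>v\<in>B - {y0}. dg (R3\<inverse>) v)"
          using sum.remove[OF t(6) yB, of "dg (R3\<inverse>)"] sum_dg_bip(2)[OF t(5,6,3)] by linarith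
        also have "(\<Sum>v\<in>B - {y0}. dg (R3\<inverse>) v) = 0" using l1(2) by simp
        finally show ?thesis using d3(2)[OF yB] by simp
      qed
      ultimately show False using light by blast
    qed
  qed
qed

section \<open>End stars and sets touching many edges\<close>

text \<open>Strip off all leaves: the remaining graph has so few edges that some vertex outside
  \<open>F\<close> keeps degree at most 1, and its other neighbours are leaves. If some component is
  a single edge, one of its ends is returned; the last conclusion records this preference.\<close>

lemma exists_end_star:
  assumes sg: "simple_on V R" and d1: "\<And>v. v \<in> V \<Longrightarrow> 1 \<le> dg R v"
    and F: "F \<subseteq> V" "\<And>v. v \<in> F \<Longrightarrow> dg R v \<noteq> 1" and w: "card F + ecard R < card V"
  obtains c where "c \<in> V" "c \<notin> F" "{l \<in> R `` {c}. dg R l = 1} \<noteq> {}"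
    "card (R `` {c} - {l \<in> R `` {c}. dg R l = 1}) \<le> 1"
    "\<And>u v. (u, v) \<in> R \<Longrightarrow> dg R u = 1 \<Longrightarrow> dg R v = 1 \<Longrightarrow> dg R c = 1"
proof (cases "\<exists>u v. (u, v) \<in> R \<and> dg R u = 1 \<and> dg R v = 1")
  case True
  then obtain u v where uv: "(u, v) \<in> R" "dg R u = 1" "dg R v = 1" by blast
  have N: "R `` {u} = {v}" using dg_1[OF uv(2,1)] .
  have "u \<in> V" using simple_onD(7)[OF sg uv(1)] .
  moreover have "u \<notin> F" using F(2) uv(2) by blast
  moreover have "{l \<in> R `` {u}. dg R l = 1} = {v}" using N uv(3) by auto
  ultimately show ?thesis using that[of u] N uv by simp
next
  case False
  note s = simple_onD[OF sg]
  define Lf where "Lf = {v \<in> V. dg R v = 1}"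
  let ?N = "V - Lf"
  \<comment> \<open>Edges between non-leaves and leaves. No component is a single edge here, so
    every leaf contributes exactly one of them.\<close>
  let ?B = "R \<inter> ?N \<times> Lf"
  have fin: "finite Lf" "finite ?N" "Lf \<subseteq> V" using s(1) by (auto simp: Lf_def)
  have leaf: "?B\<inverse> `` {l} = R `` {l}" if "l \<in> Lf" for l
  proof -
    have "u \<in> ?N \<and> (u, l) \<in> R" if "(l, u) \<in> R" for u
      using False that \<open>l \<in> Lf\<close> s(6)[OF that] s(8)[OF that] by (auto simp: Lf_def)
    moreover have "(l, u) \<in> R" if "(u, l) \<in> R" for u using s(6)[OF that] .
    ultimately show ?thesis using \<open>l \<in> Lf\<close> by blast
  qed
  have "(\<Sum>l\<in>Lf. dg (?B\<inverse>) l) = (\<Sum>l\<in>Lf. 1)"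
    by (rule sum.cong) (use leaf in \<open>auto simp: Lf_def\<close>)
  then have "card ?B = card Lf"
    using sum_dg_bip(2)[of ?N Lf ?B] fin by simp
  moreover have "card ?B = (\<Sum>v\<in>?N. card (R `` {v} \<inter> Lf))"
  proof -
    have "?B `` {v} = R `` {v} \<inter> Lf" if "v \<in> ?N" for v using that by auto
    then have "(\<Sum>v\<in>?N. dg ?B v) = (\<Sum>v\<in>?N. card (R `` {v} \<inter> Lf))"
      by (intro sum.cong) simp_all
    then show ?thesis using sum_dg_bip(1)[of ?N Lf ?B] fin by simp
  qed
  ultimately have L: "(\<Sum>v\<in>?N. card (R `` {v} \<inter> Lf)) = card Lf" by simp
  have "dg R v = card (R `` {v} \<inter> Lf) + card (R `` {v} - Lf)" for v
    using card_Un_disjoint[of "R `` {v} \<inter> Lf" "R `` {v} - Lf"] s(3)[of v]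
    by (simp add: Int_Diff_disjoint Int_Diff_Un)
  then have "(\<Sum>v\<in>?N. dg R v) = card Lf + (\<Sum>v\<in>?N. card (R `` {v} - Lf))"
    by (simp add: sum.distrib L)
  moreover have "(\<Sum>v\<in>Lf. dg R v) = card Lf" by (simp add: Lf_def)
  ultimately have tot: "2 * ecard R = 2 * card Lf + (\<Sum>v\<in>?N. card (R `` {v} - Lf))"
    using handshake[OF sg] sum.subset_diff[OF fin(3) s(1), of "dg R"] by simp
  have FN: "F \<subseteq> ?N" using F by (auto simp: Lf_def)
  \<comment> \<open>If all stripped degrees outside \<open>F\<close> were at least 2, the stripped
    degree sum would give n - |F| \<le> e.\<close>
  have "\<exists>c\<in>?N - F. card (R `` {c} - Lf) \<le> 1"
  proof (rule ccontr)
    assume "\<not> ?thesis"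
    then have ge: "2 \<le> card (R `` {c} - Lf)" if "c \<in> ?N - F" for c using that by force
    have "2 * card (?N - F) \<le> (\<Sum>v\<in>?N - F. card (R `` {v} - Lf))"
      using sum_bounded_below[of "?N - F" 2 "\<lambda>v. card (R `` {v} - Lf)"] ge by simp
    also have "\<dots> \<le> (\<Sum>v\<in>?N. card (R `` {v} - Lf))"
      by (rule sum_mono2) (use fin in auto)
    finally have "2 * card (?N - F) + 2 * card Lf \<le> 2 * ecard R" using tot by simp
    moreover have "card (?N - F) = card ?N - card F"
      using FN fin by (intro card_Diff_subset) (auto intro: finite_subset)
    moreover have "card ?N = card V - card Lf" using fin by (intro card_Diff_subset)
    moreover have "card Lf \<le> card V" using fin(3) s(1) by (rule card_mono[rotated])
    moreover have "card F \<le> card ?N" using FN fin(2) by (rule card_mono[rotated])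
    ultimately show False using w by linarith
  qed
  then obtain c where c: "c \<in> V" "c \<notin> Lf" "c \<notin> F" "card (R `` {c} - Lf) \<le> 1" by blast
  have eq: "{l \<in> R `` {c}. dg R l = 1} = R `` {c} \<inter> Lf" using s(4)[of c] by (auto simp: Lf_def)
  have "dg R c \<noteq> 1" "1 \<le> dg R c" using c d1[of c] by (auto simp: Lf_def)
  then have "R `` {c} \<inter> Lf \<noteq> {}" using c(4) by (auto simp: Diff_triv)
  moreover have "R `` {c} - R `` {c} \<inter> Lf = R `` {c} - Lf" by auto
  ultimately show ?thesis using that[of c] c eq False by auto
qed

text \<open>Split the handshake sum at \<open>Y\<close>. Outside \<open>Y\<close> degrees can only
  shrink by the deletion, and that of \<open>q\<close> does shrink, whence the strict
  inequality.\<close>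

lemma ecard_del_boundary:
  assumes sg: "simple_on V R" and Y: "Y \<subseteq> V" and pq: "(p, q) \<in> R" "p \<in> Y" "q \<notin> Y"
  shows "(\<Sum>v\<in>Y. dg R v) + 2 * ecard (del Y R) < 2 * ecard R"
proof -
  note s = simple_onD[OF sg]
  have q: "q \<in> V - Y" using s(8)[OF pq(1)] pq(3) by simp
  have "dg (del Y R) q < dg R q" using dg_del_less[OF s(2) s(6)[OF pq(1)] pq(2)] .
  moreover have "\<forall>v\<in>V - Y. dg (del Y R) v \<le> dg R v" using dg_del_le[OF s(2)] by blast
  ultimately have "(\<Sum>v\<in>V - Y. dg (del Y R) v) < (\<Sum>v\<in>V - Y. dg R v)"
    using q s(1) by (intro sum_strict_mono_ex1) auto
  then show ?thesis
    using handshake[OF sg] handshake[OF simple_on_del[OF sg, of Y]]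
      sum.subset_diff[OF Y s(1), of "dg R"] by linarith
qed

text \<open>Degree sums alone give \<open>k\<close> touched edges; the extra one comes from an edge
  leaving \<open>Y\<close>.\<close>

lemma exists_touching_set:
  assumes sg: "simple_on V R" and d2: "\<And>v. v \<in> V \<Longrightarrow> 2 \<le> dg R v"
    and M: "M \<subseteq> V" and k: "1 \<le> k" "k < card M"
  obtains Y where "Y \<subseteq> M" "card Y = k" "ecard (del Y R) + k + 1 \<le> ecard R"
proof -
  note s = simple_onD[OF sg]
  obtain Y0 where Y0: "Y0 \<subseteq> M" "card Y0 = k" using k obtain_subset_with_card_n[of k M] by auto
  have "finite M" using M s(1) finite_subset by blast
  then have fY: "finite Y0" using Y0(1) finite_subset by blast
  have "\<exists>Y p q. Y \<subseteq> M \<and> card Y = k \<and> (p, q) \<in> R \<and> p \<in> Y \<and> q \<notin> Y"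
  proof (cases "\<exists>p q. (p, q) \<in> R \<and> p \<in> Y0 \<and> q \<notin> Y0")
    case True
    then show ?thesis using Y0 by blast
  next
    case False
    \<comment> \<open>\<open>Y0\<close> is a union of components. Exchanging one of its vertices
      \<open>v\<close> for an outside vertex \<open>u\<close> turns an edge at \<open>v\<close> into
      a boundary edge.\<close>
    obtain v where v: "v \<in> Y0" using Y0(2) k(1) by fastforce
    have "v \<in> V" using v Y0 M by blast
    then have "R `` {v} \<noteq> {}" using d2[of v] by auto
    then obtain z where z: "(v, z) \<in> R" by auto
    have zY: "z \<in> Y0" "z \<noteq> v" using False v z s(9)[OF z] by auto
    obtain u where u: "u \<in> M" "u \<notin> Y0" using exists_not_in[OF fY, of M] Y0(2) k(2) by auto
    let ?Y = "insert u (Y0 - {v})"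
    have "card ?Y = k" using u v fY Y0(2) k(1) by simp
    moreover have "?Y \<subseteq> M" using u Y0(1) by blast
    moreover have "z \<in> ?Y" "v \<notin> ?Y" using zY u v by auto
    ultimately show ?thesis using s(6)[OF z] by blast
  qed
  then obtain Y p q where Y: "Y \<subseteq> M" "card Y = k" and pq: "(p, q) \<in> R" "p \<in> Y" "q \<notin> Y" by blast
  have "Y \<subseteq> V" using Y M by blast
  moreover have "card Y * 2 \<le> (\<Sum>v\<in>Y. dg R v)"
    using sum_bounded_below[of Y 2 "dg R"] d2 \<open>Y \<subseteq> V\<close> by auto
  ultimately have "ecard (del Y R) + k + 1 \<le> ecard R"
    using ecard_del_boundary[OF sg _ pq] Y(2) by fastforce
  then show ?thesis using that Y by blast
qed

section \<open>The exceptional pairs\<close>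

definition clique :: "'a set \<Rightarrow> 'a rel" where
  "clique C = C \<times> C - Id"

text \<open>All seven exceptional pairs have the same shape: a clique on \<open>j \<in> {3, 4}\<close> vertices plus
  isolated vertices, against \<open>j - 1\<close> cliques of sizes 2 or 3 that cover everything; by the pigeonhole
  principle two vertices of the former clique land in the same clique of the latter graph.\<close>

definition exceptional_on :: "'a set \<Rightarrow> 'a set \<Rightarrow> 'a rel \<Rightarrow> 'a rel \<Rightarrow> bool" where
  "exceptional_on A B R1 R2 \<longleftrightarrow> (\<exists>C P. C \<subseteq> A \<and> (card C = 3 \<or> card C = 4) \<and> R1 = clique C \<and>
     partition_on B P \<and> card P + 1 = card C \<and> (\<forall>p\<in>P. card p = 2 \<or> card p = 3) \<and>
     R2 = (\<Union>p\<in>P. clique p))"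

lemma excE:
  assumes "exceptional_on A B R1 R2"
  obtains C P where "C \<subseteq> A" "card C = 3 \<or> card C = 4" "R1 = clique C" "partition_on B P"
    "card P + 1 = card C" "\<forall>p\<in>P. card p = 2 \<or> card p = 3" "R2 = (\<Union>p\<in>P. clique p)"
  using assms unfolding exceptional_on_def by (elim exE conjE) (rule that)

lemma in_clique [simp]: "(u, v) \<in> clique C \<longleftrightarrow> u \<in> C \<and> v \<in> C \<and> u \<noteq> v"
  by (auto simp: clique_def)

lemma clique_Image: "clique C `` {v} = (if v \<in> C then C - {v} else {})"
  by auto

lemma dg_clique: "dg (clique C) v = (if v \<in> C then card C - 1 else 0)"
  by (simp add: clique_Image card_Diff_singleton_if)

lemma card_clique: "finite C \<Longrightarrow> card (clique C) = card C * (card C - 1)"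
proof -
  assume "finite C"
  moreover have "clique C \<subseteq> C \<times> C" by (auto simp: clique_def)
  moreover have "finite (clique C)" using \<open>finite C\<close> by (simp add: clique_def)
  ultimately have "card (clique C) = (\<Sum>v\<in>C. dg (clique C) v)" by (intro card_rel)
  then show ?thesis by (simp add: dg_clique)
qed

section \<open>Degrees and edge counts of exceptional pairs\<close>

lemma partition_clique_Image:
  assumes "partition_on B P" "p \<in> P" "b \<in> p"
  shows "(\<Union>p\<in>P. clique p) `` {b} = p - {b}"
proof -
  have "p' = p" if "p' \<in> P" "b \<in> p'" for p'
    using partition_onD2[OF assms(1)] assms(2,3) that by (auto simp: disjoint_def)
  then have "x \<in> p \<and> x \<noteq> b" if "(b, x) \<in> (\<Union>p\<in>P. clique p)" for x
    using that by (metis UN_E in_clique)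
  moreover have "(b, x) \<in> (\<Union>p\<in>P. clique p)" if "x \<in> p" "x \<noteq> b" for x
    using that assms(2,3) by (intro UN_I[OF assms(2)]) simp
  ultimately have "(b, x) \<in> (\<Union>p\<in>P. clique p) \<longleftrightarrow> x \<in> p \<and> x \<noteq> b" for x by metis
  then show ?thesis by (simp only: set_eq_iff Image_singleton_iff Diff_iff singleton_iff simp_thms)
qed

text \<open>With j = \<open>card C\<close>, the j - 1 cliques cover at least 2 (j - 1) > j vertices,
  so \<open>C\<close> cannot exhaust \<open>A\<close> and an isolated vertex exists.\<close>

lemma exc_left:
  assumes "exceptional_on A B R1 R2" "finite A" "finite B" "card A = card B"
  obtains C a where "C \<subseteq> A" "3 \<le> card C" "card C \<le> 4" "R1 = clique C" "a \<in> A" "a \<notin> C" "dg R1 a = 0"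
proof -
  obtain C P where *: "C \<subseteq> A" "card C = 3 \<or> card C = 4" "R1 = clique C"
     "partition_on B P" "card P + 1 = card C" "\<forall>p\<in>P. card p = 2 \<or> card p = 3"
    using excE[OF assms(1)] by metis
  have fP: "finite P" "\<And>p. p \<in> P \<Longrightarrow> finite p"
    using *(4) assms(3) by (auto simp: partition_on_def intro: finite_UnionD finite_subset)
  have "card B = (\<Sum>p\<in>P. card p)"
    using card_Union_disjoint[of P] partition_onD1[OF *(4)] partition_onD2[OF *(4)] fP
    by (simp add: disjoint_def pairwise_def disjnt_def)
  moreover have "card P * 2 \<le> (\<Sum>p\<in>P. card p)"
    using sum_bounded_below[of P 2 card] *(6) by fastforce
  ultimately have "card C < card A" using *(2,5) assms(4) by linarith
  moreover have "finite C" using *(1) assms(2) finite_subset by blast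
  ultimately obtain a where "a \<in> A" "a \<notin> C" using exists_not_in by blast
  then show ?thesis using that[of C a] * by (auto simp: dg_clique)
qed

text \<open>Degree 1 never occurs on the clique side; together with the bounds 1 and 2 on the other
  side this refutes most exceptional remainders.\<close>

lemma exc_left_dg:
  assumes "exceptional_on A B R1 R2"
  shows "dg R1 v = 0 \<or> 2 \<le> dg R1 v"
  using assms by (elim excE) (auto simp: dg_clique)

lemma exc_right_dg:
  assumes "exceptional_on A B R1 R2" "b \<in> B"
  shows "1 \<le> dg R2 b" "dg R2 b \<le> 2"
proof -
  obtain C P where *: "partition_on B P" "\<forall>p\<in>P. card p = 2 \<or> card p = 3" "R2 = (\<Union>p\<in>P. clique p)"
    using excE[OF assms(1)] by metis
  obtain p where p: "p \<in> P" "b \<in> p" using assms(2) partition_onD1[OF *(1)] by blast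
  have "dg R2 b = card p - 1"
    using partition_clique_Image[OF *(1) p] p *(3) by (simp add: card_Diff_singleton_if)
  then show "1 \<le> dg R2 b" "dg R2 b \<le> 2" using *(2) p(1) by auto
qed

text \<open>Every exceptional pair meets the edge bound 2 n - 3 with equality, for all seven at once
  by two identities valid exactly for the sizes involved.\<close>

lemma exc_ecard:
  assumes "exceptional_on A B R1 R2" "simple_on A R1" "simple_on B R2"
  shows "ecard R1 + ecard R2 + 3 = 2 * card B"
proof -
  obtain C P where *: "C \<subseteq> A" "card C = 3 \<or> card C = 4" "R1 = clique C"
     "partition_on B P" "card P + 1 = card C" "\<forall>p\<in>P. card p = 2 \<or> card p = 3"
     "R2 = (\<Union>p\<in>P. clique p)"
    by (rule excE[OF assms(1)], rule that)
  note fA = simple_onD(1)[OF assms(2)] and fB = simple_onD(1)[OF assms(3)]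
  have fP: "finite P" "\<And>p. p \<in> P \<Longrightarrow> finite p"
    using *(4) fB by (auto simp: partition_on_def intro: finite_UnionD finite_subset)
  have dis: "\<forall>p\<in>P. \<forall>q\<in>P. p \<noteq> q \<longrightarrow> p \<inter> q = {}"
    using partition_onD2[OF *(4)] by (auto simp: disjoint_def)
  have un: "B = \<Union> P" by (rule partition_onD1[OF *(4)])
  have cB: "card B = (\<Sum>p\<in>P. card p)"
    using card_Union_disjoint[of P] dis un fP
    by (simp add: pairwise_def disjnt_def)
  have "(\<Sum>a\<in>A. dg R1 a) = (\<Sum>a\<in>C. dg R1 a)"
    by (rule sum.mono_neutral_right) (use fA *(1,3) in \<open>auto simp: dg_clique\<close>)
  also have "\<dots> = card C * (card C - 1)" using *(3) by (simp add: dg_clique)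
  finally have e1: "2 * ecard R1 = card C * (card C - 1)" using handshake[OF assms(2)] by simp
  have "(\<Sum>b\<in>B. dg R2 b) = (\<Sum>p\<in>P. \<Sum>b\<in>p. dg R2 b)"
    unfolding un using sum.Union_disjoint[of P "dg R2"] fP dis by simp
  also have "\<dots> = (\<Sum>p\<in>P. card p * (card p - 1))"
  proof (rule sum.cong)
    fix p assume p: "p \<in> P"
    have "dg R2 b = card p - 1" if "b \<in> p" for b
      using partition_clique_Image[OF *(4) p that] that *(7) by (simp add: card_Diff_singleton_if)
    then show "(\<Sum>b\<in>p. dg R2 b) = card p * (card p - 1)" by simp
  qed simp
  finally have "2 * ecard R2 = (\<Sum>p\<in>P. card p * (card p - 1))" using handshake[OF assms(3)] by simp
  \<comment> \<open>The sizes k = 2 and k = 3 are the roots of k (k - 1) + 6 = 4 k.\<close>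
  then have "2 * ecard R2 + 6 * card P = (\<Sum>p\<in>P. card p * (card p - 1) + 6)"
    by (simp add: sum.distrib)
  also have "\<dots> = (\<Sum>p\<in>P. 4 * card p)"
    by (rule sum.cong) (use *(6) in force)+
  finally have "2 * ecard R2 + 6 * card P = 4 * card B" using cB by (simp add: sum_distrib_left)
  \<comment> \<open>Likewise j (j - 1) + 6 = 6 (j - 1) for j = 3 and j = 4.\<close>
  then show ?thesis using e1 *(2,5) by auto
qed

section \<open>Minimal counterexamples\<close>

text \<open>The hypotheses of the theorem with all subtractions moved across, safe for natural
  numbers. Both orders of the pair are excluded since \<open>exceptional_on\<close> is oriented: its
  first graph is the clique.\<close>

definition admissible :: "'a set \<Rightarrow> 'a set \<Rightarrow> 'a rel \<Rightarrow> 'a rel \<Rightarrow> 'a rel \<Rightarrow> bool" where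
  "admissible A B R1 R2 R3 \<longleftrightarrow> triple A B R1 R2 R3 \<and> ecard R1 + ecard R2 + card R3 + 3 \<le> 2 * card A \<and>
     (\<forall>a\<in>A. dg R1 a + 2 \<le> card A) \<and> (\<forall>b\<in>B. dg R2 b + 2 \<le> card A) \<and>
     (\<forall>a\<in>A. dg R3 a < card A) \<and> (\<forall>b\<in>B. dg (R3\<inverse>) b < card A) \<and>
     \<not> exceptional_on A B R1 R2 \<and> \<not> exceptional_on B A R2 R1"

text \<open>Smaller triples live on subsets of \<open>A\<close> and \<open>B\<close>, so minimality
  is stated over the same vertex type. The locale is closed under exchanging the two sides
  (\<open>swap\<close>), which yields the mirrored lemmas.\<close>

locale min_counterexample =
  fixes A B :: "'a set" and R1 R2 R3 :: "'a rel"
  assumes admissible: "admissible A B R1 R2 R3"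
    and np: "\<not> packs_on A B R1 R2 R3"
    and IH: "\<And>A' B' R1' R2' (R3' :: 'a rel). card A' < card A \<Longrightarrow> admissible A' B' R1' R2' R3' \<Longrightarrow> packs_on A' B' R1' R2' R3'"
begin

lemma tr: "triple A B R1 R2 R3"
  and weight: "ecard R1 + ecard R2 + card R3 + 3 \<le> 2 * card A"
  and deg1: "\<And>a. a \<in> A \<Longrightarrow> dg R1 a + 2 \<le> card A"
  and deg2: "\<And>b. b \<in> B \<Longrightarrow> dg R2 b + 2 \<le> card A"
  and deg3: "\<And>a. a \<in> A \<Longrightarrow> dg R3 a < card A"
  and deg3': "\<And>b. b \<in> B \<Longrightarrow> dg (R3\<inverse>) b < card A"
  and nexc: "\<not> exceptional_on A B R1 R2" "\<not> exceptional_on B A R2 R1"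
  using admissible by (auto simp: admissible_def)

lemmas t = tripleD[OF tr]
lemmas s1 = simple_onD[OF t(1)]
lemmas s2 = simple_onD[OF t(2)]

lemma swap: "min_counterexample B A R2 R1 (R3\<inverse>)"
proof
  show "admissible B A R2 R1 (R3\<inverse>)"
    using admissible t(4) by (auto simp: admissible_def triple_swap card_inverse)
  show "\<not> packs_on B A R2 R1 (R3\<inverse>)" using np packs_on_swap_iff[OF tr] by simp
  show "packs_on A' B' R1' R2' R3'" if "card A' < card B" "admissible A' B' R1' R2' R3'"
    for A' B' R1' R2' and R3' :: "'a rel"
    using IH[OF _ that(2)] that(1) t(4) by simp
qed

lemma weight_gt: "card A < ecard R1 + ecard R2 + card R3"
proof (rule ccontr)
  assume "\<not> ?thesis"
  then have "packs_on A B R1 R2 R3"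
    \<comment> \<open>The excluded case of \<open>packs_at_n\<close> violates the edge bound, since
      1 + 1 + 3 > 4.\<close>
    by (intro packs_at_n[OF tr]) (use deg3 deg3' weight in auto)
  then show False using np by simp
qed

lemma n_ge_4: "4 \<le> card A"
  using weight weight_gt by linarith

text \<open>The remainder has n' = n - |L| - 1 vertices; the constants 5, 3 and 2 are those of
  \<open>admissible\<close> after this substitution. As it does not pack, minimality leaves only the
  exceptional case, where \<open>exc_ecard\<close> forces equality: \<open>Q\<close> is empty and no
  edge beyond the required number is lost.\<close>

lemma reduce:
  assumes c: "c \<in> A" "y \<in> B" "(c, y) \<notin> R3"
    and L: "L \<subseteq> A" "\<And>l. l \<in> L \<Longrightarrow> R1 `` {l} = {c}"
    and Y: "Y \<subseteq> B" "card Y = card L" "y \<notin> Y" "Y \<inter> R2 `` {y} = {}" "R3 \<inter> L \<times> Y = {}"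
    and Q: "R3 \<inter> (- insert c L) \<times> (- insert y Y) \<subseteq> Q" "(R1 `` {c} - L) \<times> (R2 `` {y} - Y) \<subseteq> Q"
      "Q \<subseteq> (A - insert c L) \<times> (B - insert y Y)"
    and w: "ecard (del (insert c L) R1) + ecard (del (insert y Y) R2) + card Q + 2 * card L + 5 \<le> 2 * card A"
    and d1: "\<And>a. a \<in> A \<Longrightarrow> a \<notin> insert c L \<Longrightarrow> dg (del (insert c L) R1) a + card L + 3 \<le> card A"
    and d2: "\<And>b. b \<in> B \<Longrightarrow> b \<notin> insert y Y \<Longrightarrow> dg (del (insert y Y) R2) b + card L + 3 \<le> card A"
    and d3: "\<And>a. a \<in> A \<Longrightarrow> a \<notin> insert c L \<Longrightarrow> dg Q a + card L + 2 \<le> card A"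
    and d3': "\<And>b. b \<in> B \<Longrightarrow> b \<notin> insert y Y \<Longrightarrow> dg (Q\<inverse>) b + card L + 2 \<le> card A"
  shows "exceptional_on (A - insert c L) (B - insert y Y) (del (insert c L) R1) (del (insert y Y) R2) \<or>
      exceptional_on (B - insert y Y) (A - insert c L) (del (insert y Y) R2) (del (insert c L) R1)"
    and "Q = {}"
    and "ecard (del (insert c L) R1) + ecard (del (insert y Y) R2) + 2 * card L + 5 = 2 * card A"
proof -
  let ?A = "A - insert c L" and ?B = "B - insert y Y"
  let ?R1 = "del (insert c L) R1" and ?R2 = "del (insert y Y) R2"
  have fin: "finite L" "finite Y" using L(1) Y(1) t(5,6) finite_subset by blast+
  have cL: "c \<notin> L" using L(2)[of c] s1(5)[of c] by auto
  have cc: "card (insert c L) = card L + 1" "card (insert y Y) = card L + 1"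
    using fin cL Y(2,3) by simp_all
  have tr': "triple ?A ?B ?R1 ?R2 Q"
    by (rule triple_del[OF tr]) (use c L(1) Y(1) cc Q(3) in auto)
  have le: "card (insert c L) \<le> card A" by (rule card_mono) (use t(5) c L in auto)
  have cA: "card ?A + card L + 1 = card A"
    using card_Diff_subset[of "insert c L" A] fin c L(1) cc le by simp
  have "\<not> packs_on ?A ?B ?R1 ?R2 Q"
    using star_removal[OF tr c L Y _ Q(1,2)] np by blast
  then have "\<not> admissible ?A ?B ?R1 ?R2 Q" using IH[of ?A ?B ?R1 ?R2 Q] cA by linarith
  moreover have "ecard ?R1 + ecard ?R2 + card Q + 3 \<le> 2 * card ?A" using w cA by linarith
  moreover have "dg ?R1 a + 2 \<le> card ?A" if "a \<in> ?A" for a using d1[of a] that cA by auto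
  moreover have "dg ?R2 b + 2 \<le> card ?A" if "b \<in> ?B" for b using d2[of b] that cA by auto
  moreover have "dg Q a < card ?A" if "a \<in> ?A" for a using d3[of a] that cA by auto
  moreover have "dg (Q\<inverse>) b < card ?A" if "b \<in> ?B" for b using d3'[of b] that cA by auto
  ultimately show E: "exceptional_on ?A ?B ?R1 ?R2 \<or> exceptional_on ?B ?A ?R2 ?R1"
    unfolding admissible_def using tr' by blast
  have t': "simple_on ?A ?R1" "simple_on ?B ?R2" "card ?A = card ?B" "finite Q"
    using tripleD[OF tr'] by blast+
  have "ecard ?R1 + ecard ?R2 + 3 = 2 * card ?A"
    using E exc_ecard[OF _ t'(1,2)] exc_ecard[OF _ t'(2,1)] t'(3) by auto
  then show "ecard ?R1 + ecard ?R2 + 2 * card L + 5 = 2 * card A" using cA by linarith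
  then have "card Q = 0" using w by linarith
  then show "Q = {}" using t'(4) by simp
qed

text \<open>The third graph after mapping \<open>x\<close> to \<open>y\<close>.\<close>

definition bip_del :: "'a \<Rightarrow> 'a \<Rightarrow> 'a rel" where
  "bip_del x y = R3 \<inter> (- {x}) \<times> (- {y}) \<union> R1 `` {x} \<times> R2 `` {y}"

lemma dg_bip_del: "dg (bip_del x y) a \<le> dg R3 a + (if (x, a) \<in> R1 then dg R2 y else 0)"
proof -
  have "bip_del x y `` {a} \<subseteq> R3 `` {a} \<union> (if (x, a) \<in> R1 then R2 `` {y} else {})"
    by (auto simp: bip_del_def)
  then have "dg (bip_del x y) a \<le> card (R3 `` {a} \<union> (if (x, a) \<in> R1 then R2 `` {y} else {}))"
    by (rule card_mono[rotated]) (use t(9) s2(3) in \<open>simp add: finite_Image\<close>)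
  also have "\<dots> \<le> dg R3 a + card (if (x, a) \<in> R1 then R2 `` {y} else {})" by (rule card_Un_le)
  finally show ?thesis by (simp split: if_splits)
qed

lemma dg_bip_del': "dg ((bip_del x y)\<inverse>) b \<le> dg (R3\<inverse>) b + (if (y, b) \<in> R2 then dg R1 x else 0)"
proof -
  have "(bip_del x y)\<inverse> `` {b} \<subseteq> R3\<inverse> `` {b} \<union> (if (y, b) \<in> R2 then R1 `` {x} else {})"
    by (auto simp: bip_del_def)
  then have "dg ((bip_del x y)\<inverse>) b \<le> card (R3\<inverse> `` {b} \<union> (if (y, b) \<in> R2 then R1 `` {x} else {}))"
    by (rule card_mono[rotated]) (use t(9) s1(3) in \<open>simp add: finite_Image\<close>)
  also have "\<dots> \<le> dg (R3\<inverse>) b + card (if (y, b) \<in> R2 then R1 `` {x} else {})" by (rule card_Un_le)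
  finally show ?thesis by (simp split: if_splits)
qed

text \<open>\<open>reduce\<close> without leaves. It is mostly applied to reach a contradiction, by
  exhibiting an element of \<open>bip_del x y\<close> or a loss other than two.\<close>

lemma single:
  assumes x: "x \<in> A" "y \<in> B" "(x, y) \<notin> R3"
    and loss: "dg R1 x * dg R2 y + 2 \<le> dg R1 x + dg R2 y + dg R3 x + dg (R3\<inverse>) y"
    and d1: "\<And>a. a \<in> A \<Longrightarrow> a \<noteq> x \<Longrightarrow> dg (del {x} R1) a + 3 \<le> card A"
    and d2: "\<And>b. b \<in> B \<Longrightarrow> b \<noteq> y \<Longrightarrow> dg (del {y} R2) b + 3 \<le> card A"
    and d3: "\<And>a. a \<in> A \<Longrightarrow> a \<noteq> x \<Longrightarrow> dg R3 a + (if (x, a) \<in> R1 then dg R2 y else 0) + 2 \<le> card A"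
    and d3': "\<And>b. b \<in> B \<Longrightarrow> b \<noteq> y \<Longrightarrow> dg (R3\<inverse>) b + (if (y, b) \<in> R2 then dg R1 x else 0) + 2 \<le> card A"
  shows "exceptional_on (A - {x}) (B - {y}) (del {x} R1) (del {y} R2) \<or> exceptional_on (B - {y}) (A - {x}) (del {y} R2) (del {x} R1)"
    and "bip_del x y = {}"
    and "dg R1 x + dg R2 y + dg R3 x + dg (R3\<inverse>) y = 2"
proof -
  have sub: "bip_del x y \<subseteq> (A - insert x {}) \<times> (B - insert y {})"
  proof -
    have "R1 `` {x} \<subseteq> A - {x}" "R2 `` {y} \<subseteq> B - {y}" using s1(4,5) s2(4,5) by blast+
    then show ?thesis using t(3) unfolding bip_del_def by blast
  qed
  have "card (bip_del x y) \<le> card (R3 \<inter> (- {x}) \<times> (- {y})) + dg R1 x * dg R2 y"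
    unfolding bip_del_def by (rule order_trans[OF card_Un_le]) (simp add: card_cartesian_product)
  moreover have c3: "card (R3 \<inter> (- {x}) \<times> (- {y})) + dg R3 x + dg (R3\<inverse>) y = card R3"
    by (rule card_bip_del[OF t(9) x(3)])
  moreover have e: "ecard (del {x} R1) + dg R1 x = ecard R1" "ecard (del {y} R2) + dg R2 y = ecard R2"
    using ecard_del1[OF t(1), of x] ecard_del1[OF t(2), of y] by simp_all
  ultimately have w: "ecard (del (insert x {}) R1) + ecard (del (insert y {}) R2) + card (bip_del x y)
      + 2 * card ({} :: 'a set) + 5 \<le> 2 * card A"
    using weight loss by simp
  have D1: "dg (del (insert x {}) R1) a + card ({} :: 'a set) + 3 \<le> card A" if "a \<in> A" "a \<notin> insert x {}" for a
    using d1[of a] that by simp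
  have D2: "dg (del (insert y {}) R2) b + card ({} :: 'a set) + 3 \<le> card A" if "b \<in> B" "b \<notin> insert y {}" for b
    using d2[of b] that by simp
  have D3: "dg (bip_del x y) a + card ({} :: 'a set) + 2 \<le> card A" if "a \<in> A" "a \<notin> insert x {}" for a
    using d3[of a] dg_bip_del[of x y a] that by simp
  have D3': "dg ((bip_del x y)\<inverse>) b + card ({} :: 'a set) + 2 \<le> card A" if "b \<in> B" "b \<notin> insert y {}" for b
    using d3'[of b] dg_bip_del'[of x y b] that by simp
  have Q: "R3 \<inter> (- insert x {}) \<times> (- insert y {}) \<subseteq> bip_del x y"
    "(R1 `` {x} - {}) \<times> (R2 `` {y} - {}) \<subseteq> bip_del x y"
    by (auto simp: bip_del_def)
  have R: "exceptional_on (A - insert x {}) (B - insert y {}) (del (insert x {}) R1) (del (insert y {}) R2) \<or>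
      exceptional_on (B - insert y {}) (A - insert x {}) (del (insert y {}) R2) (del (insert x {}) R1)"
    by (rule reduce(1)[OF x _ _ _ _ _ _ _ Q sub w D1 D2 D3 D3']) simp_all
  have R2: "bip_del x y = {}"
    by (rule reduce(2)[OF x _ _ _ _ _ _ _ Q sub w D1 D2 D3 D3']) simp_all
  have R3: "ecard (del (insert x {}) R1) + ecard (del (insert y {}) R2) + 2 * card ({} :: 'a set) + 5 = 2 * card A"
    by (rule reduce(3)[OF x _ _ _ _ _ _ _ Q sub w D1 D2 D3 D3']) simp_all
  show "exceptional_on (A - {x}) (B - {y}) (del {x} R1) (del {y} R2) \<or> exceptional_on (B - {y}) (A - {x}) (del {y} R2) (del {x} R1)"
    "bip_del x y = {}" using R R2 by simp_all
  show "dg R1 x + dg R2 y + dg R3 x + dg (R3\<inverse>) y = 2"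
    using R2 R3 c3 e weight loss by (simp add: bip_del_def)
qed

text \<open>A vertex of degree n - 1 in \<open>R3\<close> has a single possible image
  \<open>y\<close>, so the degree of \<open>y\<close> cannot be controlled. The n - 1 edges lost
  leave fewer than n - 1, even when the box of the two neighbourhoods is charged the edges deleted
  at \<open>x\<close> and \<open>y\<close>.\<close>

lemma deg3_le:
  assumes "x \<in> A"
  shows "dg R3 x + 2 \<le> card A"
proof (rule ccontr)
  assume "\<not> ?thesis"
  then have d: "dg R3 x + 1 = card A" using deg3[OF assms] by simp
  obtain y where y: "y \<in> B" "y \<notin> R3 `` {x}"
    using exists_not_in[of "R3 `` {x}" B] d t(4,9) by (auto simp: finite_Image)
  let ?Q = "R3 \<inter> (- {x}) \<times> (- {y})"
  have N: "R1 `` {x} \<subseteq> A - {x}" "R2 `` {y} \<subseteq> B - {y}" using s1(4,5) s2(4,5) by blast+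
  have tr': "triple (A - {x}) (B - {y}) (del {x} R1) (del {y} R2) ?Q"
    by (rule triple_del[OF tr]) (use assms y t(3) in auto)
  have "card ?Q + dg R3 x + dg (R3\<inverse>) y = card R3"
    by (rule card_bip_del) (use t(9) y in auto)
  moreover have "ecard (del {x} R1) + dg R1 x = ecard R1" "ecard (del {y} R2) + dg R2 y = ecard R2"
    using ecard_del1[OF t(1), of x] ecard_del1[OF t(2), of y] by simp_all
  moreover have "card (A - {x}) = card A - 1" using assms t(5) by simp
  ultimately have "dg R1 x + dg R2 y + ecard (del {x} R1) + ecard (del {y} R2) + card ?Q < card (A - {x})"
    using weight d n_ge_4 by linarith
  from packs_light_forbidden_box[OF tr' N this]
  have "packs_on (A - {x}) (B - {y}) (del {x} R1) (del {y} R2) (?Q \<union> R1 `` {x} \<times> R2 `` {y})" .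
  then have "packs_on A B R1 R2 R3"
    by - (rule star_removal[OF tr, of x y "{}" "{}"], use assms y in auto)
  then show False using np by simp
qed

end

section \<open>Vertices of degree n - 2\<close>

locale big_degree = min_counterexample +
  fixes x x0
  assumes x: "x \<in> A" "dg R1 x + 2 = card A"
    and x0: "x0 \<in> A" "x0 \<noteq> x" "(x, x0) \<notin> R1"
begin

lemma nbr_x: "a \<in> A \<Longrightarrow> a \<noteq> x \<Longrightarrow> a \<noteq> x0 \<Longrightarrow> (x, a) \<in> R1"
proof -
  assume a: "a \<in> A" "a \<noteq> x" "a \<noteq> x0"
  have "R1 `` {x} \<subseteq> A - {x, x0}" using s1(4,5) x0(3) by blast
  moreover have "card (A - {x, x0}) = dg R1 x"
    using x x0 t(5) by (simp add: card_Diff_subset)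
  ultimately have "R1 `` {x} = A - {x, x0}" using t(5) by (intro card_subset_eq) auto
  then show "(x, a) \<in> R1" using a by blast
qed

lemma nbr_x0: "(x0, a) \<in> R1 \<Longrightarrow> (x, a) \<in> R1"
proof -
  assume a: "(x0, a) \<in> R1"
  have "a \<noteq> x" using s1(6)[OF a] x0(3) by blast
  then show ?thesis using nbr_x[of a] s1(8,9)[OF a] by blast
qed

lemma ecard1_ge: "dg R1 x0 + card A \<le> ecard R1 + 2"
  using dg2_le_ecard(2)[OF t(1) x0(2)[symmetric] x0(3)] x(2) by simp

text \<open>The edges at \<open>x\<close> and \<open>x0\<close> alone are n - 2 + deg x0, about half
  of the budget 2 n - 3; this bounds all that the other two graphs can have.\<close>

lemma rest_le: "ecard R2 + card R3 + dg R1 x0 + 1 \<le> card A"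
  using ecard1_ge weight by linarith

lemma R2_nonempty: "1 \<le> ecard R2"
proof (rule ccontr)
  assume "\<not> ?thesis"
  then have e: "R2 = {}" using ecard_eq_0[OF t(8)] by simp
  have "triple A B {} {} R3" using tr by (rule triple_edgeless)
  then have "packs_on A B {} {} R3" using rest_le by (intro packs_light) auto
  then show False using np packs_on_edgeless e by blast
qed

text \<open>Otherwise \<open>x\<close> goes to \<open>y\<close> without creating a pair, and losing
  n - 2 edges leaves at most n - 1, within reach of \<open>packs_at_n\<close>.\<close>

lemma isolated_adjacent:
  assumes y: "y \<in> B" "dg R2 y = 0"
  shows "(x, y) \<in> R3"
proof (rule ccontr)
  assume xy: "(x, y) \<notin> R3"
  let ?Q = "R3 \<inter> (- {x}) \<times> (- {y})"
  have tr': "triple (A - {x}) (B - {y}) (del {x} R1) (del {y} R2) ?Q"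
    by (rule triple_del[OF tr]) (use x y t(3) in auto)
  have cA: "card (A - {x}) = card A - 1" using x t(5) by simp
  have Q: "card ?Q + 2 \<le> card A" "finite ?Q"
  proof -
    have "card ?Q \<le> card R3" using t(9) by (intro card_mono) auto
    then show "card ?Q + 2 \<le> card A" using rest_le R2_nonempty by linarith
    show "finite ?Q" using t(9) by simp
  qed
  have Q': "dg ?Q a < card (A - {x})" "dg (?Q\<inverse>) b < card (A - {x})" for a b
    using converse_dg_le(1)[OF Q(2), of a] converse_dg_le(2)[OF Q(2), of b] Q(1) cA by linarith+
  have "card ?Q \<le> card R3" using t(9) by (intro card_mono) auto
  then have "ecard (del {x} R1) + ecard (del {y} R2) + card ?Q \<le> card (A - {x})"
    using ecard_del1[OF t(1), of x] ecard_del1[OF t(2), of y] weight x(2) cA by linarith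
  then have "packs_on (A - {x}) (B - {y}) (del {x} R1) (del {y} R2) ?Q"
    by (rule packs_at_n[OF tr' _ Q']) (use cA n_ge_4 in auto)
  moreover have "R2 `` {y} = {}" using y(2) dg_0[OF t(8)] by blast
  ultimately have "packs_on A B R1 R2 R3"
    by - (rule star_removal[OF tr, of x y "{}" "{}"], use x y xy in auto)
  then show False using np by simp
qed

lemma second_big: "a \<in> A \<Longrightarrow> a \<noteq> x \<Longrightarrow> dg R1 a + 2 = card A \<Longrightarrow> ecard R2 + card R3 \<le> 2"
  using dg2_le_ecard(1)[OF t(1), of x a] x(2) weight by auto

text \<open>An isolated \<open>y\<close> is an \<open>R3\<close>-neighbour of \<open>x\<close> and a
  cheap target for the neighbours of \<open>x\<close>. Mapping them there forces \<open>R1\<close>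
  to be a star with \<open>x0\<close> isolated, which no exceptional remainder allows.\<close>

lemma no_isolated:
  assumes y: "y \<in> B"
  shows "1 \<le> dg R2 y"
proof (rule ccontr)
  assume "\<not> ?thesis"
  then have y0: "dg R2 y = 0" by simp
  have xy: "(x, y) \<in> R3" by (rule isolated_adjacent[OF y y0])
  then have c3: "1 \<le> card R3" using t(9) card_gt_0_iff[of R3] by fastforce
  have N2: "R2 `` {y} = {}" using y0 dg_0[OF t(8)] by blast
  \<comment> \<open>Otherwise all of \<open>R2\<close> sits at \<open>z\<close>, \<open>R3\<close>
    is the single edge \<open>xy\<close>, and sending the then isolated \<open>x0\<close> to
    \<open>z\<close> removes \<open>R2\<close> altogether.\<close>
  have small: "dg R2 z + 3 \<le> card A" if z: "z \<in> B" for z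
  proof (rule ccontr)
    assume "\<not> ?thesis"
    then have dz: "dg R2 z + 2 = card A" using deg2[OF z] by simp
    then have e2: "ecard R2 + 2 = card A" "card R3 = 1" "dg R1 x0 = 0"
      using dg_le_ecard[OF t(2), of z] rest_le c3 by linarith+
    have "R3 = {(x, y)}" using e2(2) xy by (auto simp: card_1_singleton_iff)
    then have x0z: "(x0, z) \<notin> R3" using x0 by simp
    have "ecard (del {z} R2) = 0" using ecard_del1[OF t(2), of z] dz e2 by linarith
    then have e: "del {z} R2 = {}" using ecard_eq_0[of "del {z} R2"] t(8) by (simp add: del_def)
    let ?Q = "R3 \<inter> (- {x0}) \<times> (- {z})"
    have tr': "triple (A - {x0}) (B - {z}) (del {x0} R1) (del {z} R2) ?Q"
      by (rule triple_del[OF tr]) (use x0 z t(3) in auto)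
    then have "triple (A - {x0}) (B - {z}) {} {} ?Q" by (rule triple_edgeless)
    moreover have "card ?Q \<le> card R3" using t(9) by (intro card_mono) auto
    ultimately have "packs_on (A - {x0}) (B - {z}) {} {} ?Q"
      using e2(2) n_ge_4 x0 t(5) by (intro packs_light) auto
    then have "packs_on (A - {x0}) (B - {z}) (del {x0} R1) (del {z} R2) ?Q"
      using packs_on_edgeless e by metis
    moreover have "R1 `` {x0} = {}" using e2(3) dg_0[OF t(7)] by blast
    ultimately have "packs_on A B R1 R2 R3"
      by - (rule star_removal[OF tr, of x0 z "{}" "{}"], use x0 z x0z in auto)
    then show False using np by simp
  qed
  \<comment> \<open>If \<open>R2\<close> is a single edge, at least n - 2 vertices of
    \<open>B\<close> are isolated, and all of them are \<open>R3\<close>-neighbours of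
    \<open>x\<close>.\<close>
  have not_two: "\<not> ecard R2 + card R3 \<le> 2"
  proof
    assume "ecard R2 + card R3 \<le> 2"
    then have e: "ecard R2 = 1" "card R3 = 1" using R2_nonempty c3 by linarith+
    let ?I = "{b \<in> B. dg R2 b = 0}"
    have IB: "?I \<subseteq> B" "card ?I \<le> card B" using t(6) card_mono[of B ?I] by auto
    have "(\<Sum>v\<in>?I. dg R2 v) + 1 * (card B - card ?I) \<le> 2 * ecard R2"
      by (rule degree_sum_ge[OF t(2) IB(1)]) auto
    then have "2 \<le> card ?I" using e n_ge_4 t(4) IB(2) by simp
    also have "?I \<subseteq> R3 `` {x}" using isolated_adjacent by auto
    then have "card ?I \<le> dg R3 x" by (rule card_mono[rotated]) (use t(9) in \<open>simp add: finite_Image\<close>)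
    also have "\<dots> \<le> card R3" by (rule converse_dg_le(1)[OF t(9)])
    finally show False using e by simp
  qed
  \<comment> \<open>The edge \<open>vx\<close> of \<open>R1\<close> and the edge \<open>xy\<close>
    of \<open>R3\<close> already make up the loss of two, so equality allows no further edge at
    \<open>v\<close> or \<open>y\<close>.\<close>
  have exc_v: "dg R1 v = 1 \<and> dg (R3\<inverse>) y = 1 \<and> (exceptional_on (A - {v}) (B - {y}) (del {v} R1) (del {y} R2) \<or>
     exceptional_on (B - {y}) (A - {v}) (del {y} R2) (del {v} R1))" if v: "(x, v) \<in> R1" "(v, y) \<notin> R3" for v
  proof -
    have vA: "v \<in> A" "v \<noteq> x" "(v, x) \<in> R1" using s1(6,8,9)[OF v(1)] by auto
    have dv: "1 \<le> dg R1 v" by (rule dg_ge_1[OF t(7) vA(3)])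
    have dy: "1 \<le> dg (R3\<inverse>) y" by (rule dg_ge_1'[OF t(9) xy])
    have 1: "dg (del {v} R1) a + 3 \<le> card A" if a: "a \<in> A" "a \<noteq> v" for a
    proof (cases "a = x")
      case True
      then show ?thesis using dg_del_less[OF t(7) v(1), of "{v}"] x(2) by simp
    next
      case False
      then have "dg R1 a + 2 \<noteq> card A" using second_big[OF a(1)] not_two by blast
      then show ?thesis using deg1[OF a(1)] dg_del_le[OF t(7), of "{v}" a] by linarith
    qed
    have 2: "dg (del {y} R2) b + 3 \<le> card A" if "b \<in> B" for b
      using small[OF that] dg_del_le[OF t(8), of "{y}" b] by linarith
    have c: "card R3 + 2 \<le> card A" using rest_le R2_nonempty by linarith
    have 3: "dg R3 a + (if (v, a) \<in> R1 then dg R2 y else 0) + 2 \<le> card A" for a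
      using converse_dg_le(1)[OF t(9), of a] c y0 by simp
    have 4: "dg (R3\<inverse>) b + (if (y, b) \<in> R2 then dg R1 v else 0) + 2 \<le> card A" for b
      using converse_dg_le(2)[OF t(9), of b] c N2 by auto
    have loss: "dg R1 v * dg R2 y + 2 \<le> dg R1 v + dg R2 y + dg R3 v + dg (R3\<inverse>) y"
      using dv dy y0 by simp
    from single[OF vA(1) y v(2) loss 1 2 3 4] dv dy show ?thesis by auto
  qed
  have fin: "finite (R3\<inverse> `` {y} - {x})" using t(9) by (simp add: finite_Image)
  have "card (R3\<inverse> `` {y} - {x}) + 1 = dg (R3\<inverse>) y"
    using xy t(9) card_Suc_Diff1[of "R3\<inverse> `` {y}" x] by (simp add: finite_Image)
  also have "\<dots> \<le> card R3" by (rule converse_dg_le(2)[OF t(9)])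
  finally have "card (R3\<inverse> `` {y} - {x}) < dg R1 x" using rest_le R2_nonempty x(2) by linarith
  then obtain v where v: "(x, v) \<in> R1" "v \<notin> R3\<inverse> `` {y} - {x}"
    using exists_not_in[OF fin, of "R1 `` {x}"] by auto
  have vx: "v \<noteq> x" using s1(9)[OF v(1)] by auto
  then have "dg (R3\<inverse>) y = 1" using exc_v[OF v(1)] v(2) by auto
  then have N3: "R3\<inverse> `` {y} = {x}" using xy by (intro dg_1) auto
  \<comment> \<open>\<open>x\<close> is the only \<open>R3\<close>-neighbour of \<open>y\<close>, so
    \<open>exc_v\<close> applies to every neighbour of \<open>x\<close>: \<open>R1\<close> is a
    star.\<close>
  have dg1: "dg R1 u = 1" if "(x, u) \<in> R1" for u
  proof -
    have "u \<noteq> x" using s1(9)[OF that] by auto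
    then have "u \<notin> R3\<inverse> `` {y}" using N3 by simp
    then have "(u, y) \<notin> R3" by simp
    then show ?thesis using exc_v[OF that] by blast
  qed
  have N1: "R1 `` {u} = {x}" if "(x, u) \<in> R1" for u
    using dg_1[OF dg1[OF that] s1(6)[OF that]] .
  have dx0: "R1 `` {x0} = {}"
  proof (rule ccontr)
    assume "R1 `` {x0} \<noteq> {}"
    then obtain a where a: "(x0, a) \<in> R1" by auto
    then have "x0 \<in> R1 `` {a}" using s1(6)[OF a] by simp
    then show False using N1[OF nbr_x0[OF a]] x0(2) by simp
  qed
  have vy: "(v, y) \<notin> R3" using v(2) vx by auto
  have x0v: "x0 \<noteq> v" using v(1) x0(3) by blast
  from exc_v[OF v(1) vy] show False
  proof (elim conjE disjE)
    assume E: "exceptional_on (A - {v}) (B - {y}) (del {v} R1) (del {y} R2)"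
    have "v \<in> A" using s1(8)[OF v(1)] .
    then have "card (A - {v}) = card (B - {y})" using y t(4,5,6) by simp
    then obtain C a where C: "3 \<le> card C" "del {v} R1 = clique C"
      using exc_left[OF E] t(5,6) by (metis finite_Diff)
    have "card {x, x0, v} < card A" using n_ge_4 by (intro le_less_trans[OF card_insert_le_m1[of 3]]) (auto simp: card_insert_if)
    then obtain u where u: "u \<in> A" "u \<notin> {x, x0, v}" using exists_not_in[of "{x, x0, v}" A] by auto
    then have xu: "(x, u) \<in> clique C" unfolding C(2)[symmetric] using nbr_x[of u] vx by auto
    have "card {x, u} < card C" using C(1) by (intro le_less_trans[OF card_insert_le_m1[of 2]]) auto
    then obtain q where q: "q \<in> C" "q \<notin> {x, u}" using exists_not_in[of "{x, u}" C] by auto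
    have "(u, q) \<in> clique C" using xu q by auto
    then have "(u, q) \<in> R1" unfolding C(2)[symmetric] by simp
    moreover have "(x, u) \<in> R1" using xu unfolding C(2)[symmetric] by simp
    ultimately show False using N1[of u] q by auto
  next
    assume E: "exceptional_on (B - {y}) (A - {v}) (del {y} R2) (del {v} R1)"
    have "1 \<le> dg (del {v} R1) x0" using exc_right_dg(1)[OF E, of x0] x0 x0v by simp
    then show False using dg_del_le[OF t(7), of "{v}" x0] dx0 by simp
  qed
qed

lemma card_le_ecard2: "card A \<le> 2 * ecard R2"
  using degree_sum_ge0[OF t(2), of 1] no_isolated t(4) by simp

text \<open>An edge of \<open>R3\<close> at \<open>v\<close> or \<open>y\<close> would complete the
  loss of two. But the neighbour \<open>x\<close> of \<open>v\<close> and the neighbour of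
  \<open>y\<close> form a new pair, while the remainder may not contain any.\<close>

lemma leaf_untouched:
  assumes v: "(x, v) \<in> R1" and y: "y \<in> B" "dg R2 y = 1" "(v, y) \<notin> R3"
  shows "dg R3 v = 0 \<and> dg (R3\<inverse>) y = 0"
proof (rule ccontr)
  assume pos: "\<not> ?thesis"
  have vA: "v \<in> A" "v \<noteq> x" "(v, x) \<in> R1" using s1(6,8,9)[OF v] by auto
  have c3: "1 \<le> card R3"
    using pos converse_dg_le(1)[OF t(9), of v] converse_dg_le(2)[OF t(9), of y] by linarith
  obtain y' where N2: "R2 `` {y} = {y'}" using y(2) by (rule card_1_singletonE)
  have e2: "2 \<le> ecard R2" using card_le_ecard2 n_ge_4 by linarith
  have 1: "dg (del {v} R1) a + 3 \<le> card A" if a: "a \<in> A" "a \<noteq> v" for a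
  proof (cases "a = x")
    case True
    then show ?thesis using dg_del_less[OF t(7) v, of "{v}"] x(2) by simp
  next
    case False
    then have "dg R1 a + 2 \<noteq> card A" using second_big[OF a(1)] c3 e2 by linarith
    then show ?thesis using deg1[OF a(1)] dg_del_le[OF t(7), of "{v}" a] by linarith
  qed
  have 2: "dg (del {y} R2) b + 3 \<le> card A" if b: "b \<in> B" for b
  proof -
    obtain b0 where b0: "b0 \<in> B" "b0 \<noteq> b" "(b, b0) \<notin> R2"
      using exists_nonneighbour[OF t(2) b] deg2[OF b] t(4) by auto
    have "dg R2 b + dg R2 b0 \<le> ecard R2" using dg2_le_ecard(2)[OF t(2) b0(2)[symmetric] b0(3)] .
    then have "dg R2 b + 3 \<le> card A" using no_isolated[OF b0(1)] c3 rest_le by linarith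
    then show ?thesis using dg_del_le[OF t(8), of "{y}" b] by linarith
  qed
  have c: "card R3 + 3 \<le> card A" using rest_le e2 by linarith
  have 3: "dg R3 a + (if (v, a) \<in> R1 then dg R2 y else 0) + 2 \<le> card A" for a
    using converse_dg_le(1)[OF t(9), of a] c y(2) by simp
  have "dg R1 x + dg R1 v \<le> ecard R1 + 1" by (rule dg2_le_ecard(1)[OF t(1) vA(2)[symmetric]])
  then have "card R3 + dg R1 v + 2 \<le> card A" using x(2) weight e2 by linarith
  then have 4: "dg (R3\<inverse>) b + (if (y, b) \<in> R2 then dg R1 v else 0) + 2 \<le> card A" for b
    using converse_dg_le(2)[OF t(9), of b] by simp
  have loss: "dg R1 v * dg R2 y + 2 \<le> dg R1 v + dg R2 y + dg R3 v + dg (R3\<inverse>) y"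
    using pos y(2) by (auto simp: Suc_le_eq)
  have "bip_del v y = {}" by (rule single(2)[OF vA(1) y(1,3) loss 1 2 3 4])
  moreover have "(x, y') \<in> bip_del v y" using vA(3) N2 by (auto simp: bip_del_def)
  ultimately show False by blast
qed

text \<open>The leaves of \<open>R2\<close> outnumber the \<open>R3\<close>-neighbours of any
  \<open>u\<close> adjacent to \<open>x\<close>, so one of them is a legal image of \<open>u\<close>
  and \<open>leaf_untouched\<close> clears \<open>u\<close>.\<close>

lemma R3_touches:
  assumes vz: "(v, z) \<in> R3"
  shows "v = x \<or> v = x0" "dg R2 z \<noteq> 1"
proof -
  have *: "u = x \<or> u = x0" if uz: "(u, z) \<in> R3" for u z
  proof (rule ccontr)
    assume "\<not> ?thesis"
    moreover have "u \<in> A" using uz t(3) by blast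
    ultimately have u: "(x, u) \<in> R1" using nbr_x by blast
    have "card (R3 `` {u}) + 2 * ecard R2 < 2 * card B"
      using converse_dg_le(1)[OF t(9), of u] rest_le t(4) R2_nonempty by linarith
    moreover have "finite (R3 `` {u})" using t(9) by (simp add: finite_Image)
    ultimately obtain l where l: "l \<in> B" "dg R2 l = 1" "l \<notin> R3 `` {u}"
      using exists_leaf_outside[OF t(2) no_isolated] by blast
    then have "dg R3 u = 0" using leaf_untouched[OF u l(1,2)] by auto
    then show False using dg_ge_1[OF t(9) uz] by simp
  qed
  show "v = x \<or> v = x0" by (rule *[OF vz])
  show "dg R2 z \<noteq> 1"
  proof
    assume z: "dg R2 z = 1"
    have "dg R1 x \<noteq> 0" using x(2) n_ge_4 by linarith
    then obtain u where u: "(x, u) \<in> R1" using dg_0[OF t(7), of x] by auto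
    then have "(u, z) \<notin> R3" using *[of u z] s1(9)[OF u] x0(3) by blast
    moreover have "z \<in> B" using vz t(3) by blast
    ultimately have "dg (R3\<inverse>) z = 0" using leaf_untouched[OF u _ z] by blast
    then show False using dg_ge_1'[OF t(9) vz] by simp
  qed
qed

text \<open>\<open>x0\<close> is matched with the centre of an end star of \<open>R2\<close>, and
  \<open>x\<close> with one of its leaves. This removes n - 2 edges of \<open>R1\<close> at
  \<open>x\<close>, and also all of \<open>R3\<close>, whose edges start at \<open>x\<close> or
  \<open>x0\<close>; so few edges remain that the results on light triples apply.\<close>

lemma contradiction: False
proof -
  let ?F = "R3 `` {x0}"
  have wF: "card ?F + ecard R2 < card B"
    using converse_dg_le(1)[OF t(9), of x0] rest_le t(4) by linarith
  have F: "?F \<subseteq> B" "\<And>v. v \<in> ?F \<Longrightarrow> dg R2 v \<noteq> 1" using t(3) R3_touches(2) by auto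
  obtain c where c: "c \<in> B" "c \<notin> ?F" "{l \<in> R2 `` {c}. dg R2 l = 1} \<noteq> {}"
    "card (R2 `` {c} - {l \<in> R2 `` {c}. dg R2 l = 1}) \<le> 1"
    "\<And>u v. (u, v) \<in> R2 \<Longrightarrow> dg R2 u = 1 \<Longrightarrow> dg R2 v = 1 \<Longrightarrow> dg R2 c = 1"
    by (rule exists_end_star[OF t(2) _ F(1) _ wF], erule no_isolated, erule F(2), rule that)
  define L where "L = {l \<in> R2 `` {c}. dg R2 l = 1}"
  define s where "s = dg R1 x0"
  have L: "L \<subseteq> R2 `` {c}" "L \<noteq> {}" "card (R2 `` {c} - L) \<le> 1"
    unfolding L_def by (blast, fact c(3), fact c(4))
  have fL: "finite L" using L(1) s2(3) by (rule finite_subset)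
  have LN: "R2 `` {l} = {c}" if "l \<in> L" for l
    using that dg_1[of R2 l c] s2(6)[of c l] by (auto simp: L_def)
  have LB: "L \<subseteq> B" using L(1) s2(4) by blast
  have k1: "1 \<le> card L" using L(2) fL by (simp add: Suc_le_eq card_gt_0_iff)
  have dc: "dg R2 c = card L + card (R2 `` {c} - L)"
    using card_Diff_subset[OF fL L(1)] card_mono[OF s2(3) L(1)] by simp
  have "dg R2 c + 1 * (card B - 1) \<le> 2 * ecard R2"
    by (rule degree_sum_ge1[OF t(2) c(1)]) (rule no_isolated)
  then have k2: "dg R2 c + 2 * s + 1 \<le> card A" using rest_le t(4) unfolding s_def by linarith
  have N0: "R1 `` {x0} \<subseteq> R1 `` {x}" using nbr_x0 by auto
  have "card (R1 `` {x} - R1 `` {x0}) + s = dg R1 x"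
    unfolding s_def using card_Diff_subset[OF s1(3) N0] card_mono[OF s1(3) N0] by simp
  \<comment> \<open>\<open>x\<close> takes one leaf; the others need places adjacent to
    \<open>x\<close> but not to \<open>x0\<close>, and \<open>k2\<close> guarantees enough of
    them.\<close>
  then have "card L - 1 \<le> card (R1 `` {x} - R1 `` {x0})" using k2 dc x(2) by linarith
  then obtain X where X: "X \<subseteq> R1 `` {x} - R1 `` {x0}" "card X = card L - 1"
    by (rule obtain_subset_with_card_n)
  have fX: "finite X" using X(1) s1(3) by (meson finite_Diff finite_subset)
  define Y where "Y = insert x X"
  have xX: "x \<notin> X" using X(1) s1(5) by blast
  have Y: "Y \<subseteq> A" "card Y = card L" "x0 \<notin> Y" "Y \<inter> R1 `` {x0} = {}"
  proof -
    show "Y \<subseteq> A" using X(1) s1(4) x(1) unfolding Y_def by blast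
    show "card Y = card L" using xX fX X(2) k1 by (simp add: Y_def)
    show "x0 \<notin> Y" using X(1) x0(2,3) unfolding Y_def by blast
    show "Y \<inter> R1 `` {x0} = {}" using X(1) x0(3) s1(6)[of x0 x] unfolding Y_def by blast
  qed
  have tr': "triple B A R2 R1 (R3\<inverse>)" by (rule triple_swap[OF tr])
  have R3L: "R3\<inverse> \<inter> L \<times> Y = {}" using R3_touches(2) by (auto simp: L_def)
  let ?Q = "(R2 `` {c} - L) \<times> (R1 `` {x0} - Y)"
  have R3e: "R3\<inverse> \<inter> (- insert c L) \<times> (- insert x0 Y) \<subseteq> ?Q"
    using R3_touches(1) by (auto simp: Y_def)
  have cL: "c \<notin> L" using L(1) s2(5) by blast
  let ?A = "A - insert x0 Y" and ?B = "B - insert c L"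
  let ?R1 = "del (insert x0 Y) R1" and ?R2 = "del (insert c L) R2"
  have fY: "finite Y" using fX by (simp add: Y_def)
  have cc: "card (insert c L) = card L + 1" "card (insert x0 Y) = card L + 1"
    using cL fL fY Y(2,3) by simp_all
  have trQ: "triple ?B ?A ?R2 ?R1 ?Q"
  proof (rule triple_del[OF tr'])
    have "R1 `` {x0} - Y \<subseteq> A - insert x0 Y" "R2 `` {c} - L \<subseteq> B - insert c L"
      using s1(4,5) s2(4,5) by blast+
    then show "?Q \<subseteq> ?B \<times> ?A" by blast
  qed (use c(1) LB x0(1) Y(1) cc in auto)
  have npQ: "\<not> packs_on ?B ?A ?R2 ?R1 ?Q"
    using star_removal[OF tr' c(1) x0(1) _ LB LN Y R3L _ R3e] c(2) np packs_on_swap_iff[OF tr] by auto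
  have cB: "card ?B + card L + 1 = card A"
    using card_Diff_subset[of "insert c L" B] fL c(1) LB cc card_mono[of B "insert c L"] t(4,6) by auto
  have E1: "ecard ?R1 + dg R1 x + s \<le> ecard R1"
    using ecard_del2[OF t(1) x0(2)[symmetric] x0(3)] ecard_del_mono[OF t(7), of "{x, x0}" "insert x0 Y"]
    by (auto simp: Y_def s_def)
  have E2: "ecard ?R2 + dg R2 c \<le> ecard R2"
    using ecard_del1[OF t(2), of c] ecard_del_mono[OF t(8), of "{c}" "insert c L"] by auto
  have cQ: "card ?Q \<le> card (R2 `` {c} - L) * s"
    unfolding card_cartesian_product s_def
    by (intro mult_le_mono2 card_mono) (use s1(3) in auto)
  show False
  proof (cases "R2 `` {c} - L = {}")
    case False
    then have "card (R2 `` {c} - L) \<noteq> 0" using s2(3) by simp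
    then have 1: "card (R2 `` {c} - L) = 1" using L(3) by linarith
    \<comment> \<open>The non-leaf neighbour of \<open>c\<close> causes at most \<open>s\<close> new
      pairs, as many as the edges lost at \<open>x0\<close>, while its own edge to \<open>c\<close>
      is an additional loss.\<close>
    then have "ecard ?R2 + ecard ?R1 + card ?Q < card ?B"
      using E1 E2 cQ cB dc weight x(2) by simp
    then show False using packs_light[OF trQ] npQ by blast
  next
    case True
    then have Q0: "?Q = {}" by auto
    have dcL: "R2 `` {c} = L" "dg R2 c = card L" using True L(1) dc by auto
    have w: "ecard ?R2 + ecard ?R1 + card ?Q \<le> card ?B"
      using E1 E2 Q0 cB dcL weight x(2) by simp
    have pos: "0 < card ?B" if "b \<in> ?B" for b
      using that t(6) by (auto simp: card_gt_0_iff)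
    have pos': "0 < card ?B" if "b \<in> ?A" for b
    proof -
      have "card ?A = card ?B" using tripleD(4)[OF trQ] by simp
      then show ?thesis using that t(5) card_gt_0_iff[of ?A] by auto
    qed
    \<comment> \<open>Without a non-leaf neighbour the count is one worse, so the excluded case of
      \<open>packs_at_n\<close> survives. It is traced back to the exceptional pair on four
      vertices.\<close>
    have ex: "card ?B = 2 \<and> ecard ?R2 = 1 \<and> ecard ?R1 = 1"
    proof (rule ccontr)
      assume "\<not> ?thesis"
      then have "packs_on ?B ?A ?R2 ?R1 ?Q"
        by (intro packs_at_n[OF trQ w]) (use pos pos' in \<open>auto simp: Q0\<close>)
      then show False using npQ by blast
    qed
    then have eqs: "s = 0" "card R3 = 0" "ecard R1 + 1 = card A" "ecard R2 + 2 = card A"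
      using E1 E2 x(2) weight cB dcL by linarith+
    have "?R2 \<noteq> {}" using ex by auto
    then obtain p q where "(p, q) \<in> ?R2" by (metis all_not_in_conv prod.exhaust)
    then have pq: "(p, q) \<in> R2" "p \<notin> insert c L" "q \<notin> insert c L" unfolding in_del by blast+
    have pqB: "p \<in> B" "q \<in> B" "p \<noteq> q" "(q, p) \<in> R2" using s2(6-9)[OF pq(1)] by auto
    have "card {p, q} = card ?B" "{p, q} \<subseteq> ?B" using ex pqB pq by auto
    then have Bpq: "?B = {p, q}" using t(6) card_subset_eq[of ?B "{p, q}"] by auto
    have N: "R2 `` {u} \<subseteq> {p, q} - {u}" if u: "u \<in> {p, q}" for u
    proof
      fix w assume "w \<in> R2 `` {u}"
      then have uw: "(u, w) \<in> R2" by simp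
      then have wu: "(w, u) \<in> R2" "w \<in> B" "w \<noteq> u" using s2(6,8,9)[OF uw] by auto
      have "w \<notin> L" using LN[of w] wu(1) u pq(2,3) by auto
      moreover have "w \<noteq> c" using wu(1) dcL(1) u pq(2,3) by auto
      ultimately show "w \<in> {p, q} - {u}" using Bpq wu by blast
    qed
    have "R2 `` {p} = {q}" "R2 `` {q} = {p}" using N[of p] N[of q] pq(1) pqB by auto
    \<comment> \<open>The edge \<open>pq\<close> is a whole component, and in its presence an end
      star is itself a single edge.\<close>
    then have "dg R2 c = 1" using c(5)[OF pq(1)] by simp
    then have k: "card L = 1" using dcL by simp
    then obtain l where l: "L = {l}" by (rule card_1_singletonE)
    have n4: "card A = 4" using cB ex k by simp
    have Beq: "B = {c, l, p, q}" using Bpq c(1) LB l by auto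
    have d: "distinct [c, l, p, q]" using pq cL pqB l by auto
    have cl: "(c, l) \<in> R2" "(l, c) \<in> R2" using L(1) l s2(6)[of c l] by auto
    have "card R2 = 4" using card_ecard[OF t(2)] eqs n4 by simp
    moreover have sub: "{(c, l), (l, c), (p, q), (q, p)} \<subseteq> R2" using cl pq pqB by auto
    moreover have "card {(c, l), (l, c), (p, q), (q, p)} = 4" using d by auto
    ultimately have R2eq: "R2 = {(c, l), (l, c), (p, q), (q, p)}"
      using card_subset_eq[OF t(8) sub] by simp
    have "R1 \<subseteq> clique (A - {x0})"
    proof -
      have "R1 `` {x0} = {}" using eqs(1) dg_0[OF t(7)] unfolding s_def by blast
      then have "u \<noteq> x0 \<and> v \<noteq> x0" if "(u, v) \<in> R1" for u v using that s1(6)[OF that] by blast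
      moreover have "u \<in> A \<and> v \<in> A \<and> u \<noteq> v" if "(u, v) \<in> R1" for u v using s1(7-9)[OF that] by blast
      ultimately show ?thesis by (intro subrelI) simp
    qed
    moreover have "card R1 = card (clique (A - {x0}))"
      using card_ecard[OF t(1)] eqs n4 x0(1) t(5) by (simp add: card_clique)
    moreover have "finite (clique (A - {x0}))" using t(5) by (simp add: clique_def)
    ultimately have R1eq: "R1 = clique (A - {x0})" using card_subset_eq by blast
    have "exceptional_on A B R1 R2"
      unfolding exceptional_on_def
    proof (intro exI conjI)
      show "R1 = clique (A - {x0})" by fact
      show "partition_on B {{c, l}, {p, q}}"
        unfolding Beq using d by (auto simp: partition_on_def disjoint_def)
      show "R2 = (\<Union>p\<in>{{c, l}, {p, q}}. clique p)"
        unfolding R2eq using d by (auto simp: clique_def)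
      have "{c, l} \<noteq> {p, q}" using d by auto
      then show "card {{c, l}, {p, q}} + 1 = card (A - {x0})" using n4 x0(1) t(5) by simp
    qed (use n4 x0(1) t(5) d in auto)
    then show False using nexc by blast
  qed
qed

end

lemma (in min_counterexample) deg1_le:
  assumes "x \<in> A"
  shows "dg R1 x + 3 \<le> card A"
proof (rule ccontr)
  assume "\<not> ?thesis"
  then have d: "dg R1 x + 2 = card A" using deg1[OF assms] by simp
  then obtain x0 where "x0 \<in> A" "x0 \<noteq> x" "(x, x0) \<notin> R1"
    using exists_nonneighbour[OF t(1) assms] by auto
  then interpret big_degree A B R1 R2 R3 x x0
    by unfold_locales (use assms d in auto)
  show False by (rule contradiction)
qed

section \<open>Isolated vertices\<close>

context min_counterexample
begin

lemma deg3'_le: "b \<in> B \<Longrightarrow> dg (R3\<inverse>) b + 2 \<le> card A"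
  using min_counterexample.deg3_le[OF swap] t(4) by simp

lemma deg2_le: "b \<in> B \<Longrightarrow> dg R2 b + 3 \<le> card A"
  using min_counterexample.deg1_le[OF swap] t(4) by simp

text \<open>An isolated \<open>x\<close> creates no pairs, so all edges met at \<open>x\<close> and
  \<open>y\<close> are net loss. The degree bounds for the remainder come from the improved bounds
  just proved.\<close>

lemma isolated_single:
  assumes x: "x \<in> A" "dg R1 x = 0" and y: "y \<in> B" "(x, y) \<notin> R3"
    and ge: "2 \<le> dg R3 x + dg R2 y + dg (R3\<inverse>) y"
  shows "exceptional_on (A - {x}) (B - {y}) R1 (del {y} R2) \<or> exceptional_on (B - {y}) (A - {x}) (del {y} R2) R1"
    and "\<And>a b. (a, b) \<in> R3 \<Longrightarrow> a = x \<or> b = y"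
    and "dg R3 x + dg R2 y + dg (R3\<inverse>) y = 2"
proof -
  have N: "R1 `` {x} = {}" using x(2) dg_0[OF t(7)] by blast
  have "u \<noteq> x \<and> v \<noteq> x" if "(u, v) \<in> R1" for u v using N that s1(6)[OF that] by blast
  then have "(u, v) \<in> del {x} R1 \<longleftrightarrow> (u, v) \<in> R1" for u v by auto
  then have del: "del {x} R1 = R1" by (intro equalityI subrelI) blast+
  have loss: "dg R1 x * dg R2 y + 2 \<le> dg R1 x + dg R2 y + dg R3 x + dg (R3\<inverse>) y" using x ge by simp
  have 1: "dg (del {x} R1) a + 3 \<le> card A" if "a \<in> A" "a \<noteq> x" for a
    using deg1_le[OF that(1)] dg_del_le[OF t(7), of "{x}" a] by linarith
  have 2: "dg (del {y} R2) b + 3 \<le> card A" if "b \<in> B" "b \<noteq> y" for b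
    using deg2_le[OF that(1)] dg_del_le[OF t(8), of "{y}" b] by linarith
  have 3: "dg R3 a + (if (x, a) \<in> R1 then dg R2 y else 0) + 2 \<le> card A" if "a \<in> A" "a \<noteq> x" for a
    using deg3_le[OF that(1)] N by auto
  have 4: "dg (R3\<inverse>) b + (if (y, b) \<in> R2 then dg R1 x else 0) + 2 \<le> card A" if "b \<in> B" "b \<noteq> y" for b
    using deg3'_le[OF that(1)] x(2) by simp
  note S = single[OF x(1) y loss 1 2 3 4, unfolded del]
  show "exceptional_on (A - {x}) (B - {y}) R1 (del {y} R2) \<or> exceptional_on (B - {y}) (A - {x}) (del {y} R2) R1" by (rule S(1))
  show "a = x \<or> b = y" if "(a, b) \<in> R3" for a b
  proof (rule ccontr)
    assume "\<not> ?thesis"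
    then have "(a, b) \<in> bip_del x y" using that by (simp add: bip_del_def)
    then show False using S(2) by simp
  qed
  show "dg R3 x + dg R2 y + dg (R3\<inverse>) y = 2" using S(3) x(2) by simp
qed

lemma isolated_single':
  assumes "y \<in> B" "dg R2 y = 0" "x \<in> A" "(x, y) \<notin> R3" "2 \<le> dg (R3\<inverse>) y + dg R1 x + dg R3 x"
  shows "dg (R3\<inverse>) y + dg R1 x + dg R3 x = 2"
  using min_counterexample.isolated_single(3)[OF swap assms(1-3)] assms(4,5) by simp

lemma card_minus1: "x \<in> A \<Longrightarrow> y \<in> B \<Longrightarrow> card (A - {x}) = card (B - {y})"
  using t(4-6) by simp

text \<open>A case rule extracting from each orientation what the arguments below use: a clique with
  an isolated vertex on one side, no isolated vertex on the other.\<close>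

lemma exc_side:
  assumes E: "exceptional_on (A - {x}) (B - {y}) R1 (del {y} R2) \<or> exceptional_on (B - {y}) (A - {x}) (del {y} R2) R1"
    and xy: "x \<in> A" "y \<in> B"
  obtains (left) C a where "exceptional_on (A - {x}) (B - {y}) R1 (del {y} R2)" "C \<subseteq> A - {x}" "3 \<le> card C" "R1 = clique C"
      "a \<in> A" "a \<noteq> x" "dg R1 a = 0" "\<And>b. b \<in> B \<Longrightarrow> b \<noteq> y \<Longrightarrow> 1 \<le> dg (del {y} R2) b"
  | (right) C where "exceptional_on (B - {y}) (A - {x}) (del {y} R2) R1" "C \<subseteq> B - {y}" "3 \<le> card C" "del {y} R2 = clique C"
      "\<And>c. c \<in> C \<Longrightarrow> 2 \<le> dg R2 c" "\<And>a. a \<in> A \<Longrightarrow> a \<noteq> x \<Longrightarrow> 1 \<le> dg R1 a"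
  using E
proof
  assume E: "exceptional_on (A - {x}) (B - {y}) R1 (del {y} R2)"
  obtain C a where "C \<subseteq> A - {x}" "3 \<le> card C" "R1 = clique C" "a \<in> A - {x}" "dg R1 a = 0"
    using exc_left[OF E _ _ card_minus1[OF xy]] t(5,6) by (metis finite_Diff)
  moreover have "\<And>b. b \<in> B \<Longrightarrow> b \<noteq> y \<Longrightarrow> 1 \<le> dg (del {y} R2) b"
    using exc_right_dg(1)[OF E] by blast
  ultimately show ?thesis using left E by blast
next
  assume E: "exceptional_on (B - {y}) (A - {x}) (del {y} R2) R1"
  obtain C where C: "C \<subseteq> B - {y}" "3 \<le> card C" "del {y} R2 = clique C"
    using exc_left[OF E _ _ card_minus1[OF xy, symmetric]] t(5,6) by (metis finite_Diff)
  moreover have "2 \<le> dg R2 c" if "c \<in> C" for c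
    using dg_del_le[OF t(8), of "{y}" c] that C(2,3) by (simp add: dg_clique)
  moreover have "\<And>a. a \<in> A \<Longrightarrow> a \<noteq> x \<Longrightarrow> 1 \<le> dg R1 a"
    using exc_right_dg(1)[OF E] by blast
  ultimately show ?thesis using right E by blast
qed

text \<open>If \<open>x\<close> has several \<open>R3\<close> edges, all its possible images are
  isolated in \<open>R2\<close>; if it has one, every other image touches at most one further edge.
  Either is too sparse for an exceptional remainder.\<close>

lemma isolated_untouched:
  assumes x: "x \<in> A" "dg R1 x = 0"
  shows "dg R3 x = 0"
proof (rule ccontr)
  assume pos: "dg R3 x \<noteq> 0"
  let ?N = "R3 `` {x}"
  have fN: "finite ?N" using t(9) by (simp add: finite_Image)
  note single_x = isolated_single[OF x]
  consider "2 \<le> dg R3 x" | "dg R3 x = 1" using pos by linarith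
  then show False
  proof cases
    case 1
    obtain y where y: "y \<in> B" "y \<notin> ?N" using exists_not_in[OF fN, of B] deg3_le[OF x(1)] t(4) by auto
    have *: "dg R3 x = 2 \<and> dg R2 b = 0" if b: "b \<in> B" "b \<notin> ?N" for b
    proof -
      have "(x, b) \<notin> R3" using b by simp
      from single_x(3)[OF b(1) this] show ?thesis using 1 by linarith
    qed
    have E: "exceptional_on (A - {x}) (B - {y}) R1 (del {y} R2) \<or> exceptional_on (B - {y}) (A - {x}) (del {y} R2) R1"
      using single_x(1)[of y] y 1 by simp
    show False
    proof (rule exc_side[OF E x(1) y(1)])
      assume d: "\<And>b. b \<in> B \<Longrightarrow> b \<noteq> y \<Longrightarrow> 1 \<le> dg (del {y} R2) b"
      have "card (insert y ?N) < card B" using *[OF y] n_ge_4 t(4) y fN by simp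
      then obtain b where "b \<in> B" "b \<notin> insert y ?N" using exists_not_in[of "insert y ?N" B] fN by auto
      then show False using d[of b] *[of b] dg_del_le[OF t(8), of "{y}" b] by simp
    next
      fix C assume C: "C \<subseteq> B - {y}" "3 \<le> card C" "\<And>c. c \<in> C \<Longrightarrow> 2 \<le> dg R2 c"
      then obtain c where "c \<in> C" "c \<notin> ?N" using exists_not_in[OF fN, of C] *[OF y] by auto
      then show False using C(3)[of c] *[of c] C(1) by auto
    qed
  next
    case 2
    then obtain y0 where y0: "?N = {y0}" by (rule card_1_singletonE)
    have nadj: "(x, y) \<notin> R3" if "y \<noteq> y0" for y using y0 that by blast
    have le: "dg R2 y + dg (R3\<inverse>) y \<le> 1" if y: "y \<in> B" "y \<noteq> y0" for y
      using single_x(3)[OF y(1) nadj[OF y(2)]] 2 by linarith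
    \<comment> \<open>Otherwise \<open>R2\<close> is empty and \<open>R3\<close> is a star at
      \<open>y0\<close>, which packs directly.\<close>
    have "\<exists>y\<in>B. y \<noteq> y0 \<and> 1 \<le> dg R2 y + dg (R3\<inverse>) y"
    proof (rule ccontr)
      assume "\<not> ?thesis"
      then have z: "dg R2 y = 0 \<and> dg (R3\<inverse>) y = 0" if "y \<in> B" "y \<noteq> y0" for y using that by force
      have "R2 = {}"
      proof (rule ccontr)
        assume "R2 \<noteq> {}"
        then obtain p q where pq: "(p, q) \<in> R2" by (metis all_not_in_conv prod.exhaust)
        have qp: "(q, p) \<in> R2" by (rule s2(6)[OF pq])
        show False
          using dg_ge_1[OF t(8) pq] dg_ge_1[OF t(8) qp] z[of p] z[of q] s2(7-9)[OF pq] by fastforce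
      qed
      moreover have "card R3 < card A"
      proof -
        have yB: "y0 \<in> B" using y0 t(3) by blast
        have "card R3 = dg (R3\<inverse>) y0 + (\<Sum>v\<in>B - {y0}. dg (R3\<inverse>) v)"
          using sum.remove[OF t(6) yB, of "dg (R3\<inverse>)"] sum_dg_bip(2)[OF t(5,6,3)] by linarith
        also have "(\<Sum>v\<in>B - {y0}. dg (R3\<inverse>) v) = 0" by (rule sum.neutral) (use z in blast)
        finally show ?thesis using deg3'[OF yB] by simp
      qed
      then have "packs_on A B {} {} R3" by (intro packs_light[OF triple_edgeless[OF tr]]) simp
      ultimately show False using np packs_on_edgeless by blast
    qed
    then obtain y where y: "y \<in> B" "y \<noteq> y0" "1 \<le> dg R2 y + dg (R3\<inverse>) y" by blast
    note S = single_x[OF y(1) nadj[OF y(2)]]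
    have ge: "2 \<le> dg R3 x + dg R2 y + dg (R3\<inverse>) y" using 2 y(3) by simp
    show False
    proof (rule exc_side[OF S(1)[OF ge] x(1) y(1)])
      fix C assume C: "C \<subseteq> B - {y}" "3 \<le> card C" "\<And>c. c \<in> C \<Longrightarrow> 2 \<le> dg R2 c"
      then obtain c where "c \<in> C" "c \<notin> {y0}" using exists_not_in[of "{y0}" C] by auto
      then show False using C(3)[of c] le[of c] C(1) by fastforce
    next
      fix C a
      assume C: "C \<subseteq> A - {x}" "3 \<le> card C" "R1 = clique C"
        and a: "a \<in> A" "a \<noteq> x" "dg R1 a = 0"
        and d: "\<And>b. b \<in> B \<Longrightarrow> b \<noteq> y \<Longrightarrow> 1 \<le> dg (del {y} R2) b"
      \<comment> \<open>Another vertex is sent away to exceed the loss of two: the second isolated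
        vertex \<open>a\<close> to \<open>y0\<close>, or a clique vertex \<open>v\<close> to
        \<open>y\<close>.\<close>
      consider "dg R2 y = 1" | "dg R2 y = 0" "dg (R3\<inverse>) y = 1" using le[OF y(1,2)] y(3) by linarith
      then show False
      proof cases
        case 1
        then obtain z where z: "R2 `` {y} = {z}" by (rule card_1_singletonE)
        then have yz: "(y, z) \<in> R2" by blast
        have zB: "z \<in> B" "z \<noteq> y" using s2(8,9)[OF yz] by auto
        have "dg R2 z \<ge> 2" using d[OF zB] dg_del_less[OF t(8) s2(6)[OF yz], of "{y}"] by simp
        then have zy0: "z = y0" using le[OF zB(1)] by fastforce
        have "(a, y0) \<notin> R3" using S(2)[OF ge] a(2) y(2) by blast
        moreover have "1 \<le> dg (R3\<inverse>) y0" using y0 by (intro dg_ge_1'[OF t(9), of x]) blast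
        ultimately show False
          using isolated_single(3)[OF a(1,3), of y0] zB zy0 \<open>dg R2 z \<ge> 2\<close> by simp
      next
        case 2
        have "finite (R3\<inverse> `` {y})" using t(9) by (simp add: finite_Image)
        then obtain v where v: "v \<in> C" "v \<notin> R3\<inverse> `` {y}" using exists_not_in[of "R3\<inverse> `` {y}" C] C(2) 2(2) by auto
        then have "2 \<le> dg R1 v" using C by (simp add: dg_clique)
        then show False using isolated_single'[OF y(1) 2(1), of v] v C(1) 2(2) by auto
      qed
    qed
  qed
qed

lemma isolated_untouched': "y \<in> B \<Longrightarrow> dg R2 y = 0 \<Longrightarrow> dg (R3\<inverse>) y = 0"
  using min_counterexample.isolated_untouched[OF swap] by blast

text \<open>Otherwise the sum is exactly 2 and all of \<open>R3\<close> lies at \<open>y\<close>.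
  The three ways of splitting the 2 are refuted separately; only two edges of \<open>R2\<close> can
  lead back to an exceptional pair.\<close>

lemma isolated_degree_sum_le:
  assumes x: "x \<in> A" "dg R1 x = 0" and y: "y \<in> B"
  shows "dg R2 y + dg (R3\<inverse>) y \<le> 1"
proof (rule ccontr)
  assume "\<not> ?thesis"
  then have ge: "2 \<le> dg R2 y + dg (R3\<inverse>) y" by simp
  have d3: "dg R3 x = 0" by (rule isolated_untouched[OF x])
  then have nx: "(x, b) \<notin> R3" for b using dg_ge_1[OF t(9), of x b] by linarith
  note S = isolated_single[OF x _ nx]
  have e2: "dg R2 y + dg (R3\<inverse>) y = 2" using S(3)[OF y] ge d3 by simp
  have E: "exceptional_on (A - {x}) (B - {y}) R1 (del {y} R2) \<or> exceptional_on (B - {y}) (A - {x}) (del {y} R2) R1"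
    using S(1)[OF y] ge by simp
  have touch: "b = y" if "(a, b) \<in> R3" for a b
    using S(2)[OF y _ that] ge nx that by auto
  consider "dg R2 y = 0" | "dg R2 y = 1" | "dg R2 y = 2" using e2 by linarith
  then show False
  proof cases
    case 1
    then show False using isolated_untouched'[OF y] e2 by simp
  next
    case 2
    \<comment> \<open>Sending \<open>x\<close> to such a \<open>c\<close> would confine
      \<open>R3\<close> to \<open>c\<close>, while \<open>y\<close> has an edge of
      \<open>R3\<close>.\<close>
    have "\<exists>c\<in>B. c \<noteq> y \<and> 2 \<le> dg R2 c"
    proof (rule exc_side[OF E x(1) y])
      assume d: "\<And>b. b \<in> B \<Longrightarrow> b \<noteq> y \<Longrightarrow> 1 \<le> dg (del {y} R2) b"
      obtain z where z: "R2 `` {y} = {z}" using 2 by (rule card_1_singletonE)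
      then have yz: "(y, z) \<in> R2" by blast
      have zB: "z \<in> B" "z \<noteq> y" using s2(8,9)[OF yz] by auto
      have "dg R2 z \<ge> 2" using d[OF zB] dg_del_less[OF t(8) s2(6)[OF yz], of "{y}"] by simp
      then show ?thesis using zB by blast
    next
      fix C assume C: "C \<subseteq> B - {y}" "3 \<le> card C" "\<And>c. c \<in> C \<Longrightarrow> 2 \<le> dg R2 c"
      then obtain c where "c \<in> C" by fastforce
      then show ?thesis using C(1,3) by blast
    qed
    then obtain c where c: "c \<in> B" "c \<noteq> y" "2 \<le> dg R2 c" by blast
    have "R3\<inverse> `` {y} \<noteq> {}" using 2 e2 by auto
    then obtain v where v: "(v, y) \<in> R3" by blast
    then show False using S(2)[OF c(1) _ v] c nx by auto
  next
    case 3
    have R3e: "R3 = {}"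
    proof (rule ccontr)
      assume "R3 \<noteq> {}"
      then obtain a b where ab: "(a, b) \<in> R3" by (metis all_not_in_conv prod.exhaust)
      then have "(a, y) \<in> R3" using touch by blast
      then show False using dg_ge_1'[OF t(9)] 3 e2 by fastforce
    qed
    have le2: "dg R2 z \<le> 2" if "z \<in> B" for z using S(3)[OF that] R3e by fastforce
    have Ez: "exceptional_on (A - {x}) (B - {z}) R1 (del {z} R2) \<or> exceptional_on (B - {z}) (A - {x}) (del {z} R2) R1"
      if "z \<in> B" "2 \<le> dg R2 z" for z using S(1)[OF that(1)] that(2) by simp
    show False
    proof (rule exc_side[OF E x(1) y])
      fix C assume C: "C \<subseteq> B - {y}" "3 \<le> card C" "del {y} R2 = clique C" "\<And>c. c \<in> C \<Longrightarrow> 2 \<le> dg R2 c"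
        and d: "\<And>a. a \<in> A \<Longrightarrow> a \<noteq> x \<Longrightarrow> 1 \<le> dg R1 a"
      obtain z where z: "z \<in> C" using C(2) by fastforce
      then have zB: "z \<in> B" using C(1) by blast
      show False
      proof (rule exc_side[OF Ez[OF zB C(4)[OF z]] x(1) zB])
        fix a assume "a \<in> A" "a \<noteq> x" "dg R1 a = 0"
        then show False using d[of a] by simp
      next
        assume E': "exceptional_on (B - {z}) (A - {x}) (del {z} R2) R1"
        \<comment> \<open>Remove \<open>z\<close> from the clique in place of \<open>y\<close>:
          \<open>c\<close> is left with degree exactly 1, which the clique side never shows.\<close>
        obtain c where c: "c \<in> C" "c \<notin> {z}" using exists_not_in[of "{z}" C] C(2) by auto
        have "card {z, c} < card C" using C(2) c by simp
        then obtain c' where c': "c' \<in> C" "c' \<notin> {z, c}" using exists_not_in[of "{z, c}" C] by auto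
        have "(c, z) \<in> clique C" "(c, c') \<in> clique C" using c c' z by auto
        then have R: "(c, z) \<in> R2" "(c, c') \<in> R2" unfolding C(3)[symmetric] by simp_all
        then have "(c, c') \<in> del {z} R2" using c c' by simp
        then have "1 \<le> dg (del {z} R2) c" using t(8) by (intro dg_ge_1[of _ c c']) (simp_all add: del_def)
        moreover have "dg (del {z} R2) c < dg R2 c" using dg_del_less[OF t(8) R(1)] by simp
        moreover have "dg R2 c \<le> 2" using le2 c(1) C(1) by blast
        ultimately show False using exc_left_dg[OF E', of c] by linarith
      qed
    next
      fix C0 a assume E1: "exceptional_on (A - {x}) (B - {y}) R1 (del {y} R2)" and a: "a \<in> A" "a \<noteq> x" "dg R1 a = 0"
      obtain C P where C: "C \<subseteq> A - {x}" "card C = 3 \<or> card C = 4" "R1 = clique C"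
        and P: "partition_on (B - {y}) P" "card P + 1 = card C" "\<forall>p\<in>P. card p = 2 \<or> card p = 3"
          "del {y} R2 = (\<Union>p\<in>P. clique p)"
        by (rule excE[OF E1], rule that)
      obtain p q where pq: "R2 `` {y} = {p, q}" "p \<noteq> q" using 3 by (auto simp: card_2_iff)
      have Ry: "(y, p) \<in> R2" "(y, q) \<in> R2" using pq by auto
      have pB: "p \<in> B" "p \<noteq> y" "q \<in> B" "q \<noteq> y" using s2(8,9)[OF Ry(1)] s2(8,9)[OF Ry(2)] by auto
      \<comment> \<open>With the edge to \<open>y\<close>, the degree of \<open>r\<close> equals the
        size of its part; no degree exceeds 2, so the part is a pair.\<close>
      have cls: "\<exists>p'. {r, p'} \<in> P \<and> r \<noteq> p' \<and> R2 `` {r} = {y, p'}" if r: "r \<in> {p, q}" for r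
      proof -
        have rB: "r \<in> B" "r \<noteq> y" "(r, y) \<in> R2" using r pB s2(6)[OF Ry(1)] s2(6)[OF Ry(2)] by auto
        obtain X where X: "X \<in> P" "r \<in> X" using partition_onD1[OF P(1)] rB by blast
        have yX: "y \<notin> X" using partition_onD1[OF P(1)] X(1) by blast
        have "del {y} R2 `` {r} = X - {r}" unfolding P(4) by (rule partition_clique_Image[OF P(1) X])
        moreover have "R2 `` {r} = insert y (del {y} R2 `` {r})" using rB by (auto simp: in_del)
        ultimately have N: "R2 `` {r} = insert y (X - {r})" by simp
        have cX: "card X = 2 \<or> card X = 3" using P(3) X(1) by blast
        then have fX: "finite X" by (metis card.infinite zero_neq_numeral)
        have "dg R2 r = card X" unfolding N using fX yX card_Suc_Diff1[OF fX X(2)] by simp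
        then have "card X = 2" using le2[OF rB(1)] cX by linarith
        then obtain u v where "X = {u, v}" "u \<noteq> v" by (auto simp: card_2_iff)
        then obtain p' where "X = {r, p'}" "r \<noteq> p'" using X(2) by blast
        then show ?thesis using X N by (intro exI[of _ p']) auto
      qed
      then obtain p' where p': "{p, p'} \<in> P" "p \<noteq> p'" "R2 `` {p} = {y, p'}" by blast
      have p'B: "p' \<in> B" "p' \<noteq> y" using partition_onD1[OF P(1)] p'(1) by blast+
      show False
      proof (cases "p' = q")
        case True
        \<comment> \<open>\<open>y\<close> completes the part \<open>{p, q}\<close> to a triangle,
          so the original pair is exceptional as well.\<close>
        let ?P = "insert {p, q, y} (P - {{p, q}})"
        have pqP: "{p, q} \<in> P" using p'(1) True by simp
        have fP: "finite P" using P(2) C(2) card_ge_0_finite[of P] by linarith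
        have yP: "y \<notin> X" if "X \<in> P" for X using partition_onD1[OF P(1)] that by blast
        have dis: "X \<inter> Y = {}" if "X \<in> P" "Y \<in> P" "X \<noteq> Y" for X Y
          using partition_onD2[OF P(1)] that by (auto simp: disjoint_def)
        have part: "partition_on B ?P"
          unfolding partition_on_def disjoint_def
        proof (intro conjI ballI impI)
          show "\<Union> ?P = B" using partition_onD1[OF P(1)] pqP y by blast
          show "{} \<notin> ?P" using partition_onD3[OF P(1)] by blast
          have key: "{p, q, y} \<inter> X = {}" if "X \<in> P" "X \<noteq> {p, q}" for X
            using dis[OF pqP that(1)] that yP[OF that(1)] by blast
          show "X \<inter> Y = {}" if "X \<in> ?P" "Y \<in> ?P" "X \<noteq> Y" for X Y
            using that key[of X] key[of Y] dis[of X Y] by blast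
        qed
        have "{p, q, y} \<notin> P" using yP by blast
        then have cP: "card ?P = card P" using fP card_Suc_Diff1[OF fP pqP] by simp
        have "P = insert {p, q} (P - {{p, q}})" using pqP by blast
        then have "del {y} R2 = clique {p, q} \<union> (\<Union>p\<in>P - {{p, q}}. clique p)"
          unfolding P(4) by (metis UN_insert)
        moreover have "R2 = del {y} R2 \<union> {(y, p), (p, y), (y, q), (q, y)}"
        proof
          show "del {y} R2 \<union> {(y, p), (p, y), (y, q), (q, y)} \<subseteq> R2"
            using Ry s2(6)[OF Ry(1)] s2(6)[OF Ry(2)] by (auto simp: in_del)
          show "R2 \<subseteq> del {y} R2 \<union> {(y, p), (p, y), (y, q), (q, y)}"
          proof (rule subrelI)
            fix u v assume uv: "(u, v) \<in> R2"
            have "v \<in> {p, q}" if "u = y" using uv that pq(1) by blast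
            moreover have "u \<in> {p, q}" if "v = y" using s2(6)[OF uv] that pq(1) by blast
            ultimately show "(u, v) \<in> del {y} R2 \<union> {(y, p), (p, y), (y, q), (q, y)}" using uv by auto
          qed
        qed
        moreover have "clique {p, q, y} = clique {p, q} \<union> {(y, p), (p, y), (y, q), (q, y)}"
          using pB pq(2) by (auto simp: clique_def)
        ultimately have R2e: "R2 = (\<Union>p\<in>?P. clique p)" by auto
        have "exceptional_on A B R1 R2" unfolding exceptional_on_def
        proof (intro exI conjI)
          show "C \<subseteq> A" using C(1) by blast
          show "\<forall>X\<in>?P. card X = 2 \<or> card X = 3" using P(3) pB pq(2) by auto
          show "card ?P + 1 = card C" using cP P(2) by simp
        qed (fact C part R2e)+
        then show False using nexc by blast
      next
        case False
        \<comment> \<open>Remove \<open>p\<close> in place of \<open>y\<close>: its partner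
          \<open>p'\<close> becomes isolated, and so is \<open>a\<close> in \<open>R1\<close>, which
          rules out both orientations.\<close>
        have "dg R2 p = 2" using p' p'B by simp
        then have "2 \<le> dg R2 p" by simp
        from Ez[OF pB(1) this] show False
        proof (rule exc_side[OF _ x(1) pB(1)])
          assume "\<And>b. b \<in> B \<Longrightarrow> b \<noteq> p \<Longrightarrow> 1 \<le> dg (del {p} R2) b"
          then have "1 \<le> dg (del {p} R2) p'" using p'B p'(2) by blast
          then obtain w where "(p', w) \<in> del {p} R2" by (rule dg_ge_1E)
          then have w: "(p', w) \<in> R2" "w \<noteq> p" by simp_all
          then have "w \<noteq> y" using s2(6)[OF w(1)] pq(1) False p'(2) by auto
          then have "(p', w) \<in> del {y} R2" using w p'B by simp
          then have "w \<in> (\<Union>p\<in>P. clique p) `` {p'}" unfolding P(4)[symmetric] by blast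
          then show False using partition_clique_Image[OF P(1) p'(1), of p'] w by auto
        next
          assume "\<And>a. a \<in> A \<Longrightarrow> a \<noteq> x \<Longrightarrow> 1 \<le> dg R1 a"
          then show False using a by fastforce
        qed
      qed
    qed
  qed
qed

lemma isolated_degree_sum_le': "y \<in> B \<Longrightarrow> dg R2 y = 0 \<Longrightarrow> x \<in> A \<Longrightarrow> dg R1 x + dg R3 x \<le> 1"
  using min_counterexample.isolated_degree_sum_le[OF swap] by simp

text \<open>The degree sum bound makes \<open>R2\<close> a perfect matching and \<open>R3\<close>
  empty, so \<open>R1\<close> has more than n/2 edges. An edge of \<open>R2\<close> is placed on two
  non-adjacent vertices of \<open>R1\<close> with degree sum at least 3, which loses the required
  four edges.\<close>

lemma no_isolated:
  assumes xA: "x \<in> A"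
  shows "1 \<le> dg R1 x"
proof (rule ccontr)
  assume "\<not> ?thesis"
  then have x: "x \<in> A" "dg R1 x = 0" using xA by auto
  have le: "dg R2 y + dg (R3\<inverse>) y \<le> 1" if "y \<in> B" for y
    using isolated_degree_sum_le[OF x that] .
  then have "(\<Sum>y\<in>B. dg R2 y + dg (R3\<inverse>) y) \<le> card B"
    using sum_bounded_above[of B "\<lambda>y. dg R2 y + dg (R3\<inverse>) y" 1] by simp
  then have sB: "2 * ecard R2 + card R3 \<le> card A"
    using handshake[OF t(2)] sum_dg_bip(2)[OF t(5,6,3)] t(4) by (simp add: sum.distrib)
  \<comment> \<open>An isolated vertex on each side would bound both halves and keep the total at n,
    against \<open>weight_gt\<close>.\<close>
  have d2: "1 \<le> dg R2 y" if y: "y \<in> B" for y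
  proof (rule ccontr)
    assume "\<not> ?thesis"
    then have "dg R1 v + dg R3 v \<le> 1" if "v \<in> A" for v
      using isolated_degree_sum_le'[OF y _ that] by simp
    then have "(\<Sum>v\<in>A. dg R1 v + dg R3 v) \<le> card A"
      using sum_bounded_above[of A "\<lambda>v. dg R1 v + dg R3 v" 1] by simp
    then have "2 * ecard R1 + card R3 \<le> card A"
      using handshake[OF t(1)] sum_dg_bip(1)[OF t(5,6,3)] by (simp add: sum.distrib)
    then show False using sB weight_gt by linarith
  qed
  have d2: "dg R2 y = 1" if "y \<in> B" for y using d2[OF that] le[OF that] by linarith
  then have e2: "2 * ecard R2 = card A" using handshake[OF t(2)] t(4) by simp
  then have R3e: "R3 = {}" using sB t(9) by simp
  have e1: "card A < 2 * ecard R1" using weight_gt e2 R3e by simp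
  obtain u where u: "u \<in> A" "\<And>w. w \<in> A \<Longrightarrow> dg R1 w \<le> dg R1 u"
    using max_dg[OF t(5)] x(1) by blast
  have u2: "2 \<le> dg R1 u"
  proof (rule ccontr)
    assume "\<not> ?thesis"
    then have "dg R1 w \<le> 1" if "w \<in> A" for w using u(2)[OF that] by linarith
    then have "(\<Sum>w\<in>A. dg R1 w) \<le> card A" using sum_bounded_above[of A "dg R1" 1] by simp
    then show False using handshake[OF t(1)] e1 by simp
  qed
  define U where "U = {a \<in> A. a \<noteq> u \<and> (u, a) \<notin> R1}"
  obtain a0 where "a0 \<in> A" "a0 \<noteq> u" "(u, a0) \<notin> R1"
    using exists_nonneighbour[OF t(1) u(1)] deg1[OF u(1)] by blast
  then have "finite U" "U \<noteq> {}" using t(5) by (auto simp: U_def)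
  then obtain u' where u': "u' \<in> U" "\<And>w. w \<in> U \<Longrightarrow> dg R1 w \<le> dg R1 u'"
    using max_dg[where R = R1] by blast
  then have u'A: "u' \<in> A" "u' \<noteq> u" "(u, u') \<notin> R1" by (simp_all add: U_def)
  \<comment> \<open>Otherwise all edges lie among \<open>u\<close> and its two neighbours, at most
    three of them; but n is at least 5 and even, and \<open>R1\<close> has more than n/2
    edges.\<close>
  have big: "3 \<le> dg R1 u + dg R1 u'"
  proof (rule ccontr)
    assume "\<not> ?thesis"
    then have d: "dg R1 u = 2" "dg R1 u' = 0" using u2 by linarith+
    let ?S = "insert u (R1 `` {u})"
    have S: "?S \<subseteq> A" "card ?S = 3" using u(1) s1(4) d(1) s1(3,5)[of u] by auto
    have "(\<Sum>w\<in>A. dg R1 w) = (\<Sum>w\<in>?S. dg R1 w)"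
      by (rule sum.mono_neutral_right[OF t(5) S(1)]) (use u'(2) d(2) in \<open>force simp: U_def\<close>)
    also have "\<dots> \<le> card ?S * 2"
      using sum_bounded_above[of ?S "dg R1" 2] u(2) S(1) d(1) by auto
    finally have "2 * ecard R1 \<le> 6" using handshake[OF t(1)] S(2) by simp
    moreover have "5 \<le> card A" using deg1_le[OF u(1)] d(1) by simp
    ultimately show False using weight_gt e2 R3e by simp
  qed
  have "card A > 0" using n_ge_4 by simp
  then have "R2 \<noteq> {}" using e2 by auto
  then obtain y y' where yy: "(y, y') \<in> R2" by (metis all_not_in_conv prod.exhaust)
  have yB: "y \<in> B" "y' \<in> B" "(y', y) \<in> R2" "y \<noteq> y'" using s2(6-9)[OF yy] by auto
  have N: "R2 `` {y} = {y'}" "R2 `` {y'} = {y}"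
    using dg_1[OF d2[OF yB(1)] yy] dg_1[OF d2[OF yB(2)] yB(3)] .
  interpret sw: min_counterexample B A R2 R1 "R3\<inverse>" by (rule swap)
  let ?R1 = "del {u, u'} R1" and ?R2 = "del {y, y'} R2"
  have E1: "ecard ?R1 + dg R1 u + dg R1 u' = ecard R1"
    by (rule ecard_del2[OF t(1) u'A(2)[symmetric] u'A(3)])
  have E2: "ecard ?R2 + 1 \<le> ecard R2"
    using ecard_del1[OF t(2), of y] ecard_del_mono[OF t(8), of "{y}" "{y, y'}"] d2[OF yB(1)] by simp
  have w: "ecard ?R2 + ecard ?R1 + card ({} :: 'a rel) + 2 * card {y'} + 5 \<le> 2 * card B"
    using E1 E2 weight big t(4) by simp
  have 1: "dg ?R2 b + card {y'} + 3 \<le> card B" if "b \<in> B" for b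
  proof -
    have "5 \<le> card A" using deg1_le[OF u(1)] u2 by simp
    then show ?thesis using dg_del_le[OF t(8), of "{y, y'}" b] d2[OF that] t(4) by simp
  qed
  \<comment> \<open>A violating \<open>a\<close> would have degree n - 3, yet it misses itself,
    \<open>u\<close>, \<open>u'\<close> and the isolated \<open>x\<close>.\<close>
  have 2: "dg ?R1 a + card {y'} + 3 \<le> card B" if a: "a \<in> A" "a \<notin> insert u {u'}" for a
  proof (rule ccontr)
    assume "\<not> ?thesis"
    then have c: "card A \<le> dg ?R1 a + 3" using t(4) by simp
    have le: "dg ?R1 a \<le> dg R1 a" by (rule dg_del_le[OF t(7)])
    have "(a, s) \<notin> R1" if "s \<in> {u, u'}" for s
      using dg_del_less[OF t(7), of a s "{u, u'}"] that c deg1_le[OF a(1)] by linarith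
    then have au: "(a, u) \<notin> R1" "(a, u') \<notin> R1" by auto
    then have "a \<in> U" using a s1(6)[of u a] by (auto simp: U_def)
    then have "dg R1 a \<le> dg R1 u'" by (rule u'(2))
    moreover have "1 \<le> dg R1 a" using c le n_ge_4 by linarith
    ultimately have ne: "x \<noteq> a" "x \<noteq> u" "x \<noteq> u'" using x(2) u2 by auto
    have "(a, x) \<notin> R1" using s1(6)[of a x] dg_ge_1[OF t(7), of x a] x(2) by auto
    then have "R1 `` {a} \<subseteq> A - {a, u, u', x}" using au s1(4,5) by blast
    then have "dg R1 a \<le> card (A - {a, u, u', x})" using t(5) by (intro card_mono) auto
    also have "\<dots> = card A - card {a, u, u', x}"
      using a(1) u(1) u'A(1) x(1) by (intro card_Diff_subset) auto
    also have "card {a, u, u', x} = 4" using ne a(2) u'A(2) by auto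
    finally show False using c le n_ge_4 by linarith
  qed
  have prem: "(y, u) \<notin> R3\<inverse>" "{y'} \<subseteq> B" "{u'} \<subseteq> A" "card {u'} = card {y'}" "u \<notin> {u'}"
    "{u'} \<inter> R1 `` {u} = {}" "R3\<inverse> \<inter> {y'} \<times> {u'} = {}"
    "R3\<inverse> \<inter> (- insert y {y'}) \<times> (- insert u {u'}) \<subseteq> {}" "(R2 `` {y} - {y'}) \<times> (R1 `` {u} - {u'}) \<subseteq> {}"
    "({} :: 'a rel) \<subseteq> (B - insert y {y'}) \<times> (A - insert u {u'})"
    using R3e yB u'A N(1) by auto
  have 3: "dg ({} :: 'a rel) a + card {y'} + 2 \<le> card B" "dg (({} :: 'a rel)\<inverse>) a + card {y'} + 2 \<le> card B" for a
    using n_ge_4 t(4) by simp_all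
  have N': "R2 `` {l} = {y}" if "l \<in> {y'}" for l using that N(2) by simp
  note red = sw.reduce[OF yB(1) u(1) prem(1,2) N' prem(3-10) w 1 2 3]
  have s3: "dg R1 u + dg R1 u' = 3"
    using red(3) E1 E2 weight big t(4) by simp
  have cc: "card (B - insert y {y'}) = card (A - insert u {u'})"
    using yB u(1) u'A t(4-6) by (simp add: card_Diff_subset)
  from red(1) show False
  proof
    assume E: "exceptional_on (B - insert y {y'}) (A - insert u {u'}) ?R2 ?R1"
    obtain C where C: "C \<subseteq> B - insert y {y'}" "3 \<le> card C" "?R2 = clique C"
      using exc_left[OF E _ _ cc] t(5,6) by (metis finite_Diff)
    obtain c where c: "c \<in> C" using C(2) by fastforce
    then have "2 \<le> dg ?R2 c" using C(2,3) by (simp add: dg_clique)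
    then show False using dg_del_le[OF t(8), of "{y, y'}" c] d2[of c] c C(1) by auto
  next
    assume E: "exceptional_on (A - insert u {u'}) (B - insert y {y'}) ?R1 ?R2"
    obtain C P where C: "C \<subseteq> A - insert u {u'}" "card C = 3 \<or> card C = 4" "?R1 = clique C"
      and P: "partition_on (B - insert y {y'}) P" "card P + 1 = card C" "\<forall>p\<in>P. card p = 2 \<or> card p = 3"
        "?R2 = (\<Union>p\<in>P. clique p)"
      by (rule excE[OF E], rule that)
    have fC: "finite C" using C(2) card_ge_0_finite[of C] by linarith
    have dC: "2 \<le> dg R1 c" "C - {c} \<subseteq> R1 `` {c}" if "c \<in> C" for c
    proof -
      show "2 \<le> dg R1 c"
        using dg_del_le[OF t(7), of "{u, u'}" c] C(2,3) that by (auto simp: dg_clique)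
      have "(c, b) \<in> ?R1" if "b \<in> C - {c}" for b unfolding C(3) using that \<open>c \<in> C\<close> by auto
      then show "C - {c} \<subseteq> R1 `` {c}" by auto
    qed
    obtain c where c: "c \<in> C" using C(2) by fastforce
    show False
    proof (cases "dg R1 u = 2")
      case True
      then have "dg R1 u' = 1" using s3 by simp
      \<comment> \<open>Degrees are at most 2, so the clique is a whole component avoiding
        \<open>u\<close>; its vertices then compete with \<open>u'\<close> and beat its degree
        1.\<close>
      moreover have "c \<in> U"
      proof -
        have cu: "c \<in> A" "c \<noteq> u" "u \<notin> C" using c C(1) by auto
        have "dg R1 c \<le> 2" using u(2)[of c] True cu by simp
        moreover have "2 \<le> card (C - {c})" using fC c C(2) by auto
        ultimately have "dg R1 c \<le> card (C - {c})" by linarith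
        then have "C - {c} = R1 `` {c}" by (rule card_seteq[OF s1(3) dC(2)[OF c]])
        then have "(c, u) \<notin> R1" using cu(3) by blast
        then show ?thesis using cu s1(6)[of u c] by (auto simp: U_def)
      qed
      ultimately show False using u'(2)[of c] dC(1)[OF c] by simp
    next
      case False
      then have d: "dg R1 u = 3" "dg R1 u' = 0" using s3 u2 by linarith+
      \<comment> \<open>A clique vertex not adjacent to \<open>u\<close> would be a better choice
        than the isolated \<open>u'\<close>. So \<open>u\<close> extends the triangle to a clique on
        four vertices and \<open>{y, y'}\<close> becomes the third part.\<close>
      have "C \<subseteq> R1 `` {u}"
      proof
        fix c assume c: "c \<in> C"
        then have "c \<in> A" "c \<noteq> u" using C(1) by auto
        moreover have "c \<notin> U" using u'(2)[of c] d(2) dC(1)[OF c] by auto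
        ultimately show "c \<in> R1 `` {u}" by (simp add: U_def)
      qed
      moreover have "dg R1 u \<le> card C" using d(1) C(2) by auto
      ultimately have CN: "C = R1 `` {u}" by (rule card_seteq[OF s1(3)])
      have uC: "u \<notin> C" using C(1) by blast
      have N0: "R1 `` {u'} = {}" using d(2) dg_0[OF t(7)] by blast
      have "(a, b) \<in> R1 \<longleftrightarrow> (a, b) \<in> clique (insert u C)" for a b
      proof
        assume ab: "(a, b) \<in> R1"
        have ba: "(b, a) \<in> R1" "a \<noteq> b" using s1(6,9)[OF ab] .
        have ne: "a \<noteq> u'" "b \<noteq> u'" using ab ba N0 by blast+
        consider "a = u" | "b = u" | "a \<noteq> u" "b \<noteq> u" by blast
        then show "(a, b) \<in> clique (insert u C)"
        proof cases
          case 3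
          then have "(a, b) \<in> ?R1" using ab ne by simp
          then show ?thesis unfolding C(3) by simp
        qed (use ab ba CN in auto)
      next
        assume ab: "(a, b) \<in> clique (insert u C)"
        consider "a = u" | "b = u" | "a \<noteq> u" "b \<noteq> u" by blast
        then show "(a, b) \<in> R1"
        proof cases
          case 1
          then show ?thesis using ab CN by auto
        next
          case 2
          then show ?thesis using ab CN s1(6)[of u a] by auto
        next
          case 3
          then have "(a, b) \<in> ?R1" unfolding C(3) using ab by simp
          then show ?thesis by simp
        qed
      qed
      then have R1e: "R1 = clique (insert u C)" by (intro equalityI subrelI) blast+
      have cC: "card C = 3" using CN d(1) by simp
      let ?P = "insert {y, y'} P"
      have part: "partition_on B ?P"
        unfolding partition_on_def disjoint_def
      proof (intro conjI ballI impI)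
        note un = partition_onD1[OF P(1)]
        show "\<Union> ?P = B" using un yB by blast
        show "{} \<notin> ?P" using partition_onD3[OF P(1)] by blast
        show "X \<inter> Y = {}" if "X \<in> ?P" "Y \<in> ?P" "X \<noteq> Y" for X Y
        proof -
          have "X \<inter> Y = {}" if "X \<in> P" "Y \<in> P"
            using partition_onD2[OF P(1)] that \<open>X \<noteq> Y\<close> by (auto simp: disjoint_def)
          moreover have "Z \<inter> {y, y'} = {}" if "Z \<in> P" for Z using un that by blast
          ultimately show ?thesis using that by blast
        qed
      qed
      have "{y, y'} \<notin> P" using partition_onD1[OF P(1)] by blast
      moreover have "finite P" using P(2) cC card_ge_0_finite[of P] by linarith
      ultimately have cP: "card ?P = 3" using P(2) cC by simp
      have "(a, b) \<in> R2 \<longleftrightarrow> (a, b) \<in> ?R2 \<union> clique {y, y'}" for a b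
      proof
        assume ab: "(a, b) \<in> R2"
        have ba: "(b, a) \<in> R2" by (rule s2(6)[OF ab])
        consider "a = y" | "a = y'" | "b = y" | "b = y'" | "a \<notin> {y, y'}" "b \<notin> {y, y'}" by blast
        then show "(a, b) \<in> ?R2 \<union> clique {y, y'}"
        proof cases
          case 1
          then have "b = y'" using ab N(1) by blast
          then show ?thesis using 1 yB(4) by simp
        next
          case 2
          then have "b = y" using ab N(2) by blast
          then show ?thesis using 2 yB(4) by simp
        next
          case 3
          then have "a = y'" using ba N(1) by blast
          then show ?thesis using 3 yB(4) by simp
        next
          case 4
          then have "a = y" using ba N(2) by blast
          then show ?thesis using 4 yB(4) by simp
        next
          case 5
          then show ?thesis using ab by simp
        qed
      next
        assume "(a, b) \<in> ?R2 \<union> clique {y, y'}"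
        then consider "(a, b) \<in> ?R2" | "a = y" "b = y'" | "a = y'" "b = y" by auto
        then show "(a, b) \<in> R2" using yy yB(3) by cases simp_all
      qed
      then have "R2 = ?R2 \<union> clique {y, y'}" by (intro equalityI subrelI) blast+
      then have R2e: "R2 = (\<Union>p\<in>?P. clique p)" using P(4) by (metis UN_insert Un_commute)
      have "exceptional_on A B R1 R2" unfolding exceptional_on_def
      proof (intro exI conjI)
        show "insert u C \<subseteq> A" using C(1) u(1) by blast
        show "card (insert u C) = 3 \<or> card (insert u C) = 4" "card ?P + 1 = card (insert u C)"
          using cC fC uC cP by simp_all
        show "\<forall>X\<in>?P. card X = 2 \<or> card X = 3" using P(3) yB(4) by auto
      qed (fact R1e part R2e)+
      then show False using nexc by blast
    qed
  qed
qed

lemma no_isolated': "y \<in> B \<Longrightarrow> 1 \<le> dg R2 y"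
  using min_counterexample.no_isolated[OF swap] .

end

section \<open>Graphs without isolated vertices\<close>

context min_counterexample
begin

lemma two_ecard_ge: "card A \<le> 2 * ecard R1" "card A \<le> 2 * ecard R2"
  using degree_sum_ge0[OF t(1), of 1] degree_sum_ge0[OF t(2), of 1] no_isolated no_isolated' t(4) by simp_all

text \<open>A leaf \<open>x\<close> and one edge of \<open>R3\<close> lose two edges. The remainder
  always contains a new pair at the neighbour \<open>x'\<close> of \<open>x\<close>, so it cannot be
  exceptional; only the \<open>R3\<close>-degree of \<open>x'\<close> may become too large.\<close>

lemma R3_empty:
  assumes "ecard R1 < card A"
  shows "R3 = {}"
proof (rule ccontr)
  assume ne: "R3 \<noteq> {}"
  obtain x where x: "x \<in> A" "dg R1 x = 1"
    using exists_leaf_outside[OF t(1) no_isolated, of "{}"] assms by auto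
  obtain x' where N: "R1 `` {x} = {x'}" using x(2) by (rule card_1_singletonE)
  have xx': "(x, x') \<in> R1" using N by blast
  have c3: "card R3 + 3 \<le> card A" using two_ecard_ge weight by linarith
  have key: "card A \<le> dg R3 x' + dg R2 y + 1"
    if y: "y \<in> B" "(x, y) \<notin> R3" "1 \<le> dg R3 x + dg (R3\<inverse>) y" for y
  proof (rule ccontr)
    assume c: "\<not> ?thesis"
    have loss: "dg R1 x * dg R2 y + 2 \<le> dg R1 x + dg R2 y + dg R3 x + dg (R3\<inverse>) y"
      using x(2) y(3) by simp
    have 1: "dg (del {x} R1) a + 3 \<le> card A" if "a \<in> A" for a
      using deg1_le[OF that] dg_del_le[OF t(7), of "{x}" a] by linarith
    have 2: "dg (del {y} R2) b + 3 \<le> card A" if "b \<in> B" for b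
      using deg2_le[OF that] dg_del_le[OF t(8), of "{y}" b] by linarith
    have 3: "dg R3 a + (if (x, a) \<in> R1 then dg R2 y else 0) + 2 \<le> card A" for a
    proof (cases "(x, a) \<in> R1")
      case True
      then have "a = x'" using N by blast
      then show ?thesis using c True by simp
    next
      case False
      then show ?thesis using converse_dg_le(1)[OF t(9), of a] c3 by simp
    qed
    have 4: "dg (R3\<inverse>) b + (if (y, b) \<in> R2 then dg R1 x else 0) + 2 \<le> card A" for b
      using converse_dg_le(2)[OF t(9), of b] c3 x(2) by simp
    have "bip_del x y = {}" by (rule single(2)[OF x(1) y(1,2) loss 1 2 3 4])
    moreover obtain z where "(y, z) \<in> R2" using no_isolated'[OF y(1)] by (rule dg_ge_1E)
    then have "(x', z) \<in> bip_del x y" using xx' by (simp add: bip_del_def)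
    ultimately show False by blast
  qed
  \<comment> \<open>The failure inequality for two images forces many edges of \<open>R2\<close> and
    \<open>R3\<close> together; with at least n/2 edges in \<open>R1\<close> the budget is
    exceeded.\<close>
  have two: False if y: "y1 \<in> B" "y2 \<in> B" "y1 \<noteq> y2"
    "card A \<le> dg R3 x' + dg R2 y1 + 1" "card A \<le> dg R3 x' + dg R2 y2 + 1" for y1 y2
  proof -
    have "dg R2 y1 + dg R2 y2 + 1 * (card B - 2) \<le> 2 * ecard R2"
      by (rule degree_sum_ge2[OF t(2) y(1-3)]) (rule no_isolated')
    then show False
      using y(4,5) converse_dg_le(1)[OF t(9), of x'] two_ecard_ge(1) weight n_ge_4 t(4) by linarith
  qed
  have fin: "finite (R3 `` {a})" for a using t(9) by (simp add: finite_Image)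
  show False
  proof (cases "dg R3 x = 0")
    case False
    have cN: "dg R3 x + 1 < card B" using converse_dg_le(1)[OF t(9), of x] c3 t(4) by linarith
    obtain y1 where y1: "y1 \<in> B" "y1 \<notin> R3 `` {x}" using exists_not_in[OF fin, of x B] cN by auto
    have "card (insert y1 (R3 `` {x})) < card B" using cN fin y1 by simp
    then obtain y2 where y2: "y2 \<in> B" "y2 \<notin> insert y1 (R3 `` {x})"
      using exists_not_in[of "insert y1 (R3 `` {x})" B] fin by auto
    have "card A \<le> dg R3 x' + dg R2 y1 + 1" "card A \<le> dg R3 x' + dg R2 y2 + 1"
      using key[of y1] key[of y2] y1 y2 False by simp_all
    then show False using two[of y1 y2] y1 y2 by blast
  next
    case True
    then have nx: "(x, b) \<notin> R3" for b using dg_ge_1[OF t(9), of x b] by linarith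
    show False
    proof (cases "2 \<le> dg R3 x'")
      case True
      then obtain y1 where y1: "y1 \<in> R3 `` {x'}" using exists_not_in[of "{}" "R3 `` {x'}"] by auto
      obtain y2 where y2: "y2 \<in> R3 `` {x'}" "y2 \<notin> {y1}"
        using exists_not_in[of "{y1}" "R3 `` {x'}"] True by auto
      have "y \<in> B \<and> card A \<le> dg R3 x' + dg R2 y + 1" if "y \<in> R3 `` {x'}" for y
      proof -
        have r: "(x', y) \<in> R3" using that by simp
        then have "y \<in> B" using t(3) by blast
        moreover have "1 \<le> dg R3 x + dg (R3\<inverse>) y" using dg_ge_1'[OF t(9) r] by simp
        ultimately show ?thesis using key nx by blast
      qed
      then show False using two[of y1 y2] y1 y2 by blast
    next
      case False
      obtain a y where ay: "(a, y) \<in> R3" using ne by (metis all_not_in_conv prod.exhaust)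
      then have yB: "y \<in> B" using t(3) by blast
      have "1 \<le> dg R3 x + dg (R3\<inverse>) y" using dg_ge_1'[OF t(9) ay] by simp
      then show False using key[OF yB nx] deg2_le[OF yB] False by linarith
    qed
  qed
qed

text \<open>If \<open>R2\<close> has minimum degree 2, an end star of \<open>R1\<close> is mapped so
  that its leaves land on a set touching one edge more than its size. That surplus edge just reaches
  the required loss.\<close>

lemma exists_leaf2:
  assumes le: "ecard R1 \<le> ecard R2" and R3e: "R3 = {}"
  shows "\<exists>b\<in>B. dg R2 b = 1"
proof (rule ccontr)
  assume "\<not> ?thesis"
  then have d2: "2 \<le> dg R2 b" if "b \<in> B" for b using no_isolated'[OF that] that by force
  have w: "ecard R1 < card A" using le weight by linarith
  have w0: "card ({} :: 'a set) + ecard R1 < card A" using w by simp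
  obtain c where c: "c \<in> A" "{l \<in> R1 `` {c}. dg R1 l = 1} \<noteq> {}"
    "card (R1 `` {c} - {l \<in> R1 `` {c}. dg R1 l = 1}) \<le> 1"
    by (rule exists_end_star[OF t(1) _ empty_subsetI _ w0], erule no_isolated, simp, rule that)
  define L where "L = {l \<in> R1 `` {c}. dg R1 l = 1}"
  have L: "L \<subseteq> R1 `` {c}" "L \<noteq> {}" "card (R1 `` {c} - L) \<le> 1"
    unfolding L_def by (blast, fact c(2), fact c(3))
  have fL: "finite L" using L(1) s1(3) by (rule finite_subset)
  have LN: "R1 `` {l} = {c}" if "l \<in> L" for l
    using that dg_1[of R1 l c] s1(6)[of c l] by (auto simp: L_def)
  have LA: "L \<subseteq> A" using L(1) s1(4) by blast
  have k1: "1 \<le> card L" using L(2) fL by (simp add: Suc_le_eq card_gt_0_iff)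
  have dc: "dg R1 c = card L + card (R1 `` {c} - L)"
    using card_Diff_subset[OF fL L(1)] card_mono[OF s1(3) L(1)] by simp
  have sum1: "dg R1 c + 1 * (card A - 1) \<le> 2 * ecard R1"
    by (rule degree_sum_ge1[OF t(1) c(1)]) (rule no_isolated)
  \<comment> \<open>The degree sums of both graphs, with minimum degrees 1 and 2, add up to at most
    4 n - 6.\<close>
  have D: "dg R2 b + dg R1 c + 3 \<le> card A" if "b \<in> B" for b
  proof -
    have "dg R2 b + 2 * (card B - 1) \<le> 2 * ecard R2"
      by (rule degree_sum_ge1[OF t(2) that]) (rule d2)
    then show ?thesis using sum1 weight n_ge_4 t(4) by linarith
  qed
  have e2: "card A \<le> ecard R2" using degree_sum_ge0[OF t(2) d2] t(4) by simp
  have "B \<noteq> {}" using n_ge_4 t(4) by auto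
  then obtain y where y: "y \<in> B" by blast
  let ?M = "B - insert y (R2 `` {y})"
  have "card ?M = card B - card (insert y (R2 `` {y}))"
    using y s2(3,4) by (intro card_Diff_subset) auto
  also have "card (insert y (R2 `` {y})) = dg R2 y + 1" using s2(3,5) by simp
  finally have "card L < card ?M" using D[OF y] dc t(4) by linarith
  then obtain Y where Y: "Y \<subseteq> ?M" "card Y = card L" "ecard (del Y R2) + card L + 1 \<le> ecard R2"
    using exists_touching_set[OF t(2) d2, of ?M "card L"] k1 by blast
  have Y': "Y \<subseteq> B" "y \<notin> Y" "Y \<inter> R2 `` {y} = {}" using Y(1) by blast+
  let ?Q = "(R1 `` {c} - L) \<times> (R2 `` {y} - Y)"
  have NY: "R2 `` {y} - Y = R2 `` {y}" using Y'(3) by blast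
  have cQ: "card ?Q = card (R1 `` {c} - L) * dg R2 y" unfolding NY by (rule card_cartesian_product)
  have E1: "ecard (del (insert c L) R1) + dg R1 c \<le> ecard R1"
    using ecard_del1[OF t(1), of c] ecard_del_mono[OF t(7), of "{c}" "insert c L"] by auto
  have E2: "ecard (del (insert y Y) R2) + dg R2 y = ecard (del Y R2)"
    by (rule ecard_del_insert[OF t(2) Y'(2,3)])
  have sub: "?Q \<subseteq> (A - insert c L) \<times> (B - insert y Y)" using s1(4,5) s2(4,5) by blast
  have m: "card (R1 `` {c} - L) = 0 \<or> card (R1 `` {c} - L) = 1" using L(3) by linarith
  have w: "ecard (del (insert c L) R1) + ecard (del (insert y Y) R2) + card ?Q + 2 * card L + 5 \<le> 2 * card A"
    using m
  proof
    assume "card (R1 `` {c} - L) = 0"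
    then show ?thesis using E1 E2 Y(3) weight dc cQ d2[OF y] by simp
  next
    assume "card (R1 `` {c} - L) = 1"
    then show ?thesis using E1 E2 Y(3) weight dc cQ by simp
  qed
  have 1: "dg (del (insert c L) R1) a + card L + 3 \<le> card A" for a
    using dg_le_ecard[OF simple_on_del[OF t(1)], of "insert c L" a] E1 dc e2 weight by linarith
  have 2: "dg (del (insert y Y) R2) b + card L + 3 \<le> card A" if "b \<in> B" for b
    using dg_del_le[OF t(8), of "insert y Y" b] D[OF that] dc by linarith
  have 3: "dg ?Q a + card L + 2 \<le> card A" for a
  proof -
    have "dg ?Q a \<le> dg R2 y" using s2(3) by (intro card_mono) auto
    then show ?thesis using D[OF y] dc by linarith
  qed
  have 4: "dg (?Q\<inverse>) b + card L + 2 \<le> card A" for b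
  proof -
    have "dg (?Q\<inverse>) b \<le> card (R1 `` {c} - L)" using s1(3) by (intro card_mono) auto
    then show ?thesis using D[OF y] dc by linarith
  qed
  have Q1: "R3 \<inter> (- insert c L) \<times> (- insert y Y) \<subseteq> ?Q" "(c, y) \<notin> R3" "R3 \<inter> L \<times> Y = {}"
    using R3e by auto
  note red = reduce[OF c(1) y Q1(2) LA LN Y'(1) Y(2) Y'(2,3) Q1(3) Q1(1) subset_refl sub w 1 2 3 4]
  show False using m
  proof
    \<comment> \<open>Without a non-leaf neighbour one edge too many is lost; with one,
      \<open>?Q\<close> is non-empty. Both contradict the equality case.\<close>
    assume "card (R1 `` {c} - L) = 0"
    then show False using red(3) E1 E2 Y(3) weight dc d2[OF y] by linarith
  next
    assume "card (R1 `` {c} - L) = 1"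
    then have "card ?Q = dg R2 y" using cQ by simp
    moreover have "card ?Q = 0" using red(2) by (metis card.empty)
    ultimately show False using d2[OF y] by linarith
  qed
qed

text \<open>Two mapped vertices require remaining degrees of at most n - 4. A vertex
  \<open>w\<close> of degree n - 3 meets all but at most one edge of \<open>R1\<close>, so a leaf at
  \<open>w\<close> is chosen if there is such a vertex.\<close>

lemma nice_leaf1:
  assumes le: "ecard R1 + 2 \<le> card A" and n5: "5 \<le> card A"
  obtains x x' where "(x, x') \<in> R1" "dg R1 x = 1" "\<And>a. a \<in> A \<Longrightarrow> dg (del {x, x'} R1) a + 4 \<le> card A"
proof (cases "\<exists>w\<in>A. dg R1 w + 3 = card A")
  case True
  then obtain w where w: "w \<in> A" "dg R1 w + 3 = card A" by blast
  let ?S = "insert w (R1 `` {w})"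
  have S: "?S \<subseteq> A" "card ?S = dg R1 w + 1" using w(1) s1(3-5) by auto
  \<comment> \<open>If all neighbours of \<open>w\<close> had degree at least 2, the degree sum
    would be at least 3 (n - 3) + 2, more than 2 (n - 2).\<close>
  have "\<exists>x\<in>R1 `` {w}. dg R1 x = 1"
  proof (rule ccontr)
    assume "\<not> ?thesis"
    then have "2 \<le> dg R1 v" if "v \<in> R1 `` {w}" for v
      using that no_isolated[of v] s1(4)[of w] by force
    then have "2 * dg R1 w \<le> (\<Sum>v\<in>R1 `` {w}. dg R1 v)"
      using sum_bounded_below[of "R1 `` {w}" 2 "dg R1"] by (simp add: mult.commute)
    moreover have "(\<Sum>v\<in>?S. dg R1 v) = dg R1 w + (\<Sum>v\<in>R1 `` {w}. dg R1 v)"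
      using s1(3,5) by (intro sum.insert) auto
    moreover have "(\<Sum>v\<in>?S. dg R1 v) + 1 * (card A - card ?S) \<le> 2 * ecard R1"
      by (rule degree_sum_ge[OF t(1) S(1)]) (use no_isolated in auto)
    ultimately show False using S(2) w(2) le n_ge_4 by linarith
  qed
  then obtain x where x: "(w, x) \<in> R1" "dg R1 x = 1" by blast
  show ?thesis
  proof (rule that[OF s1(6)[OF x(1)] x(2)])
    fix a assume "a \<in> A"
    have "ecard (del {x, w} R1) \<le> ecard (del {w} R1)" by (rule ecard_del_mono[OF t(7)]) simp
    then have "ecard (del {x, w} R1) \<le> 1" using ecard_del1[OF t(1), of w] w(2) le by linarith
    then show "dg (del {x, w} R1) a + 4 \<le> card A"
      using dg_le_ecard[OF simple_on_del[OF t(1)], of "{x, w}" a] n5 by linarith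
  qed
next
  case False
  obtain x where x: "x \<in> A" "dg R1 x = 1"
    using exists_leaf_outside[OF t(1) no_isolated, of "{}"] le by auto
  obtain x' where N: "R1 `` {x} = {x'}" using x(2) by (rule card_1_singletonE)
  show ?thesis
  proof (rule that[of x x'])
    show "(x, x') \<in> R1" using N by blast
    show "dg (del {x, x'} R1) a + 4 \<le> card A" if "a \<in> A" for a
    proof -
      have "dg R1 a + 3 \<noteq> card A" using False that by blast
      then show ?thesis using deg1_le[OF that] dg_del_le[OF t(7), of "{x, x'}" a] by linarith
    qed
  qed fact
qed

text \<open>\<open>x'\<close> goes to the leaf \<open>y'\<close> and \<open>x\<close> to
  \<open>y\<close>. The new pairs number deg x' - 1, so the net loss is deg y + 2, at least
  four.\<close>

lemma leaf_pair:
  assumes R3e: "R3 = {}"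
    and x: "(x, x') \<in> R1" "dg R1 x = 1" "\<And>a. a \<in> A \<Longrightarrow> dg (del {x, x'} R1) a + 4 \<le> card A"
    and y: "y \<in> B" "y' \<in> B" "dg R2 y' = 1" "y \<noteq> y'" "(y, y') \<notin> R2" "2 \<le> dg R2 y"
    and d: "\<And>b. b \<in> B \<Longrightarrow> b \<noteq> y \<Longrightarrow> b \<noteq> y' \<Longrightarrow> dg (del {y, y'} R2) b + 4 \<le> card A"
  shows "dg R2 y = 2" "exceptional_on (B - {y, y'}) (A - {x, x'}) (del {y, y'} R2) (del {x, x'} R1)"
proof -
  have N: "R1 `` {x} = {x'}" using dg_1[OF x(2,1)] .
  have xA: "x \<in> A" "x' \<in> A" "(x', x) \<in> R1" "x \<noteq> x'" using s1(6-9)[OF x(1)] by auto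
  obtain z where N2: "R2 `` {y'} = {z}" using y(3) by (rule card_1_singletonE)
  have zy: "z \<noteq> y" using N2 s2(6)[of y' y] y(5) by blast
  let ?Q = "(R1 `` {x'} - {x}) \<times> (R2 `` {y'} - {y})"
  have Qe: "?Q = (R1 `` {x'} - {x}) \<times> {z}" using N2 zy by auto
  have cN: "card (R1 `` {x'} - {x}) + 1 = dg R1 x'"
    using xA(3) s1(3)[of x'] card_Suc_Diff1[of "R1 `` {x'}" x] by simp
  have cQ: "card ?Q + 1 = dg R1 x'" unfolding Qe card_cartesian_product using cN by simp
  have E1: "ecard (del (insert x' {x}) R1) + dg R1 x' \<le> ecard R1"
    using ecard_del1[OF t(1), of x'] ecard_del_mono[OF t(7), of "{x'}" "insert x' {x}"] by auto
  have E2: "ecard (del (insert y' {y}) R2) + dg R2 y + 1 = ecard R2"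
    using ecard_del2[OF t(2) y(4,5)] y(3) by (simp add: insert_commute)
  have w: "ecard (del (insert x' {x}) R1) + ecard (del (insert y' {y}) R2) + card ?Q + 2 * card {x} + 5
      \<le> 2 * card A"
    using E1 E2 cQ weight y(6) by simp
  have eqs: "insert x' {x} = {x, x'}" "insert y' {y} = {y, y'}" by auto
  have 1: "dg (del (insert x' {x}) R1) a + card {x} + 3 \<le> card A" if "a \<in> A" for a
    using x(3)[OF that] unfolding eqs by simp
  have 2: "dg (del (insert y' {y}) R2) b + card {x} + 3 \<le> card A" if "b \<in> B" "b \<notin> insert y' {y}" for b
    using d[of b] that unfolding eqs by simp
  have 3: "dg ?Q a + card {x} + 2 \<le> card A" for a
  proof -
    have "dg ?Q a \<le> card {z}" unfolding Qe by (intro card_mono) auto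
    then show ?thesis using n_ge_4 by simp
  qed
  have 4: "dg (?Q\<inverse>) b + card {x} + 2 \<le> card A" for b
  proof -
    have "dg (?Q\<inverse>) b \<le> card (R1 `` {x'} - {x})" using s1(3) by (intro card_mono) auto
    then show ?thesis using cN deg1_le[OF xA(2)] by simp
  qed
  have pre: "(x', y') \<notin> R3" "{x} \<subseteq> A" "{y} \<subseteq> B" "card {y} = card {x}" "y' \<notin> {y}"
    "{y} \<inter> R2 `` {y'} = {}" "R3 \<inter> {x} \<times> {y} = {}"
    "R3 \<inter> (- insert x' {x}) \<times> (- insert y' {y}) \<subseteq> ?Q" "?Q \<subseteq> (A - insert x' {x}) \<times> (B - insert y' {y})"
  proof -
    show "?Q \<subseteq> (A - insert x' {x}) \<times> (B - insert y' {y})" using s1(4,5) s2(4,5) by blast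
    show "{y} \<inter> R2 `` {y'} = {}" using N2 zy by auto
  qed (use R3e xA y in auto)
  have N': "R1 `` {l} = {x'}" if "l \<in> {x}" for l using that N by simp
  note red = reduce[OF xA(2) y(2) pre(1,2) N' pre(3-8) subset_refl pre(9) w 1 2 3 4]
  show "dg R2 y = 2" using red(3) E1 E2 cQ weight y(6) red(2) by simp
  have "card (R1 `` {x'} - {x}) = 0" using red(2) unfolding Qe by (metis Times_empty card.empty insert_not_empty)
  then have "dg R1 x' = 1" using cN by linarith
  then have N1': "R1 `` {x'} = {x}" using dg_1 xA(3) by metis
  have cc: "card (A - {x, x'}) = card (B - {y, y'})"
    using xA y t(4-6) by (simp add: card_Diff_subset)
  \<comment> \<open>\<open>x\<close> and \<open>x'\<close> form a whole component, so its removal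
    isolates nothing, while the clique side always has an isolated vertex.\<close>
  have "\<not> exceptional_on (A - {x, x'}) (B - {y, y'}) (del {x, x'} R1) (del {y, y'} R2)"
  proof
    assume E: "exceptional_on (A - {x, x'}) (B - {y, y'}) (del {x, x'} R1) (del {y, y'} R2)"
    obtain a where a: "a \<in> A - {x, x'}" "dg (del {x, x'} R1) a = 0"
      using exc_left[OF E _ _ cc] t(5,6) by (metis finite_Diff)
    have "a \<in> A" using a(1) by blast
    from no_isolated[OF this] obtain v where v: "(a, v) \<in> R1" by (rule dg_ge_1E)
    have va: "(v, a) \<in> R1" by (rule s1(6)[OF v])
    have "v \<noteq> x" "v \<noteq> x'" using va N N1' a(1) by auto
    then have "(a, v) \<in> del {x, x'} R1" using v a(1) by simp
    moreover have "finite (del {x, x'} R1)" using t(7) by (simp add: del_def)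
    ultimately show False using dg_ge_1[of "del {x, x'} R1" a v] a(2) by simp
  qed
  then show "exceptional_on (B - {y, y'}) (A - {x, x'}) (del {y, y'} R2) (del {x, x'} R1)"
    using red(1) unfolding eqs by blast
qed

text \<open>A vertex of maximum degree in \<open>R2\<close> paired with a non-adjacent leaf admits
  \<open>leaf_pair\<close>. If every such vertex is adjacent to every leaf, a non-neighbour of the
  maximum takes its place.\<close>

lemma contradiction_le:
  assumes le: "ecard R1 \<le> ecard R2"
  shows False
proof -
  have le2: "ecard R1 + 2 \<le> card A" using le weight by linarith
  have R3e: "R3 = {}" by (rule R3_empty) (use le2 in linarith)
  have "B \<noteq> {}" using n_ge_4 t(4) by auto
  then obtain y0 where y0: "y0 \<in> B" "\<And>b. b \<in> B \<Longrightarrow> dg R2 b \<le> dg R2 y0"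
    using max_dg[OF t(6), of R2] by blast
  have D2: "2 \<le> dg R2 y0"
  proof (rule ccontr)
    assume "\<not> ?thesis"
    then have "dg R2 w \<le> 1" if "w \<in> B" for w using y0(2)[OF that] by linarith
    then have "(\<Sum>w\<in>B. dg R2 w) \<le> card B" using sum_bounded_above[of B "dg R2" 1] by simp
    then show False using handshake[OF t(2)] weight_gt le R3e t(4) by simp
  qed
  have n5: "5 \<le> card A" using deg2_le[OF y0(1)] D2 by linarith
  obtain x x' where x: "(x, x') \<in> R1" "dg R1 x = 1" "\<And>a. a \<in> A \<Longrightarrow> dg (del {x, x'} R1) a + 4 \<le> card A"
    by (rule nice_leaf1[OF le2 n5], rule that)
  have pair: "dg R2 y = 2 \<and> exceptional_on (B - {y, y'}) (A - {x, x'}) (del {y, y'} R2) (del {x, x'} R1)"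
    if "y \<in> B" "y' \<in> B" "dg R2 y' = 1" "y \<noteq> y'" "(y, y') \<notin> R2" "2 \<le> dg R2 y"
      "\<And>b. b \<in> B \<Longrightarrow> b \<noteq> y \<Longrightarrow> b \<noteq> y' \<Longrightarrow> dg (del {y, y'} R2) b + 4 \<le> card A" for y y'
    by (rule conjI; rule leaf_pair[OF R3e x(1,2) x(3) that(1-6) that(7)])
  obtain y' where y': "y' \<in> B" "dg R2 y' = 1" using exists_leaf2[OF le R3e] by blast
  have xA: "x \<in> A" "x' \<in> A" "x \<noteq> x'" using s1(7-9)[OF x(1)] by auto
  have cc: "card (B - {b, b'}) = card (A - {x, x'})" if "b \<in> B" "b' \<in> B" "b \<noteq> b'" for b b'
    using that xA t(4-6) by (simp add: card_Diff_subset)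
  have max: "dg R2 y = 2 \<and> exceptional_on (B - {y, l}) (A - {x, x'}) (del {y, l} R2) (del {x, x'} R1)"
    if y: "y \<in> B" "dg R2 y = dg R2 y0" and l: "l \<in> B" "dg R2 l = 1" "(y, l) \<notin> R2" for y l
  proof -
    have yl: "y \<noteq> l" using y l D2 by auto
    \<comment> \<open>A violating \<open>b\<close> has degree n - 3, hence so has \<open>y\<close>,
      and both are adjacent to every vertex but \<open>b\<close>, \<open>y\<close>,
      \<open>l\<close>. This costs \<open>R2\<close> too many edges.\<close>
    have d: "dg (del {y, l} R2) b + 4 \<le> card A" if b: "b \<in> B" "b \<noteq> y" "b \<noteq> l" for b
    proof (rule ccontr)
      assume "\<not> ?thesis"
      then have c: "card A \<le> dg (del {y, l} R2) b + 3" by simp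
      have "(b, s) \<notin> R2" if "s \<in> {y, l}" for s
        using dg_del_less[OF t(8), of b s "{y, l}"] that c deg2_le[OF b(1)] by linarith
      then have bn: "(b, y) \<notin> R2" "(b, l) \<notin> R2" by auto
      have db: "dg R2 b + 3 = card A"
        using c dg_del_le[OF t(8), of "{y, l}" b] deg2_le[OF b(1)] by linarith
      have dy: "dg R2 y + 3 = card A" using db y0(2)[OF b(1)] y(2) deg2_le[OF y(1)] by linarith
      let ?T = "B - {b, y, l}"
      have cS: "card {b, y, l} = 3" using b yl by simp
      have cT: "card ?T = card B - 3" using cS b(1) y(1) l(1) by (simp add: card_Diff_subset)
      have "R2 `` {b} \<subseteq> ?T" using s2(4,5) bn by blast
      then have Nb: "R2 `` {b} = ?T" using cT db t(4,6) by (intro card_subset_eq) auto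
      have "R2 `` {y} \<subseteq> ?T" using s2(4,5) l(3) bn(1) s2(6)[of y b] by blast
      then have Ny: "R2 `` {y} = ?T" using cT dy t(4,6) by (intro card_subset_eq) auto
      obtain z where Nl: "R2 `` {l} = {z}" using l(2) by (rule card_1_singletonE)
      have lz: "(l, z) \<in> R2" using Nl by blast
      have "z \<noteq> b" "z \<noteq> y" using s2(6)[OF lz] bn l(3) by auto
      then have zT: "z \<in> ?T" using s2(8,9)[OF lz] by auto
      have adj: "{b, y} \<subseteq> R2 `` {v}" if "v \<in> ?T" for v
        using that Nb Ny s2(6)[of b v] s2(6)[of y v] by blast
      have "{b, y, l} \<subseteq> R2 `` {z}" using adj[OF zT] s2(6)[OF lz] by blast
      then have "3 \<le> dg R2 z" using card_mono[OF s2(3)] cS by metis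
      then have n6: "6 \<le> card A" using y0(2)[of z] zT y(2) dy by auto
      have "(\<Sum>v\<in>{b, y, l}. dg R2 v) + 2 * (card B - card {b, y, l}) \<le> 2 * ecard R2"
      proof (rule degree_sum_ge[OF t(2)])
        show "{b, y, l} \<subseteq> B" using b y l by blast
        fix v assume "v \<in> B - {b, y, l}"
        then have "card {b, y} \<le> dg R2 v" using adj s2(3) by (intro card_mono) auto
        then show "2 \<le> dg R2 v" using b(2) by simp
      qed
      moreover have "(\<Sum>v\<in>{b, y, l}. dg R2 v) = dg R2 b + dg R2 y + 1" using b yl l(2) by simp
      ultimately show False using db dy cS n6 weight two_ecard_ge(1) t(4) by linarith
    qed
    have "2 \<le> dg R2 y" using y(2) D2 by simp
    then show ?thesis by (rule pair[OF y(1) l(1,2) yl l(3) _ d])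
  qed
  show False
  proof (cases "\<exists>y\<in>B. \<exists>l\<in>B. dg R2 y = dg R2 y0 \<and> dg R2 l = 1 \<and> (y, l) \<notin> R2")
    case True
    then obtain y l where y: "y \<in> B" "dg R2 y = dg R2 y0" and l: "l \<in> B" "dg R2 l = 1" "(y, l) \<notin> R2" by blast
    have yl: "y \<noteq> l" using y l D2 by auto
    have d2: "dg R2 y0 = 2" and E: "exceptional_on (B - {y, l}) (A - {x, x'}) (del {y, l} R2) (del {x, x'} R1)"
      using max[OF y l] y(2) by auto
    obtain C where C: "C \<subseteq> B - {y, l}" "3 \<le> card C" "del {y, l} R2 = clique C"
      using exc_left[OF E _ _ cc[OF y(1) l(1) yl]] t(5,6) by (metis finite_Diff)
    have fC: "finite C" using C(1) t(6) by (meson finite_Diff finite_subset)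
    have NC: "R2 `` {c} = C - {c} \<and> dg R2 c = 2" if c: "c \<in> C" for c
    proof -
      have "(c, v) \<in> del {y, l} R2" if "v \<in> C - {c}" for v unfolding C(3) using that c by auto
      then have sub: "C - {c} \<subseteq> R2 `` {c}" by auto
      have "c \<in> B" using c C(1) by blast
      then have "dg R2 c \<le> 2" using y0(2) d2 by metis
      moreover have "2 \<le> card (C - {c})" using C(2) c fC by simp
      ultimately have le: "dg R2 c \<le> card (C - {c})" by linarith
      have "C - {c} = R2 `` {c}" by (rule card_seteq[OF s2(3) sub le])
      moreover have "dg R2 c = 2" using \<open>dg R2 c \<le> 2\<close> card_mono[OF s2(3) sub] \<open>2 \<le> card (C - {c})\<close> by linarith
      ultimately show ?thesis by simp
    qed
    obtain c where c: "c \<in> C" using C(2) by fastforce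
    have cB: "c \<in> B" "l \<notin> C" using c C(1) by auto
    have "(c, l) \<notin> R2" using NC[OF c] cB(2) by blast
    \<comment> \<open>A clique vertex \<open>c\<close> also has maximum degree, so it may replace
      \<open>y\<close>; another clique vertex \<open>u\<close> then keeps degree exactly 1,
      impossible on the clique side.\<close>
    then have E': "exceptional_on (B - {c, l}) (A - {x, x'}) (del {c, l} R2) (del {x, x'} R1)"
      using max[OF cB(1) _ l(1,2)] NC[OF c] d2 by metis
    obtain u where u: "u \<in> C" "u \<notin> {c}" using exists_not_in[of "{c}" C] C(2) by auto
    have "card {c, u} < card C" using C(2) u by simp
    then obtain v where v: "v \<in> C" "v \<notin> {c, u}" using exists_not_in[of "{c, u}" C] by auto
    have R: "(u, c) \<in> R2" "(u, v) \<in> R2" using NC[OF u(1)] c u v by auto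
    then have "(u, v) \<in> del {c, l} R2" using u v cB(2) by auto
    moreover have "finite (del {c, l} R2)" using t(8) by (simp add: del_def)
    ultimately have "1 \<le> dg (del {c, l} R2) u" using dg_ge_1 by metis
    moreover have "dg (del {c, l} R2) u < 2" using dg_del_less[OF t(8) R(1), of "{c, l}"] NC[OF u(1)] by (metis insertI1)
    ultimately show False using exc_left_dg[OF E', of u] by linarith
  next
    case False
    then have adj: "(y, l) \<in> R2" if "y \<in> B" "l \<in> B" "dg R2 y = dg R2 y0" "dg R2 l = 1" for y l
      using that by blast
    have yy': "(y0, y') \<in> R2" by (rule adj[OF y0(1) y'(1) refl y'(2)])
    have Ny': "R2 `` {y'} = {y0}" using dg_1[OF y'(2) s2(6)[OF yy']] .
    obtain y2 where y2: "y2 \<in> B" "y2 \<noteq> y0" "(y0, y2) \<notin> R2"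
      using exists_nonneighbour[OF t(2) y0(1)] deg2[OF y0(1)] t(4) by auto
    have "dg R2 y2 \<noteq> 1" using adj[OF y0(1) y2(1) refl] y2(3) by blast
    then have d2: "2 \<le> dg R2 y2" using no_isolated'[OF y2(1)] by linarith
    have ne: "y2 \<noteq> y'" using yy' y2(3) by blast
    have y2y': "(y2, y') \<notin> R2" using Ny' s2(6)[of y2 y'] y2(2) by blast
    have d: "dg (del {y2, y'} R2) b + 4 \<le> card A" if b: "b \<in> B" for b
    proof (rule ccontr)
      assume "\<not> ?thesis"
      then have c: "card A \<le> dg (del {y2, y'} R2) b + 3" by simp
      have db: "dg R2 b + 3 = card A" "dg (del {y2, y'} R2) b = dg R2 b"
        using c dg_del_le[OF t(8), of "{y2, y'}" b] deg2_le[OF b] by linarith+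
      then have "dg R2 b = dg R2 y0" using y0(2)[OF b] deg2_le[OF y0(1)] by linarith
      then have "(b, y') \<in> R2" using adj[OF b y'(1) _ y'(2)] by blast
      then show False using dg_del_less[OF t(8), of b y' "{y2, y'}"] db(2) by simp
    qed
    have E: "exceptional_on (B - {y2, y'}) (A - {x, x'}) (del {y2, y'} R2) (del {x, x'} R1)"
      using pair[OF y2(1) y'(1,2) ne y2y' d2] d by blast
    \<comment> \<open>This \<open>u\<close> can only be a leaf attached to \<open>y2\<close>, but
      every leaf is adjacent to \<open>y0\<close>.\<close>
    obtain u where u: "u \<in> B - {y2, y'}" "dg (del {y2, y'} R2) u = 0"
      using exc_left[OF E _ _ cc[OF y2(1) y'(1) ne]] t(5,6) by (metis finite_Diff)
    have fd: "finite (del {y2, y'} R2)" using t(8) by (simp add: del_def)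
    have Nu: "v = y2 \<or> v = y'" if "(u, v) \<in> R2" for v
    proof (rule ccontr)
      assume "\<not> ?thesis"
      then have "(u, v) \<in> del {y2, y'} R2" using that u(1) by simp
      then show False using dg_ge_1[OF fd] u(2) by fastforce
    qed
    have "card {y'} < dg R2 y0" using D2 by simp
    then obtain v0 where v0: "v0 \<in> R2 `` {y0}" "v0 \<notin> {y'}" using exists_not_in[of "{y'}"] by blast
    have uy0: "u \<noteq> y0"
    proof
      assume "u = y0"
      then have "(u, v0) \<in> R2" using v0(1) by simp
      then have "v0 = y2" using Nu v0(2) by blast
      then show False using v0(1) y2(3) by blast
    qed
    have "(u, y') \<notin> R2" using Ny' s2(6)[of u y'] uy0 by blast
    then have sub: "R2 `` {u} \<subseteq> {y2}" using Nu by blast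
    have uB: "u \<in> B" using u(1) by blast
    have "dg R2 u \<le> 1" using card_mono[OF _ sub] by simp
    then have "dg R2 u = 1" using no_isolated'[OF uB] by linarith
    then have "(y0, u) \<in> R2" using adj[OF y0(1) uB refl] by blast
    then have "y0 \<in> R2 `` {u}" using s2(6) by blast
    then show False using sub y2(2) by blast
  qed
qed

lemma contradiction: False
proof (cases "ecard R1 \<le> ecard R2")
  case True
  then show ?thesis by (rule contradiction_le)
next
  case False
  then show ?thesis using min_counterexample.contradiction_le[OF swap] by simp
qed

end

theorem admissible_imp_packs_on:
  fixes A B :: "'a set"
  assumes "admissible A B R1 R2 R3"
  shows "packs_on A B R1 R2 R3"
  using assms
proof (induction "card A" arbitrary: A B R1 R2 R3 rule: less_induct)
  case less
  show ?case
  proof (rule ccontr)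
    assume "\<not> ?case"
    then have "min_counterexample A B R1 R2 R3"
      by unfold_locales (use less in blast)+
    then show False by (rule min_counterexample.contradiction)
  qed
qed

section \<open>Transfer to graphs as edge sets\<close>

definition graph_rel :: "'a graph \<Rightarrow> 'a rel" where
  "graph_rel G = {(u, v). {u, v} \<in> edges G}"

lemma in_graph_rel [simp]: "(u, v) \<in> graph_rel G \<longleftrightarrow> {u, v} \<in> edges G"
  by (simp add: graph_rel_def)

lemma simple_graph_edge:
  assumes "simple_graph G" "{u, v} \<in> edges G"
  shows "u \<in> verts G" "v \<in> verts G" "u \<noteq> v"
proof -
  have *: "{u, v} \<subseteq> verts G" "card {u, v} = 2" using assms unfolding simple_graph_def by blast+
  then show "u \<in> verts G" "v \<in> verts G" "u \<noteq> v" by auto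
qed

lemma simple_on_graph_rel:
  assumes "simple_graph G"
  shows "simple_on (verts G) (graph_rel G)"
  unfolding simple_on_def
proof (intro conjI)
  show "finite (verts G)" using assms by (simp add: simple_graph_def)
  show "graph_rel G \<subseteq> verts G \<times> verts G" using simple_graph_edge(1,2)[OF assms] by (intro subrelI) auto
  show "sym (graph_rel G)" by (simp add: sym_def insert_commute)
  show "irrefl (graph_rel G)" unfolding irrefl_def in_graph_rel using simple_graph_edge(3)[OF assms] by blast
qed

lemma simple_graph_edgeE:
  assumes "simple_graph G" "e \<in> edges G"
  obtains u v where "e = {u, v}"
proof -
  have "card e = 2" using assms by (simp add: simple_graph_def)
  then show ?thesis using that by (auto simp: card_2_iff)
qed

lemma ecard_graph_rel:
  assumes "simple_graph G"
  shows "ecard (graph_rel G) = card (edges G)"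
proof -
  have "(\<lambda>(u, v). {u, v}) ` graph_rel G = edges G"
  proof
    show "(\<lambda>(u, v). {u, v}) ` graph_rel G \<subseteq> edges G" by auto
    show "edges G \<subseteq> (\<lambda>(u, v). {u, v}) ` graph_rel G"
    proof
      fix e assume e: "e \<in> edges G"
      obtain u v where "e = {u, v}" by (rule simple_graph_edgeE[OF assms e])
      then show "e \<in> (\<lambda>(u, v). {u, v}) ` graph_rel G" using e by (intro image_eqI[of _ _ "(u, v)"]) simp_all
    qed
  qed
  then show ?thesis by (simp add: ecard_def)
qed

lemma card_edges_at:
  assumes "\<And>e. e \<in> edges G \<Longrightarrow> v \<in> e \<Longrightarrow> \<exists>w. e = {v, w} \<and> w \<in> N" "\<And>w. w \<in> N \<Longrightarrow> {v, w} \<in> edges G"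
  shows "degree G v = card N"
proof -
  have "{e \<in> edges G. v \<in> e} = (\<lambda>w. {v, w}) ` N"
    using assms by (intro equalityI subsetI) (blast, auto)
  moreover have "inj_on (\<lambda>w. {v, w}) N" by (auto simp: inj_on_def doubleton_eq_iff)
  ultimately show ?thesis by (simp add: degree_def card_image)
qed

lemma degree_graph_rel:
  assumes "simple_graph G"
  shows "degree G v = dg (graph_rel G) v"
proof (rule card_edges_at)
  fix e assume e: "e \<in> edges G" "v \<in> e"
  obtain a b where "e = {a, b}" by (rule simple_graph_edgeE[OF assms e(1)])
  then show "\<exists>w. e = {v, w} \<and> w \<in> graph_rel G `` {v}" using e by (auto simp: insert_commute)
qed simp

lemma degree_le_max:
  assumes "simple_graph G" "v \<in> verts G"
  shows "degree G v \<le> max_degree G"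
  using assms by (simp add: max_degree_def simple_graph_def)

text \<open>The isomorphism type of the part induced on \<open>V\<close>, with \<open>R\<close>
  itself not cut down to \<open>V\<close>; so one relation can be identified piece by piece and the
  pieces glued.\<close>

definition riso :: "'a set \<Rightarrow> 'a rel \<Rightarrow> 'b graph \<Rightarrow> bool" where
  "riso V R H \<longleftrightarrow> (\<exists>f. bij_betw f V (verts H) \<and> (\<forall>u\<in>V. \<forall>v\<in>V. (u, v) \<in> R \<longleftrightarrow> {f u, f v} \<in> edges H))"

lemma riso_graph_iso: "riso (verts G) (graph_rel G) H \<Longrightarrow> G \<cong> H"
  by (simp add: riso_def graph_iso_def)

lemma riso_complete:
  assumes "finite V" "card V = m" "\<And>u v. u \<in> V \<Longrightarrow> v \<in> V \<Longrightarrow> (u, v) \<in> R \<longleftrightarrow> u \<noteq> v"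
  shows "riso V R (K\<^bsub>m\<^esub>)"
proof -
  obtain f where f: "bij_betw f V {..<m}"
    using finite_same_card_bij[OF assms(1), of "{..<m}"] assms(2) by auto
  have "(u, v) \<in> R \<longleftrightarrow> {f u, f v} \<in> edges (K\<^bsub>m\<^esub>)" if "u \<in> V" "v \<in> V" for u v
  proof -
    have "f u \<in> {..<m}" "f v \<in> {..<m}" using bij_betwE[OF f] that by blast+
    moreover have "f u = f v \<longleftrightarrow> u = v" using bij_betw_imp_inj_on[OF f] that by (auto simp: inj_on_def)
    ultimately show ?thesis using assms(3)[OF that] by (auto simp: complete_graph_def card_insert_if)
  qed
  then show ?thesis using f unfolding riso_def by (auto simp: complete_graph_def)
qed

lemma riso_edgeless:
  assumes "finite V" "card V = m" "\<And>u v. u \<in> V \<Longrightarrow> v \<in> V \<Longrightarrow> (u, v) \<notin> R"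
  shows "riso V R (K\<^sup>c\<^bsub>m\<^esub>)"
proof -
  obtain f where "bij_betw f V {..<m}"
    using finite_same_card_bij[OF assms(1), of "{..<m}"] assms(2) by auto
  then show ?thesis using assms(3) unfolding riso_def by (auto simp: edgeless_graph_def)
qed

lemma riso_union:
  fixes H :: "'b graph" and H' :: "'c graph"
  assumes "riso V R H" "riso W R H'" "V \<inter> W = {}"
    "\<And>v w. v \<in> V \<Longrightarrow> w \<in> W \<Longrightarrow> (v, w) \<notin> R \<and> (w, v) \<notin> R"
  shows "riso (V \<union> W) R (H \<uplus> H')"
proof -
  obtain f g where f: "bij_betw f V (verts H)" "\<forall>u\<in>V. \<forall>v\<in>V. (u, v) \<in> R \<longleftrightarrow> {f u, f v} \<in> edges H"
    and g: "bij_betw g W (verts H')" "\<forall>u\<in>W. \<forall>v\<in>W. (u, v) \<in> R \<longleftrightarrow> {g u, g v} \<in> edges H'"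
    using assms(1,2) unfolding riso_def by blast
  let ?h = "\<lambda>v. if v \<in> V then Inl (f v) else Inr (g v)"
  have "bij_betw (Inl \<circ> f) V (Inl ` verts H)"
    using f(1) by (rule bij_betw_trans) (simp add: bij_betw_def inj_on_def)
  then have "bij_betw ?h V (Inl ` verts H)" by (rule bij_betw_cong[THEN iffD1, rotated]) simp
  moreover have "bij_betw (Inr \<circ> g) W (Inr ` verts H')"
    using g(1) by (rule bij_betw_trans) (simp add: bij_betw_def inj_on_def)
  then have "bij_betw ?h W (Inr ` verts H')"
    by (rule bij_betw_cong[THEN iffD1, rotated]) (use assms(3) in auto)
  ultimately have b: "bij_betw ?h (V \<union> W) (verts (H \<uplus> H'))"
    unfolding graph_union_def fst_conv by (rule bij_betw_combine) auto
  have E: "e \<in> edges (H \<uplus> H') \<longleftrightarrow> e \<in> image Inl ` edges H \<or> e \<in> image Inr ` edges H'" for e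
    by (simp add: graph_union_def)
  have inj: "inj (image (Inl :: 'b \<Rightarrow> 'b + 'c))" "inj (image (Inr :: 'c \<Rightarrow> 'b + 'c))"
    by (simp_all add: inj_def inj_image_eq_iff)
  have ne: "e \<notin> image Inl ` X" if "Inr b \<in> e" for e :: "('b + 'c) set" and b X using that by blast
  have ne': "e \<notin> image Inr ` X" if "Inl a \<in> e" for e :: "('b + 'c) set" and a X using that by blast
  have l: "{Inl a, Inl b} \<in> edges (H \<uplus> H') \<longleftrightarrow> {a, b} \<in> edges H" for a b
    using inj_image_mem_iff[OF inj(1), of "{a, b}" "edges H"] ne'[of a "{Inl a, Inl b}"]
    unfolding E by simp
  have r: "{Inr a, Inr b} \<in> edges (H \<uplus> H') \<longleftrightarrow> {a, b} \<in> edges H'" for a b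
    using inj_image_mem_iff[OF inj(2), of "{a, b}" "edges H'"] ne[of a "{Inr a, Inr b}"]
    unfolding E by simp
  have lr: "{Inl a, Inr b} \<notin> edges (H \<uplus> H')" for a b
    using ne[of b "{Inl a, Inr b}"] ne'[of a "{Inl a, Inr b}"] unfolding E by simp
  have "(u, v) \<in> R \<longleftrightarrow> {?h u, ?h v} \<in> edges (H \<uplus> H')" if uv: "u \<in> V \<union> W" "v \<in> V \<union> W" for u v
  proof -
    consider "u \<in> V" "v \<in> V" | "u \<in> V" "v \<in> W" | "u \<in> W" "v \<in> V" | "u \<in> W" "v \<in> W" using uv by blast
    then show ?thesis
    proof cases
      case 1
      then show ?thesis using f(2) l by simp
    next
      case 2
      then have "v \<notin> V" using assms(3) by blast
      then show ?thesis using 2 assms(4)[OF 2] lr by simp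
    next
      case 3
      then have "u \<notin> V" using assms(3) by blast
      then show ?thesis using 3 assms(4)[OF 3(2,1)] lr by (simp add: insert_commute)
    next
      case 4
      then have "u \<notin> V" "v \<notin> V" using assms(3) by blast+
      then show ?thesis using 4 g(2) r by simp
    qed
  qed
  then show ?thesis unfolding riso_def using b by blast
qed

lemma riso_copies:
  fixes H :: "'b graph"
  assumes V: "\<And>i. i < m \<Longrightarrow> riso (V i) R H"
    and dis: "\<And>i j. i < m \<Longrightarrow> j < m \<Longrightarrow> i \<noteq> j \<Longrightarrow> V i \<inter> V j = {}"
    and cross: "\<And>i j u v. i < m \<Longrightarrow> j < m \<Longrightarrow> i \<noteq> j \<Longrightarrow> u \<in> V i \<Longrightarrow> v \<in> V j \<Longrightarrow> (u, v) \<notin> R"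
  shows "riso (\<Union>i<m. V i) R (m \<odot> H)"
proof -
  have "\<forall>i\<in>{..<m}. \<exists>f. bij_betw f (V i) (verts H) \<and> (\<forall>u\<in>V i. \<forall>v\<in>V i. (u, v) \<in> R \<longleftrightarrow> {f u, f v} \<in> edges H)"
    using V unfolding riso_def by simp
  then obtain f where f: "\<And>i. i < m \<Longrightarrow> bij_betw (f i) (V i) (verts H)"
    "\<And>i u v. i < m \<Longrightarrow> u \<in> V i \<Longrightarrow> v \<in> V i \<Longrightarrow> (u, v) \<in> R \<longleftrightarrow> {f i u, f i v} \<in> edges H"
    by (metis bchoice lessThan_iff)
  \<comment> \<open>The number of the part containing \<open>u\<close>, unique since the parts are
    disjoint; it becomes the copy index.\<close>
  define ix where "ix u = (THE i. i < m \<and> u \<in> V i)" for u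
  have ix: "ix u = i" if "i < m" "u \<in> V i" for u i
    unfolding ix_def using that dis by (intro the_equality) blast+
  let ?h = "\<lambda>u. (ix u, f (ix u) u)"
  have h: "?h u = (i, f i u)" if "i < m" "u \<in> V i" for u i using ix[OF that] by simp
  have b: "bij_betw ?h (\<Union>i<m. V i) (verts (m \<odot> H))"
    unfolding bij_betw_def
  proof
    show "inj_on ?h (\<Union>i<m. V i)"
    proof (rule inj_onI)
      fix u v assume u: "u \<in> (\<Union>i<m. V i)" and v: "v \<in> (\<Union>i<m. V i)" and e: "?h u = ?h v"
      obtain i where i: "i < m" "u \<in> V i" using u by auto
      obtain j where j: "j < m" "v \<in> V j" using v by auto
      have "i = j" "f i u = f i v" using e h[OF i] h[OF j] by auto
      then show "u = v" using bij_betw_imp_inj_on[OF f(1)[OF i(1)]] i j by (auto simp: inj_on_def)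
    qed
    show "?h ` (\<Union>i<m. V i) = verts (m \<odot> H)"
    proof (intro equalityI subsetI)
      fix z assume "z \<in> ?h ` (\<Union>i<m. V i)"
      then obtain u where "u \<in> (\<Union>i<m. V i)" and z: "z = ?h u" by blast
      then obtain i where i: "i < m" "u \<in> V i" by auto
      then have "z = (i, f i u)" "f i u \<in> verts H" using z h[OF i] bij_betwE[OF f(1)[OF i(1)]] by auto
      then show "z \<in> verts (m \<odot> H)" using i by (simp add: copies_def)
    next
      fix z assume "z \<in> verts (m \<odot> H)"
      then obtain i a where z: "z = (i, a)" "i < m" "a \<in> verts H" by (auto simp: copies_def)
      then obtain u where u: "u \<in> V i" "a = f i u" using bij_betw_imp_surj_on[OF f(1)[OF z(2)]] by blast
      then have "z = ?h u" using z h[OF z(2) u(1)] by simp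
      then show "z \<in> ?h ` (\<Union>i<m. V i)" using u z(2) by blast
    qed
  qed
  have e: "{(i, a), (j, b)} \<in> edges (m \<odot> H) \<longleftrightarrow> i = j \<and> {a, b} \<in> edges H" if "i < m" "j < m" for i j a b
  proof
    assume "{(i, a), (j, b)} \<in> edges (m \<odot> H)"
    then obtain k e where k: "{(i, a), (j, b)} = Pair k ` e" "e \<in> edges H" by (auto simp: copies_def)
    have "(i, a) \<in> Pair k ` e" "(j, b) \<in> Pair k ` e" using k(1) by blast+
    then have ij: "i = k" "j = k" by auto
    then have "Pair k ` {a, b} = Pair k ` e" using k(1) by simp
    then have "{a, b} = e" by (subst (asm) inj_image_eq_iff) (auto simp: inj_on_def)
    then show "i = j \<and> {a, b} \<in> edges H" using ij k(2) by simp
  next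
    assume "i = j \<and> {a, b} \<in> edges H"
    then have "{(i, a), (j, b)} = Pair i ` {a, b}" "{a, b} \<in> edges H" by auto
    then show "{(i, a), (j, b)} \<in> edges (m \<odot> H)" using that unfolding copies_def snd_conv by blast
  qed
  have "(u, v) \<in> R \<longleftrightarrow> {?h u, ?h v} \<in> edges (m \<odot> H)"
    if u: "u \<in> (\<Union>i<m. V i)" and v: "v \<in> (\<Union>i<m. V i)" for u v
  proof -
    obtain i where i: "i < m" "u \<in> V i" using u by auto
    obtain j where j: "j < m" "v \<in> V j" using v by auto
    have "{?h u, ?h v} \<in> edges (m \<odot> H) \<longleftrightarrow> i = j \<and> {f i u, f j v} \<in> edges H"
      unfolding h[OF i] h[OF j] by (rule e[OF i(1) j(1)])
    also have "\<dots> \<longleftrightarrow> (u, v) \<in> R"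
    proof (cases "i = j")
      case True
      then show ?thesis using f(2)[OF i] j by simp
    next
      case False
      then show ?thesis using cross[OF i(1) j(1) False i(2) j(2)] by simp
    qed
    finally show ?thesis by simp
  qed
  then show ?thesis unfolding riso_def using b by blast
qed

lemma riso_cliques:
  assumes T: "finite T" "card T = m" "\<And>p. p \<in> T \<Longrightarrow> finite p \<and> card p = k"
    and dis: "\<And>p q. p \<in> T \<Longrightarrow> q \<in> T \<Longrightarrow> p \<noteq> q \<Longrightarrow> p \<inter> q = {}"
    and R: "\<And>p u v. p \<in> T \<Longrightarrow> u \<in> p \<Longrightarrow> (u, v) \<in> R \<longleftrightarrow> v \<in> p \<and> u \<noteq> v"
  shows "riso (\<Union>T) R (m \<odot> K\<^bsub>k\<^esub>)"
proof -
  obtain h where h: "bij_betw h {..<m} T"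
    using finite_same_card_bij[of "{..<m}" T] T(1,2) by auto
  have hT: "h i \<in> T" if "i < m" for i using bij_betwE[OF h] that by simp
  have hne: "h i \<noteq> h j" if "i < m" "j < m" "i \<noteq> j" for i j
    using bij_betw_imp_inj_on[OF h] that by (auto simp: inj_on_def)
  have hd: "h i \<inter> h j = {}" if "i < m" "j < m" "i \<noteq> j" for i j
    by (rule dis[OF hT[OF that(1)] hT[OF that(2)] hne[OF that]])
  have "riso (\<Union>i<m. h i) R (m \<odot> K\<^bsub>k\<^esub>)"
  proof (rule riso_copies)
    fix i assume i: "i < m"
    show "riso (h i) R (K\<^bsub>k\<^esub>)"
      by (rule riso_complete) (use T(3)[OF hT[OF i]] R[OF hT[OF i]] in auto)
  next
    fix i j u v assume "i < m" "j < m" "i \<noteq> j" "u \<in> h i" "v \<in> h j"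
    then show "(u, v) \<notin> R" using hd[of i j] R[OF hT[of i], of u v] by blast
  qed (rule hd)
  moreover have "(\<Union>i<m. h i) = \<Union>T" using bij_betw_imp_surj_on[OF h] by blast
  ultimately show ?thesis by simp
qed

text \<open>Let t and s count the parts of sizes 2 and 3. Then t + s + 1 = |C| with |C| in {3, 4}
  has seven solutions, one for each listed pair, and the number of isolated vertices is 2 t + 3 s -
  |C|.\<close>

lemma exc_exceptional:
  assumes G: "simple_graph G1" "simple_graph G2" "card (verts G1) = card (verts G2)"
    and E: "exceptional_on (verts G1) (verts G2) (graph_rel G1) (graph_rel G2)"
  shows "exceptional_pair G1 G2"
proof -
  let ?A = "verts G1" and ?B = "verts G2" and ?R1 = "graph_rel G1" and ?R2 = "graph_rel G2"
  obtain C P where C: "C \<subseteq> ?A" "card C = 3 \<or> card C = 4" "?R1 = clique C"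
    and P: "partition_on ?B P" "card P + 1 = card C" "\<forall>p\<in>P. card p = 2 \<or> card p = 3"
      "?R2 = (\<Union>p\<in>P. clique p)"
    by (rule excE[OF E], rule that)
  have fin: "finite ?A" "finite ?B" using G by (simp_all add: simple_graph_def)
  have fC: "finite C" using C(1) fin(1) finite_subset by blast
  have un: "\<Union>P = ?B" using partition_onD1[OF P(1)] by simp
  have fP: "finite P" using fin(2) un finite_UnionD by metis
  have fp: "finite p" if "p \<in> P" for p using un that fin(2) by (metis Union_upper finite_subset)
  have dis: "p \<inter> q = {}" if "p \<in> P" "q \<in> P" "p \<noteq> q" for p q
    using partition_onD2[OF P(1)] that by (auto simp: disjoint_def)
  have R: "(u, v) \<in> ?R2 \<longleftrightarrow> v \<in> p \<and> u \<noteq> v" if "p \<in> P" "u \<in> p" for p u v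
  proof -
    have "?R2 `` {u} = p - {u}" unfolding P(4) by (rule partition_clique_Image[OF P(1) that])
    then show ?thesis by blast
  qed
  define T S where "T = {p \<in> P. card p = 2}" and "S = {p \<in> P. card p = 3}"
  have TS: "T \<union> S = P" "T \<inter> S = {}" "T \<subseteq> P" "S \<subseteq> P" using P(3) by (auto simp: T_def S_def)
  have fTS: "finite T" "finite S" using TS(3,4) fP finite_subset by blast+
  have cP: "card P = card T + card S" using card_Un_disjoint[OF fTS TS(2)] TS(1) by simp
  have cB: "card ?B = 2 * card T + 3 * card S"
  proof -
    have "card ?B = (\<Sum>p\<in>P. card p)"
      unfolding un[symmetric] using dis fp by (intro card_Union_disjoint) (auto simp: pairwise_def disjnt_def)
    also have "\<dots> = (\<Sum>p\<in>T. card p) + (\<Sum>p\<in>S. card p)"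
      using sum.union_disjoint[OF fTS TS(2), of card] TS(1) by simp
    also have "\<dots> = 2 * card T + 3 * card S" by (simp add: T_def S_def)
    finally show ?thesis .
  qed
  have T: "riso (\<Union>T) ?R2 (card T \<odot> K\<^bsub>2\<^esub>)"
    by (rule riso_cliques[OF fTS(1) refl]) (use TS(3) fp dis R in \<open>auto simp: T_def\<close>)
  have S: "riso (\<Union>S) ?R2 (card S \<odot> K\<^bsub>3\<^esub>)"
    by (rule riso_cliques[OF fTS(2) refl]) (use TS(4) fp dis R in \<open>auto simp: S_def\<close>)
  \<comment> \<open>The listed pairs name a single clique directly and not as one copy of it, so a
    single part is treated separately.\<close>
  have T1: "riso (\<Union>T) ?R2 (K\<^bsub>2\<^esub>)" if t: "card T = 1"
  proof -
    obtain p where p: "T = {p}" using t by (rule card_1_singletonE)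
    then have pP: "p \<in> P" "card p = 2" by (auto simp: T_def)
    show ?thesis unfolding p by (rule riso_complete) (use pP fp R[OF pP(1)] in auto)
  qed
  have S1: "riso (\<Union>S) ?R2 (K\<^bsub>3\<^esub>)" if s: "card S = 1"
  proof -
    obtain p where p: "S = {p}" using s by (rule card_1_singletonE)
    then have pP: "p \<in> P" "card p = 3" by (auto simp: S_def)
    show ?thesis unfolding p by (rule riso_complete) (use pP fp R[OF pP(1)] in auto)
  qed
  have BTS: "\<Union>T \<union> \<Union>S = ?B" using un TS(1) by blast
  have dTS: "\<Union>T \<inter> \<Union>S = {}" using dis TS by blast
  have cross: "(v, w) \<notin> ?R2 \<and> (w, v) \<notin> ?R2" if v: "v \<in> \<Union>T" and w: "w \<in> \<Union>S" for v w
  proof -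
    obtain p q where p: "p \<in> T" "v \<in> p" and q: "q \<in> S" "w \<in> q" using v w by blast
    then have pq: "p \<in> P" "q \<in> P" "p \<noteq> q" using TS by blast+
    then have "w \<notin> p" "v \<notin> q" using dis[OF pq] p q by blast+
    then show ?thesis using R[OF pq(1) p(2), of w] R[OF pq(2) q(2), of v] by blast
  qed
  have G2T: "G2 \<cong> card T \<odot> K\<^bsub>2\<^esub>" if "card S = 0"
    using T BTS that fTS(2) by (intro riso_graph_iso) simp
  have G2S: "G2 \<cong> card S \<odot> K\<^bsub>3\<^esub>" if "card T = 0"
    using S BTS that fTS(1) by (intro riso_graph_iso) simp
  have AC: "(?A - C) \<union> C = ?A" using C(1) by blast
  have cA: "card (?A - C) + card C = card ?A"
    using card_Diff_subset[OF fC C(1)] card_mono[OF fin(1) C(1)] by simp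
  have clq: "riso C ?R1 (K\<^bsub>card C\<^esub>)"
    unfolding C(3) by (rule riso_complete[OF fC refl]) simp
  have G1: "G1 \<cong> H \<uplus> K\<^bsub>card C\<^esub>" if "riso (?A - C) ?R1 H" for H :: "nat graph"
  proof (rule riso_graph_iso)
    have "riso ((?A - C) \<union> C) ?R1 (H \<uplus> K\<^bsub>card C\<^esub>)"
      by (rule riso_union[OF that clq]) (auto simp: C(3))
    then show "riso ?A ?R1 (H \<uplus> K\<^bsub>card C\<^esub>)" unfolding AC .
  qed
  have G1e: "G1 \<cong> K\<^sup>c\<^bsub>m\<^esub> \<uplus> K\<^bsub>card C\<^esub>" if "card (?A - C) = m" for m
    by (rule G1, rule riso_edgeless) (use that fin(1) in \<open>auto simp: C(3)\<close>)
  have G1k: "G1 \<cong> K\<^bsub>1\<^esub> \<uplus> K\<^bsub>card C\<^esub>" if one: "card (?A - C) = 1"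
  proof (rule G1, rule riso_complete[OF _ one])
    fix u v assume "u \<in> ?A - C" "v \<in> ?A - C"
    moreover obtain a where "?A - C = {a}" using one by (rule card_1_singletonE)
    ultimately show "(u, v) \<in> ?R1 \<longleftrightarrow> u \<noteq> v" unfolding C(3) by auto
  qed (use fin in simp)
  note num = cA cB cP P(2) G(3)
  consider "card T = 2" "card S = 0" "card C = 3" | "card T = 1" "card S = 1" "card C = 3"
    | "card T = 0" "card S = 2" "card C = 3"
    | "card T = 3" "card S = 0" "card C = 4" | "card T = 2" "card S = 1" "card C = 4"
    | "card T = 1" "card S = 2" "card C = 4" | "card T = 0" "card S = 3" "card C = 4"
  proof -
    have "card T + card S + 1 = card C" using cP P(2) by simp
    then have "card T = 2 \<and> card S = 0 \<and> card C = 3 \<or> card T = 1 \<and> card S = 1 \<and> card C = 3 \<or>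
        card T = 0 \<and> card S = 2 \<and> card C = 3 \<or> card T = 3 \<and> card S = 0 \<and> card C = 4 \<or>
        card T = 2 \<and> card S = 1 \<and> card C = 4 \<or> card T = 1 \<and> card S = 2 \<and> card C = 4 \<or>
        card T = 0 \<and> card S = 3 \<and> card C = 4"
      using C(2) by presburger
    then show ?thesis using that by blast
  qed
  then show ?thesis
  proof cases
    case 1
    then have "card (?A - C) = 1" using num by linarith
    then have "G1 \<cong> K\<^bsub>1\<^esub> \<uplus> K\<^bsub>3\<^esub>" "G2 \<cong> 2 \<odot> K\<^bsub>2\<^esub>" using G1k G2T 1 by simp_all
    then show ?thesis unfolding exceptional_pair_def iso_pair_def by blast
  next
    case 2
    then have "card (?A - C) = 2" using num by linarith
    then have "G1 \<cong> K\<^sup>c\<^bsub>2\<^esub> \<uplus> K\<^bsub>3\<^esub>" using G1e[of 2] 2 by simp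
    moreover have "G2 \<cong> K\<^bsub>2\<^esub> \<uplus> K\<^bsub>3\<^esub>"
      using riso_union[OF T1[OF 2(1)] S1[OF 2(2)] dTS cross] unfolding BTS by (rule riso_graph_iso)
    ultimately show ?thesis unfolding exceptional_pair_def iso_pair_def by blast
  next
    case 3
    then have "card (?A - C) = 3" using num by linarith
    then have "G1 \<cong> K\<^sup>c\<^bsub>3\<^esub> \<uplus> K\<^bsub>3\<^esub>" "G2 \<cong> 2 \<odot> K\<^bsub>3\<^esub>" using G1e[of 3] G2S 3 by simp_all
    then show ?thesis unfolding exceptional_pair_def iso_pair_def by blast
  next
    case 4
    then have "card (?A - C) = 2" using num by linarith
    then have "G1 \<cong> K\<^sup>c\<^bsub>2\<^esub> \<uplus> K\<^bsub>4\<^esub>" "G2 \<cong> 3 \<odot> K\<^bsub>2\<^esub>" using G1e[of 2] G2T 4 by simp_all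
    then show ?thesis unfolding exceptional_pair_def iso_pair_def by blast
  next
    case 5
    then have "card (?A - C) = 3" using num by linarith
    then have "G1 \<cong> K\<^sup>c\<^bsub>3\<^esub> \<uplus> K\<^bsub>4\<^esub>" using G1e[of 3] 5 by simp
    moreover have "G2 \<cong> 2 \<odot> K\<^bsub>2\<^esub> \<uplus> K\<^bsub>3\<^esub>"
      using riso_union[OF T S1[OF 5(2)] dTS cross] unfolding BTS 5(1) by (rule riso_graph_iso)
    ultimately show ?thesis unfolding exceptional_pair_def iso_pair_def by blast
  next
    case 6
    then have "card (?A - C) = 4" using num by linarith
    then have "G1 \<cong> K\<^sup>c\<^bsub>4\<^esub> \<uplus> K\<^bsub>4\<^esub>" using G1e[of 4] 6 by simp
    moreover have "G2 \<cong> K\<^bsub>2\<^esub> \<uplus> 2 \<odot> K\<^bsub>3\<^esub>"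
      using riso_union[OF T1[OF 6(1)] S dTS cross] unfolding BTS 6(2) by (rule riso_graph_iso)
    ultimately show ?thesis unfolding exceptional_pair_def iso_pair_def by blast
  next
    case 7
    then have "card (?A - C) = 5" using num by linarith
    then have "G1 \<cong> K\<^sup>c\<^bsub>5\<^esub> \<uplus> K\<^bsub>4\<^esub>" "G2 \<cong> 3 \<odot> K\<^bsub>3\<^esub>" using G1e[of 5] G2S 7 by simp_all
    then show ?thesis unfolding exceptional_pair_def iso_pair_def by blast
  qed
qed

lemma iso_pair_commute: "iso_pair G1 G2 H1 H2 \<longleftrightarrow> iso_pair G2 G1 H1 H2"
  unfolding iso_pair_def by blast

lemma exceptional_pair_sym: "exceptional_pair G1 G2 \<Longrightarrow> exceptional_pair G2 G1"
  by (simp only: exceptional_pair_def iso_pair_commute[of G1 G2])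

theorem theorem6:
  fixes n :: nat and G1 G2 G3 :: "'a graph"
  assumes "n \<ge> 1"
    and "graph_triple n G1 G2 G3"
    and "int (max_degree G1) \<le> int n - 2"
    and "int (max_degree G2) \<le> int n - 2"
    and "int (max_degree G3) \<le> int n - 1"
    and "int (card (edges G1) + card (edges G2) + card (edges G3)) \<le> 2 * int n - 3"
    and "\<not> exceptional_pair G1 G2"
  shows "packs G1 G2 G3"
proof -
  let ?A = "verts G1" and ?B = "verts G2"
  have g: "simple_graph G1" "simple_graph G2" "simple_graph G3" "card ?A = n" "card ?B = n" "?A \<inter> ?B = {}"
    "verts G3 = ?A \<union> ?B" "\<And>e. e \<in> edges G3 \<Longrightarrow> \<exists>u\<in>?A. \<exists>v\<in>?B. e = {u, v}"
    using assms(2) by (auto simp: graph_triple_def)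
  \<comment> \<open>Orienting each edge of \<open>G3\<close> from the first side to the second loses
    nothing, as the two sides are disjoint.\<close>
  define R3 where "R3 = {(u, v). u \<in> ?A \<and> v \<in> ?B \<and> {u, v} \<in> edges G3}"
  have "triple ?A ?B (graph_rel G1) (graph_rel G2) R3"
    unfolding triple_def using simple_on_graph_rel[OF g(1)] simple_on_graph_rel[OF g(2)] g(4,5)
    by (auto simp: R3_def)
  moreover have "card R3 = card (edges G3)"
  proof -
    have "inj_on (\<lambda>(u, v). {u, v}) R3"
      unfolding inj_on_def R3_def using g(6) by (auto simp: doubleton_eq_iff)
    moreover have "(\<lambda>(u, v). {u, v}) ` R3 = edges G3"
    proof
      show "(\<lambda>(u, v). {u, v}) ` R3 \<subseteq> edges G3" by (auto simp: R3_def)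
      show "edges G3 \<subseteq> (\<lambda>(u, v). {u, v}) ` R3"
      proof
        fix e assume e: "e \<in> edges G3"
        then obtain u v where "u \<in> ?A" "v \<in> ?B" "e = {u, v}" using g(8) by blast
        then show "e \<in> (\<lambda>(u, v). {u, v}) ` R3" using e
          by (intro image_eqI[of _ _ "(u, v)"]) (simp_all add: R3_def)
      qed
    qed
    ultimately show ?thesis by (metis card_image)
  qed
  moreover have "dg (graph_rel G1) a + 2 \<le> n" if "a \<in> ?A" for a
    using degree_le_max[OF g(1) that] degree_graph_rel[OF g(1), of a] assms(3) by linarith
  moreover have "dg (graph_rel G2) b + 2 \<le> n" if "b \<in> ?B" for b
    using degree_le_max[OF g(2) that] degree_graph_rel[OF g(2), of b] assms(4) by linarith
  moreover have "dg R3 a < n" if a: "a \<in> ?A" for a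
  proof -
    have "degree G3 a = dg R3 a"
    proof (rule card_edges_at)
      fix e assume e: "e \<in> edges G3" "a \<in> e"
      then obtain u v where uv: "u \<in> ?A" "v \<in> ?B" "e = {u, v}" using g(8) by blast
      then have "u = a" using e(2) a g(6) by blast
      then show "\<exists>w. e = {a, w} \<and> w \<in> R3 `` {a}" using e(1) uv by (auto simp: R3_def)
    qed (auto simp: R3_def)
    then show ?thesis using degree_le_max[OF g(3), of a] a g(7) assms(5) by simp
  qed
  moreover have "dg (R3\<inverse>) b < n" if b: "b \<in> ?B" for b
  proof -
    have "degree G3 b = dg (R3\<inverse>) b"
    proof (rule card_edges_at)
      fix e assume e: "e \<in> edges G3" "b \<in> e"
      then obtain u v where uv: "u \<in> ?A" "v \<in> ?B" "e = {u, v}" using g(8) by blast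
      then have "v = b" using e(2) b g(6) by blast
      then show "\<exists>w. e = {b, w} \<and> w \<in> R3\<inverse> `` {b}" using e(1) uv by (auto simp: R3_def insert_commute)
    qed (auto simp: R3_def insert_commute)
    then show ?thesis using degree_le_max[OF g(3), of b] b g(7) assms(5) by simp
  qed
  moreover have "\<not> exceptional_on ?A ?B (graph_rel G1) (graph_rel G2)"
    using exc_exceptional[OF g(1,2)] g(4,5) assms(7) by auto
  moreover have "\<not> exceptional_on ?B ?A (graph_rel G2) (graph_rel G1)"
    using exc_exceptional[OF g(2,1)] g(4,5) assms(7) exceptional_pair_sym[of G2 G1] by auto
  ultimately have "admissible ?A ?B (graph_rel G1) (graph_rel G2) R3"
    using assms(6) g(4) by (simp add: admissible_def ecard_graph_rel[OF g(1)] ecard_graph_rel[OF g(2)])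
  then obtain f where f: "bij_betw f ?A ?B" "\<And>u v. (u, v) \<in> graph_rel G1 \<Longrightarrow> (f u, f v) \<notin> graph_rel G2"
    "\<And>u. u \<in> ?A \<Longrightarrow> (u, f u) \<notin> R3"
    using admissible_imp_packs_on unfolding packs_on_def by blast
  have "{u, f u} \<notin> edges G3" if u: "u \<in> ?A" for u
    using f(3)[OF u] bij_betwE[OF f(1)] u by (auto simp: R3_def)
  then show ?thesis unfolding packs_def using f(1,2) by auto
qed

end
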